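(* Assume the energy hypothesis (EH) of the context, $0<\delta\le1$, the approximation estimate $$\|Y-\Pi_hY\|_\Omega+h\|G(Y-\Pi_hY)\|_\Omega\lesssim h^r\|Y\|_{H^r(\Omega)}$$ for $Y=U(t),\partial_tU(t),\partial_t^2U(t)$, and the differentiated consistency bounds $$\max_{n_0\le n\le N}\|\rho^n\|_\Omega\lesssim\tau^\nu\mathcal C^\sharp_{T,\nu+2}(U,F),\qquad \|D_\tau^+\rho\|_{\ell_\tau^2(n_0,N-1;\mathcal H)}\lesssim\tau^\nu\mathcal C^\sharp_{T,\nu+2}(U,F).$$ Let $U_h^n\in\mathcal V_h$, $0\le n\le N$, satisfy $U_h^j=\Pi_hU(t^j)$ for $0\le j<n_0$ and $$(A_\tau U_h^n,T_\delta W)_\Omega=(\mathcal M_\tau F(t^n),T_\delta W)_\Omega\qquad\forall W\in\mathcal V_h,\ n_0\le n\le N.$$ Then $$\begin{aligned}\max_{n_0\le n\le N}\|T_\delta(U_h^n-U(t^n))\|_\Omega\lesssim{}&(h^r+\delta h^{r-1})\|U\|_{L^\infty(0,T;H^r(\Omega))}\\&+\bigl((1+T^{1/2})\delta^{1/2}h^{r-1}+\delta^{-1/2}h^r\bigr)\mathcal N_{r,2}(U)\\&+(1+T^{1/2})\tau^\nu\mathcal C^\sharp_{T,\nu+2}(U,F)\\&+\tau^{1/2}(h^r+\tau h^{r-1})\|\partial_tU\|_{L^2(0,T;H^r(\Omega))}\\&+\tau^{1/2}h^{r-1}\|U\|_{L^2(0,T;H^r(\Omega))}+\tau^{\nu+1/2}\mathcal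 C^\sharp_{T,\nu+2}(U,F).\end{aligned}$$ The same right-hand side bounds (up to a constant) the accumulated material-residual dissipation $\bigl(\tau\delta\sum_{n=n_0}^N\|A_\tau\phi^n\|_\Omega^2\bigr)^{1/2}$, where $\phi^n=U_h^n-\Pi_hU(t^n)$.
   Context: Setting. $\Omega\subset\mathbb R^d$ is a Lipschitz domain, $\mathcal H=[L^2(\Omega)]^{n_{\rm sys}}$ with inner product $(\cdot,\cdot)_\Omega$ and norm $\|\cdot\|_\Omega$; $\mathcal V\subset[H^1(\Omega)]^{n_{\rm sys}}$ is dense in $\mathcal H$; $G:\mathcal V\to\mathcal H$ is a time-independent linear first-order differential operator with $(GU,V)_\Omega=-(U,GV)_\Omega$ for all $U,V\in\mathcal V$. $U$ is the exact solution of $\partial_tU+GU=F$ on $(0,T)$, $U(0)=U_0$, assumed regular enough that all quantities below are defined. $\mathcal V_h\subset\mathcal V$ is a conforming finite element space of componentwise polynomial degree at most $k$ on a shape-regular mesh of mesh size $h$; $\Pi_h:\mathcal H\to\mathcal V_h$ is the $L^2$-orthogonal projection; $s\ge1$ is the spatial Sobolev regularity index and $r=\min(s,k+1)$. Time discretisation. $\tau>0$, $t^n=n\tau$ ($0\le n\le N$), $t^N\le T$, $\delta>0$. For sequences and fixed real coefficients $b_0,\dots,b_\ell$: $D_\tau^-V^n=\tau^{-1}(V^n-V^{n-1})$, $D_\tau^+V^n=\tau^{-1}(V^{n+1}-V^n)$, $\mathcal M_\tau V^n=\sum_{j=0}^\ell b_jV^{n-j}$ (also for sampled functions). The first computed index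 $n_0$ satisfies $n_0\ge\ell$, $1\le n_0\le N$. Operators: $T_\delta=\mathrm{Id}+\delta G$, $S_\delta=\mathcal M_\tau+\delta D_\tau^-$, $A_\tau=D_\tau^-+G\mathcal M_\tau$, $P_\delta=T_\delta S_\delta$. Local truncation residual: $\rho^n=D_\tau^-U(t^n)+G\mathcal M_\tau U(t^n)-\mathcal M_\tau F(t^n)$. The method has temporal order $\nu$: standing assumption $\|\rho\|_{\ell_\tau^2(n_0,N;\mathcal H)}\lesssim\tau^\nu\mathcal C_{T,\nu+1}(U,F)$, where $\mathcal C_{T,\nu+1}(U,F)$ is an $L^2$-in-time regularity quantity; $\mathcal C^\sharp_{T,\nu+2}(U,F)\ge\mathcal C_{T,\nu+1}(U,F)$ is a regularity quantity containing one additional time derivative and endpoint regularity. Norms. $e_\tau^n(V),d_\tau^n(V)\ge0$ ($n_0\le n\le N$) are given method-dependent energy and dissipation quantities depending only on $V^j$, $j\le n$. For $n_0\le m\le N$: $\|V\|_{\mathcal E,m}^2=\max_{n_0\le j\le m}e_\tau^j(V)+\tau\sum_{n=n_0}^md_\tau^n(V)$; $\mathcal I_\tau(V)=\sum_{j=0}^{n_0-1}\|T_\delta V^j\|_\Omega^2$; $\|R\|_{\ell_\tau^2(a,b;\mathcal H)}^2=\tau\sum_{n=a}^b\|R^n\|_\Omega^2$. Also $$\mathcal N_{r,2}(U)=\sum_{j=0}^2\|\partial_t^jU\|_{L^2(0,T;H^r(\Omega))}+\sum_{j=0}^1\|\partial_t^jU\|_{L^\infty(0,T;H^r(\Omega))}.$$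 Energy hypothesis (EH). There are $c_E,C_E>0$, independent of $h,\tau,m$, such that for all $\mathcal V_h$-valued sequences $V$ and all $n_0\le m,n\le N$: $c_E\|T_\delta V^m\|_\Omega^2\le e_\tau^m(V)$, $c_E\,\delta\|A_\tau V^n\|_\Omega^2\le d_\tau^n(V)$; and, for every $\mathcal H$-valued $(R^n)$, every $\mathcal V_h$-valued solution $V$ of $(A_\tau V^n,T_\delta W)_\Omega=(R^n,T_\delta W)_\Omega$ for all $W\in\mathcal V_h$, $n_0\le n\le N$, satisfies for every $n_0\le m\le N$ $$e_\tau^m(V)+\tau\sum_{n=n_0}^m d_\tau^n(V)\le C_E\mathcal I_\tau(V)+C_E\tau\sum_{n=n_0}^m(R^n,P_\delta V^n)_\Omega+C_E\tau\|R\|_{\ell_\tau^2(n_0,m;\mathcal H)}^2 .$$ Convention: $a\lesssim b$ means $a\le Cb$ with $C>0$ independent of the mesh size $h$, the time step $\tau$ and the final index $N$. *)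

theory Defs
  imports "HOL-Analysis.Analysis" "HOL-Library.Multiset" "HOL-Probability.Essential_Supremum"
begin

(* Elements of [L^2(Omega)]^n are represented by functions on R^d that only matter up to equality
   almost everywhere in Omega; every identity between such elements is stated in that sense. *)

type_synonym ('d, 'm) field = "real^'d \<Rightarrow> real^'m"

section \<open>Lipschitz domains\<close>

text \<open>Near each boundary point the domain lies strictly above the graph, in the direction of a unit
  vector \<open>e\<close>, of a Lipschitz function \<open>\<gamma>\<close> of the component orthogonal to \<open>e\<close>.\<close>

definition lipschitz_domain :: "(real^'d) set \<Rightarrow> bool" where
  "lipschitz_domain \<Omega> \<longleftrightarrow>
     open \<Omega> \<and> connected \<Omega> \<and> bounded \<Omega> \<and> \<Omega> \<noteq> {} \<and>
     (\<forall>x\<in>frontier \<Omega>. \<exists>e \<gamma> L \<rho>. norm e = 1 \<and> L-lipschitz_on UNIV \<gamma> \<and> 0 < \<rho> \<and>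
        (\<forall>y\<in>ball x \<rho>. y \<in> \<Omega> \<longleftrightarrow> (\<gamma> (y - (y \<bullet> e) *\<^sub>R e) :: real) < y \<bullet> e))"

section \<open>Square-integrable fields\<close>

definition L2 :: "(real^'d) set \<Rightarrow> ('d::finite, 'm::finite) field set" where
  "L2 \<Omega> = {u. u \<in> borel_measurable (lebesgue_on \<Omega>) \<and>
               integrable (lebesgue_on \<Omega>) (\<lambda>x. (norm (u x))\<^sup>2)}"

definition ip :: "(real^'d) set \<Rightarrow> ('d::finite, 'm::finite) field \<Rightarrow> ('d, 'm) field \<Rightarrow> real" where
  "ip \<Omega> u v = (LINT x|lebesgue_on \<Omega>. u x \<bullet> v x)"

definition l2norm :: "(real^'d) set \<Rightarrow> ('d::finite, 'm::finite) field \<Rightarrow> real" where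
  "l2norm \<Omega> u = sqrt (ip \<Omega> u u)"

definition eq_ae :: "(real^'d) set \<Rightarrow> ('d::finite, 'm::finite) field \<Rightarrow> ('d, 'm) field \<Rightarrow> bool" where
  "eq_ae \<Omega> u v \<longleftrightarrow> (AE x in lebesgue_on \<Omega>. u x = v x)"

definition lin_subspace :: "('d::finite, 'm::finite) field set \<Rightarrow> bool" where
  "lin_subspace S \<longleftrightarrow> (\<lambda>x. 0) \<in> S \<and>
     (\<forall>u\<in>S. \<forall>v\<in>S. \<forall>a b. (\<lambda>x. a *\<^sub>R u x + b *\<^sub>R v x) \<in> S)"

definition l2_dense :: "(real^'d) set \<Rightarrow> ('d::finite, 'm::finite) field set \<Rightarrow> bool" where
  "l2_dense \<Omega> S \<longleftrightarrow> (\<forall>u\<in>L2 \<Omega>. \<forall>\<epsilon>>0. \<exists>v\<in>S. l2norm \<Omega> (\<lambda>x. u x - v x) < \<epsilon>)"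

section \<open>Weak derivatives and Sobolev spaces\<close>

fun partials :: "'d list \<Rightarrow> (real^'d \<Rightarrow> real) \<Rightarrow> real^'d \<Rightarrow> real" where
  "partials [] f = f"
| "partials (i # is) f = (\<lambda>x. frechet_derivative (partials is f) (at x) (axis i 1))"

text \<open>If all iterated partial derivatives are differentiable they are continuous, so the first
  condition says that \<open>\<phi>\<close> is infinitely differentiable.\<close>

definition test_functions :: "(real^'d) set \<Rightarrow> (real^'d \<Rightarrow> real) set" where
  "test_functions \<Omega> = {\<phi>. (\<forall>is x. partials is \<phi> differentiable at x) \<and>
     compact (closure {x. \<phi> x \<noteq> 0}) \<and> closure {x. \<phi> x \<noteq> 0} \<subseteq> \<Omega>}"

definition has_weak_partials ::
    "(real^'d) set \<Rightarrow> 'd list \<Rightarrow> ('d::finite, 'm::finite) field \<Rightarrow> ('d, 'm) field \<Rightarrow> bool" where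
  "has_weak_partials \<Omega> is u w \<longleftrightarrow> w \<in> L2 \<Omega> \<and>
     (\<forall>\<phi>\<in>test_functions \<Omega>.
        (LINT x|lebesgue_on \<Omega>. partials is \<phi> x *\<^sub>R u x)
          = (-1) ^ length is *\<^sub>R (LINT x|lebesgue_on \<Omega>. \<phi> x *\<^sub>R w x))"

definition weak_partials :: "(real^'d) set \<Rightarrow> 'd list \<Rightarrow> ('d::finite, 'm::finite) field \<Rightarrow> ('d, 'm) field" where
  "weak_partials \<Omega> is u = (SOME w. has_weak_partials \<Omega> is u w)"

text \<open>Multi-indices are multisets of coordinate directions; the order in which the derivatives of
  a test function are taken is irrelevant.\<close>

definition dirs :: "'d multiset \<Rightarrow> 'd list" where
  "dirs \<alpha> = (SOME is. mset is = \<alpha>)"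

definition slobodeckij :: "(real^'d) set \<Rightarrow> real \<Rightarrow> ('d::finite, 'm::finite) field \<Rightarrow> ennreal" where
  "slobodeckij \<Omega> \<sigma> w =
     (\<integral>\<^sup>+x. (\<integral>\<^sup>+y. ennreal ((norm (w x - w y))\<^sup>2 / norm (x - y) powr (real CARD('d) + 2 * \<sigma>))
        \<partial>lebesgue_on \<Omega>) \<partial>lebesgue_on \<Omega>)"

text \<open>The order \<open>r \<ge> 0\<close> may be fractional; the norm is then the Sobolev--Slobodeckij norm.\<close>

definition sobolev_sq :: "(real^'d) set \<Rightarrow> real \<Rightarrow> ('d::finite, 'm::finite) field \<Rightarrow> ennreal" where
  "sobolev_sq \<Omega> r u =
     (\<Sum>\<alpha> | size \<alpha> \<le> nat \<lfloor>r\<rfloor>. \<integral>\<^sup>+x. ennreal ((norm (weak_partials \<Omega> (dirs \<alpha>) u x))\<^sup>2) \<partial>lebesgue_on \<Omega>)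
     + (if frac r = 0 then 0
        else \<Sum>\<alpha> | size \<alpha> = nat \<lfloor>r\<rfloor>. slobodeckij \<Omega> (frac r) (weak_partials \<Omega> (dirs \<alpha>) u))"

definition sobolev :: "(real^'d) set \<Rightarrow> real \<Rightarrow> ('d::finite, 'm::finite) field set" where
  "sobolev \<Omega> r = {u\<in>L2 \<Omega>.
     (\<forall>\<alpha>. size \<alpha> \<le> nat \<lfloor>r\<rfloor> \<longrightarrow> (\<exists>w. has_weak_partials \<Omega> (dirs \<alpha>) u w)) \<and> sobolev_sq \<Omega> r u < \<infinity>}"

definition sobolev_norm :: "(real^'d) set \<Rightarrow> real \<Rightarrow> ('d::finite, 'm::finite) field \<Rightarrow> real" where
  "sobolev_norm \<Omega> r u = sqrt (enn2real (sobolev_sq \<Omega> r u))"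

section \<open>The evolution operator\<close>

definition first_order_operator ::
    "(real^'d) set \<Rightarrow> ('d::finite, 'm::finite) field set \<Rightarrow> (('d, 'm) field \<Rightarrow> ('d, 'm) field) \<Rightarrow> bool" where
  "first_order_operator \<Omega> \<V> G \<longleftrightarrow>
     (\<forall>u\<in>\<V>. G u \<in> L2 \<Omega>) \<and>
     (\<forall>u\<in>\<V>. \<forall>v\<in>\<V>. \<forall>a b.
        eq_ae \<Omega> (G (\<lambda>x. a *\<^sub>R u x + b *\<^sub>R v x)) (\<lambda>x. a *\<^sub>R G u x + b *\<^sub>R G v x)) \<and>
     (\<exists>(A :: 'd \<Rightarrow> real^'d \<Rightarrow> real^'m^'m) B.
        (\<forall>i. A i \<in> borel_measurable (lebesgue_on \<Omega>)) \<and> B \<in> borel_measurable (lebesgue_on \<Omega>) \<and>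
        (\<forall>u\<in>\<V>. eq_ae \<Omega> (G u)
           (\<lambda>x. (\<Sum>i\<in>UNIV. A i x *v weak_partials \<Omega> [i] u x) + B x *v u x)))"

definition skew_symmetric ::
    "(real^'d) set \<Rightarrow> ('d::finite, 'm::finite) field set \<Rightarrow> (('d, 'm) field \<Rightarrow> ('d, 'm) field) \<Rightarrow> bool" where
  "skew_symmetric \<Omega> \<V> G \<longleftrightarrow> (\<forall>u\<in>\<V>. \<forall>v\<in>\<V>. ip \<Omega> (G u) v = - ip \<Omega> u (G v))"

section \<open>Functions of time and the exact solution\<close>

definition has_time_derivative ::
    "(real^'d) set \<Rightarrow> real \<Rightarrow> (real \<Rightarrow> ('d::finite, 'm::finite) field) \<Rightarrow> (real \<Rightarrow> ('d, 'm) field) \<Rightarrow> bool" where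
  "has_time_derivative \<Omega> T U U' \<longleftrightarrow> (\<forall>t\<in>{0..T}.
     ((\<lambda>s. l2norm \<Omega> (\<lambda>x. (U s x - U t x) /\<^sub>R (s - t) - U' t x)) \<longlongrightarrow> 0) (at t within {0..T}))"

definition L2H :: "(real^'d) set \<Rightarrow> real \<Rightarrow> real \<Rightarrow> (real \<Rightarrow> ('d::finite, 'm::finite) field) set" where
  "L2H \<Omega> r T = {V. (\<lambda>t. sobolev_norm \<Omega> r (V t)) \<in> borel_measurable (lebesgue_on {0<..<T}) \<and>
     integrable (lebesgue_on {0<..<T}) (\<lambda>t. (sobolev_norm \<Omega> r (V t))\<^sup>2)}"

definition L2H_norm :: "(real^'d) set \<Rightarrow> real \<Rightarrow> real \<Rightarrow> (real \<Rightarrow> ('d::finite, 'm::finite) field) \<Rightarrow> real" where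
  "L2H_norm \<Omega> r T V = sqrt (LINT t|lebesgue_on {0<..<T}. (sobolev_norm \<Omega> r (V t))\<^sup>2)"

definition LinfH :: "(real^'d) set \<Rightarrow> real \<Rightarrow> real \<Rightarrow> (real \<Rightarrow> ('d::finite, 'm::finite) field) set" where
  "LinfH \<Omega> r T = {V. (\<lambda>t. sobolev_norm \<Omega> r (V t)) \<in> borel_measurable (lebesgue_on {0<..<T}) \<and>
     (\<exists>B. AE t in lebesgue_on {0<..<T}. sobolev_norm \<Omega> r (V t) \<le> B)}"

definition LinfH_norm :: "(real^'d) set \<Rightarrow> real \<Rightarrow> real \<Rightarrow> (real \<Rightarrow> ('d::finite, 'm::finite) field) \<Rightarrow> real" where
  "LinfH_norm \<Omega> r T V =
     real_of_ereal (esssup (lebesgue_on {0<..<T}) (\<lambda>t. ereal (sobolev_norm \<Omega> r (V t))))"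

text \<open>The derivative is taken in the \<open>L\<^sup>2\<close> norm, one-sided at the end points of \<open>{0..T}\<close>; \<open>esssup\<close> is
  finite on \<open>LinfH\<close>, so the conversion to a real loses nothing there.

  In the following, \<open>dU j\<close> is the \<open>j\<close>-th time derivative of the solution, for \<open>j \<le> 2\<close>. The
  regularity conditions are those under which all norms of the error estimate are defined.\<close>

definition exact_solution ::
    "(real^'d) set \<Rightarrow> ('d::finite, 'm::finite) field set \<Rightarrow> (('d, 'm) field \<Rightarrow> ('d, 'm) field) \<Rightarrow> real \<Rightarrow> real \<Rightarrow>
     (real \<Rightarrow> ('d, 'm) field) \<Rightarrow> ('d, 'm) field \<Rightarrow> (nat \<Rightarrow> real \<Rightarrow> ('d, 'm) field) \<Rightarrow> bool" where
  "exact_solution \<Omega> \<V> G r T F U0 dU \<longleftrightarrow>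
     (\<forall>j<2. has_time_derivative \<Omega> T (dU j) (dU (Suc j))) \<and>
     (\<forall>j\<le>2. (\<forall>t\<in>{0..T}. dU j t \<in> \<V> \<inter> sobolev \<Omega> r) \<and> dU j \<in> L2H \<Omega> r T) \<and>
     (\<forall>j\<le>1. dU j \<in> LinfH \<Omega> r T) \<and>
     U0 \<in> L2 \<Omega> \<and> (\<forall>t\<in>{0..T}. F t \<in> L2 \<Omega>) \<and>
     eq_ae \<Omega> (dU 0 0) U0 \<and>
     (\<forall>t\<in>{0<..<T}. eq_ae \<Omega> (\<lambda>x. dU 1 t x + G (dU 0 t) x) (F t))"

definition reg_norm2 ::
    "(real^'d) set \<Rightarrow> real \<Rightarrow> real \<Rightarrow> (nat \<Rightarrow> real \<Rightarrow> ('d::finite, 'm::finite) field) \<Rightarrow> real" where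
  "reg_norm2 \<Omega> r T dU = (\<Sum>j\<le>2. L2H_norm \<Omega> r T (dU j)) + (\<Sum>j\<le>1. LinfH_norm \<Omega> r T (dU j))"

section \<open>Finite element spaces\<close>

text \<open>Shape regularity: every cell is star-shaped with respect to a ball whose radius is at least
  \<open>\<kappa>\<close> times the diameter of the cell. For convex cells (simplices, parallelotopes) this is the
  usual bound on the ratio of inradius and diameter; curved cells are admitted because the domain
  need not be polyhedral.\<close>

definition star_shaped_ball :: "(real^'d) set \<Rightarrow> real^'d \<Rightarrow> real \<Rightarrow> bool" where
  "star_shaped_ball K c \<rho> \<longleftrightarrow> (\<forall>x\<in>K. convex hull (insert x (cball c \<rho>)) \<subseteq> K)"

definition shape_regular_mesh :: "(real^'d) set \<Rightarrow> real \<Rightarrow> (real^'d) set set \<Rightarrow> bool" where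
  "shape_regular_mesh \<Omega> \<kappa> \<T> \<longleftrightarrow>
     finite \<T> \<and> \<Union>\<T> = closure \<Omega> \<and>
     (\<forall>K\<in>\<T>. compact K \<and> interior K \<noteq> {} \<and> (\<exists>c. star_shaped_ball K c (\<kappa> * diameter K))) \<and>
     pairwise (\<lambda>K L. interior K \<inter> interior L = {}) \<T>"

definition mesh_size :: "(real^'d) set set \<Rightarrow> real" where
  "mesh_size \<T> = Max (diameter ` \<T>)"

definition poly_on :: "nat \<Rightarrow> (real^'d) set \<Rightarrow> (real^'d \<Rightarrow> real) \<Rightarrow> bool" where
  "poly_on k K f \<longleftrightarrow> (\<exists>c. AE x in lebesgue_on K.
     f x = (\<Sum>\<alpha> | size \<alpha> \<le> k. c \<alpha> * (\<Prod>j\<in>UNIV. (x $ j) ^ count \<alpha> j)))"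

definition fe_space ::
    "('d::finite, 'm::finite) field set \<Rightarrow> nat \<Rightarrow> (real^'d) set set \<Rightarrow> ('d, 'm) field set \<Rightarrow> bool" where
  "fe_space \<V> k \<T> Vh \<longleftrightarrow> lin_subspace Vh \<and> Vh \<subseteq> \<V> \<and>
     (\<forall>v\<in>Vh. \<forall>K\<in>\<T>. \<forall>i. poly_on k (interior K) (\<lambda>x. v x $ i))"

definition l2_projection ::
    "(real^'d) set \<Rightarrow> ('d::finite, 'm::finite) field set \<Rightarrow> (('d, 'm) field \<Rightarrow> ('d, 'm) field) \<Rightarrow> bool" where
  "l2_projection \<Omega> Vh P \<longleftrightarrow>
     (\<forall>u\<in>L2 \<Omega>. P u \<in> Vh \<and> (\<forall>w\<in>Vh. ip \<Omega> (\<lambda>x. u x - P u x) w = 0))"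

section \<open>Time discretisation\<close>

text \<open>The indices \<open>n - 1\<close> and \<open>n - j\<close> below are only used for \<open>n \<ge> n0\<close> with \<open>n0 \<ge> 1\<close> and \<open>n0 \<ge> l\<close>, so that
  the subtraction is never truncated.\<close>

definition Dminus :: "real \<Rightarrow> (nat \<Rightarrow> ('d::finite, 'm::finite) field) \<Rightarrow> nat \<Rightarrow> ('d, 'm) field" where
  "Dminus \<tau> V n = (\<lambda>x. (V n x - V (n - 1) x) /\<^sub>R \<tau>)"

definition Dplus :: "real \<Rightarrow> (nat \<Rightarrow> ('d::finite, 'm::finite) field) \<Rightarrow> nat \<Rightarrow> ('d, 'm) field" where
  "Dplus \<tau> V n = (\<lambda>x. (V (n + 1) x - V n x) /\<^sub>R \<tau>)"

definition Mavg :: "nat \<Rightarrow> (nat \<Rightarrow> real) \<Rightarrow> (nat \<Rightarrow> ('d::finite, 'm::finite) field) \<Rightarrow> nat \<Rightarrow> ('d, 'm) field" where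
  "Mavg l b V n = (\<lambda>x. \<Sum>j\<le>l. b j *\<^sub>R V (n - j) x)"

definition sampled :: "real \<Rightarrow> (real \<Rightarrow> ('d::finite, 'm::finite) field) \<Rightarrow> nat \<Rightarrow> ('d, 'm) field" where
  "sampled \<tau> U n = U (real n * \<tau>)"

definition Top :: "(('d::finite, 'm::finite) field \<Rightarrow> ('d, 'm) field) \<Rightarrow> real \<Rightarrow> ('d, 'm) field \<Rightarrow> ('d, 'm) field" where
  "Top G \<delta> u = (\<lambda>x. u x + \<delta> *\<^sub>R G u x)"

definition Sop ::
    "nat \<Rightarrow> (nat \<Rightarrow> real) \<Rightarrow> real \<Rightarrow> real \<Rightarrow> (nat \<Rightarrow> ('d::finite, 'm::finite) field) \<Rightarrow> nat \<Rightarrow> ('d, 'm) field" where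
  "Sop l b \<tau> \<delta> V n = (\<lambda>x. Mavg l b V n x + \<delta> *\<^sub>R Dminus \<tau> V n x)"

definition Aop ::
    "(('d::finite, 'm::finite) field \<Rightarrow> ('d, 'm) field) \<Rightarrow> nat \<Rightarrow> (nat \<Rightarrow> real) \<Rightarrow> real \<Rightarrow>
     (nat \<Rightarrow> ('d, 'm) field) \<Rightarrow> nat \<Rightarrow> ('d, 'm) field" where
  "Aop G l b \<tau> V n = (\<lambda>x. Dminus \<tau> V n x + G (Mavg l b V n) x)"

definition Pop ::
    "(('d::finite, 'm::finite) field \<Rightarrow> ('d, 'm) field) \<Rightarrow> nat \<Rightarrow> (nat \<Rightarrow> real) \<Rightarrow> real \<Rightarrow> real \<Rightarrow>
     (nat \<Rightarrow> ('d, 'm) field) \<Rightarrow> nat \<Rightarrow> ('d, 'm) field" where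
  "Pop G l b \<tau> \<delta> V n = Top G \<delta> (Sop l b \<tau> \<delta> V n)"

definition residual ::
    "(('d::finite, 'm::finite) field \<Rightarrow> ('d, 'm) field) \<Rightarrow> nat \<Rightarrow> (nat \<Rightarrow> real) \<Rightarrow> real \<Rightarrow>
     (real \<Rightarrow> ('d, 'm) field) \<Rightarrow> (real \<Rightarrow> ('d, 'm) field) \<Rightarrow> nat \<Rightarrow> ('d, 'm) field" where
  "residual G l b \<tau> U F n =
     (\<lambda>x. Dminus \<tau> (sampled \<tau> U) n x + G (Mavg l b (sampled \<tau> U) n) x - Mavg l b (sampled \<tau> F) n x)"

definition lt2norm ::
    "(real^'d) set \<Rightarrow> real \<Rightarrow> nat \<Rightarrow> nat \<Rightarrow> (nat \<Rightarrow> ('d::finite, 'm::finite) field) \<Rightarrow> real" where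
  "lt2norm \<Omega> \<tau> a c R = sqrt (\<tau> * (\<Sum>n=a..c. (l2norm \<Omega> (R n))\<^sup>2))"

definition Iinit ::
    "(real^'d) set \<Rightarrow> (('d::finite, 'm::finite) field \<Rightarrow> ('d, 'm) field) \<Rightarrow> real \<Rightarrow> nat \<Rightarrow> (nat \<Rightarrow> ('d, 'm) field) \<Rightarrow> real"
  where "Iinit \<Omega> G \<delta> n0 V = (\<Sum>j<n0. (l2norm \<Omega> (Top G \<delta> (V j)))\<^sup>2)"

section \<open>The energy hypothesis\<close>

text \<open>\<open>energy_quantity\<close> is required of both the energies \<open>e n\<close> and the dissipations \<open>d n\<close>: they are
  nonnegative and depend only on the terms of index at most \<open>n\<close>.\<close>

definition energy_quantity ::
    "(real^'d) set \<Rightarrow> ('d::finite, 'm::finite) field set \<Rightarrow> nat \<Rightarrow> nat \<Rightarrow>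
     (nat \<Rightarrow> (nat \<Rightarrow> ('d, 'm) field) \<Rightarrow> real) \<Rightarrow> bool" where
  "energy_quantity \<Omega> Vh n0 N e \<longleftrightarrow> (\<forall>n\<in>{n0..N}.
     (\<forall>V. (\<forall>j\<le>N. V j \<in> Vh) \<longrightarrow> 0 \<le> e n V) \<and>
     (\<forall>V W. (\<forall>j\<le>N. V j \<in> Vh \<and> W j \<in> Vh) \<and> (\<forall>j\<le>n. eq_ae \<Omega> (V j) (W j)) \<longrightarrow> e n V = e n W))"

definition energy_hypothesis ::
    "(real^'d) set \<Rightarrow> (('d::finite, 'm::finite) field \<Rightarrow> ('d, 'm) field) \<Rightarrow> nat \<Rightarrow> (nat \<Rightarrow> real) \<Rightarrow> nat \<Rightarrow>
     real \<Rightarrow> real \<Rightarrow> ('d, 'm) field set \<Rightarrow> real \<Rightarrow> real \<Rightarrow> nat \<Rightarrow>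
     (nat \<Rightarrow> (nat \<Rightarrow> ('d, 'm) field) \<Rightarrow> real) \<Rightarrow> (nat \<Rightarrow> (nat \<Rightarrow> ('d, 'm) field) \<Rightarrow> real) \<Rightarrow> bool" where
  "energy_hypothesis \<Omega> G l b n0 cE CE Vh \<delta> \<tau> N e d \<longleftrightarrow>
     (\<forall>V. (\<forall>j\<le>N. V j \<in> Vh) \<longrightarrow>
        (\<forall>n\<in>{n0..N}.
           cE * (l2norm \<Omega> (Top G \<delta> (V n)))\<^sup>2 \<le> e n V \<and>
           cE * \<delta> * (l2norm \<Omega> (Aop G l b \<tau> V n))\<^sup>2 \<le> d n V) \<and>
        (\<forall>R. (\<forall>n\<in>{n0..N}. R n \<in> L2 \<Omega>) \<and>
             (\<forall>n\<in>{n0..N}. \<forall>W\<in>Vh. ip \<Omega> (Aop G l b \<tau> V n) (Top G \<delta> W) = ip \<Omega> (R n) (Top G \<delta> W)) \<longrightarrow>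
           (\<forall>m\<in>{n0..N}.
              e m V + \<tau> * (\<Sum>n=n0..m. d n V)
                \<le> CE * Iinit \<Omega> G \<delta> n0 V
                  + CE * \<tau> * (\<Sum>n=n0..m. ip \<Omega> (R n) (Pop G l b \<tau> \<delta> V n))
                  + CE * \<tau> * (lt2norm \<Omega> \<tau> n0 m R)\<^sup>2)))"

section \<open>The right-hand side of the error estimate\<close>

text \<open>\<open>Cs\<close> stands for the regularity quantity of order \<open>\<nu> + 2\<close> of the data and the solution.\<close>

definition error_bound ::
    "(real^'d) set \<Rightarrow> real \<Rightarrow> real \<Rightarrow> nat \<Rightarrow> real \<Rightarrow> real \<Rightarrow> real \<Rightarrow>
     (nat \<Rightarrow> real \<Rightarrow> ('d::finite, 'm::finite) field) \<Rightarrow> real \<Rightarrow> real" where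
  "error_bound \<Omega> r T \<nu> \<delta> h \<tau> dU Cs =
     (h powr r + \<delta> * h powr (r - 1)) * LinfH_norm \<Omega> r T (dU 0)
     + ((1 + sqrt T) * sqrt \<delta> * h powr (r - 1) + \<delta> powr (- 1/2) * h powr r) * reg_norm2 \<Omega> r T dU
     + (1 + sqrt T) * \<tau> ^ \<nu> * Cs
     + sqrt \<tau> * (h powr r + \<tau> * h powr (r - 1)) * L2H_norm \<Omega> r T (dU 1)
     + sqrt \<tau> * h powr (r - 1) * L2H_norm \<Omega> r T (dU 0)
     + \<tau> powr (real \<nu> + 1/2) * Cs"

end

theory Submission
  imports Defs "HOL-Library.Function_Algebras"
begin

text \<open>
  Write \<open>\<eta> = U - \<Pi>\<^sub>hU\<close> and \<open>\<phi> = U\<^sub>h - \<Pi>\<^sub>hU\<close>. The discrete error \<open>\<phi>\<close> solves the scheme with right-hand side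
  \<open>R = A\<^sub>\<tau>\<eta> - \<rho>\<close> and vanishing initial values, so the energy hypothesis bounds its squared energy norm
  by \<open>\<tau> \<Sum> (R, P\<^sub>\<delta>\<phi>)\<close> and a harmless square of \<open>R\<close>. What has to be shown is that the pairing is
  linear in the energy norm, with a factor of the right order. The multiplier expands to
  \<open>P\<^sub>\<delta>\<phi> = M\<phi> + \<delta> A\<^sub>\<tau>\<phi> + \<delta>\<^sup>2 G D\<phi>\<close>, with \<open>M\<close> the weighted average and \<open>D\<close> the backward difference
  quotient, and each part needs its own reason.

  Against \<open>M\<phi>\<close>, the term \<open>D\<eta>\<close> of \<open>R\<close> vanishes because \<open>\<eta>\<close> is orthogonal to the discrete space. In the
  term \<open>G M\<eta>\<close>, skew symmetry moves \<open>G\<close> onto \<open>M\<phi>\<close>, and \<open>G M\<phi> = A\<^sub>\<tau>\<phi> - D\<phi>\<close>, where \<open>D\<phi>\<close> is again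
  orthogonal to \<open>M\<eta>\<close>; what remains is \<open>(M\<eta>, A\<^sub>\<tau>\<phi>)\<close>, which the dissipation absorbs at the price of
  \<open>\<delta>\<close> to the power \<open>-1/2\<close> but without losing a power of \<open>h\<close> (\<open>forcing_multiplier\<close>). The part
  \<open>\<delta> A\<^sub>\<tau>\<phi>\<close> is bounded by the dissipation directly. The part \<open>\<delta>\<^sup>2 G D\<phi>\<close> is controlled by neither energy nor dissipation;
  summation by parts in time shifts the difference quotient to \<open>R\<close> and leaves \<open>\<delta> G\<phi>\<close>, which the
  energy controls (\<open>second_order_part_le\<close>). This is where the second time derivative of \<open>U\<close>
  and the difference quotient of the truncation residual enter. A quadratic inequality then gives
  \<open>stability\<close>.

  It remains to bound sampled values, first and second differences of \<open>\<eta>\<close>, and values and first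
  differences of \<open>G \<eta>\<close>, by Bochner norms in time. The solution is differentiable in the \<open>L\<^sup>2\<close> norm
  only, and \<open>G\<close> is unbounded. Testing with a fixed vector turns paths into real functions,
  to which the fundamental theorem of calculus for the gauge integral applies; for \<open>G \<eta>\<close>, skew symmetry moves
  \<open>G\<close> to the test vector, and vectors from the dense domain suffice as test vectors
  (\<open>increment_le\<close>, \<open>controlled_G_path\<close>). Bounds that are uniform in time follow from the \<open>L\<^sup>2\<close> norms
  of a path and its derivative by a trace inequality on intervals (\<open>controlled_trace\<close>), so the constant
  of the final estimate depends on \<open>T\<close>.

  All of this takes place in a real vector space with a semi-inner product. Identities that hold almost
  everywhere enter in tested form or as vectors of norm zero, hence no quotient by null functions is formed.
\<close>

section \<open>Fields as vectors\<close>

text \<open>With pointwise operations the square-integrable fields form a subspace of a real vector space,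
  and equality almost everywhere becomes equality up to a vector of norm zero.\<close>

instantiation "fun" :: (type, real_vector) real_vector
begin

definition scaleR_fun :: "real \<Rightarrow> ('a \<Rightarrow> 'b) \<Rightarrow> 'a \<Rightarrow> 'b" where
  "scaleR_fun c f = (\<lambda>x. c *\<^sub>R f x)"

instance
  by standard (simp_all add: scaleR_fun_def fun_eq_iff scaleR_add_right scaleR_add_left)

end

lemma scaleR_fun_apply [simp]: "(c *\<^sub>R f) x = c *\<^sub>R f x"
  by (simp add: scaleR_fun_def)

lemma sum_fun_apply: "(\<Sum>i\<in>A. f i) x = (\<Sum>i\<in>A. f i x)"
  by (induction A rule: infinite_finite_induct) auto

section \<open>Square-integrable functions of time\<close>

text \<open>Stated with the gauge integral on the closed interval, the form in which the fundamental theorem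
  of calculus is applied.\<close>

definition sq_integrable :: "real \<Rightarrow> (real \<Rightarrow> real) \<Rightarrow> bool" where
  "sq_integrable T g \<longleftrightarrow> (\<forall>t\<in>{0..T}. 0 \<le> g t) \<and> g integrable_on {0..T} \<and>
     (\<lambda>t. (g t)\<^sup>2) integrable_on {0..T}"

definition l2time :: "real \<Rightarrow> (real \<Rightarrow> real) \<Rightarrow> real" where
  "l2time T g = sqrt (integral {0..T} (\<lambda>t. (g t)\<^sup>2))"

lemma sq_integrableD:
  assumes "sq_integrable T g" "0 \<le> a" "b \<le> T"
  shows "g integrable_on {a..b}" "(\<lambda>t. (g t)\<^sup>2) integrable_on {a..b}"
    "\<And>t. t \<in> {a..b} \<Longrightarrow> 0 \<le> g t"
    "0 \<le> integral {a..b} g" "0 \<le> integral {a..b} (\<lambda>t. (g t)\<^sup>2)"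
proof -
  have s: "{a..b} \<subseteq> {0..T}" using assms by auto
  show 1: "g integrable_on {a..b}" "(\<lambda>t. (g t)\<^sup>2) integrable_on {a..b}"
    using assms(1) integrable_on_subinterval[OF _ s] by (auto simp: sq_integrable_def)
  show 2: "0 \<le> g t" if "t \<in> {a..b}" for t
    using assms that by (auto simp: sq_integrable_def)
  show "0 \<le> integral {a..b} g" "0 \<le> integral {a..b} (\<lambda>t. (g t)\<^sup>2)"
    using 1 2 by (auto intro: integral_nonneg)
qed

lemma l2time_nonneg [simp]: "0 \<le> l2time T g"
  by (cases "(\<lambda>t. (g t)\<^sup>2) integrable_on {0..T}")
    (auto simp: l2time_def integral_nonneg not_integrable_integral)

lemma l2time_sq: "(l2time T g)\<^sup>2 = integral {0..T} (\<lambda>t. (g t)\<^sup>2)"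
  by (cases "(\<lambda>t. (g t)\<^sup>2) integrable_on {0..T}")
    (auto simp: l2time_def integral_nonneg not_integrable_integral)

lemma sq_integrable_scale:
  assumes "sq_integrable T g" "0 \<le> c"
  shows "sq_integrable T (\<lambda>t. c * g t)"
  using assms by (auto simp: sq_integrable_def power_mult_distrib
      intro!: integrable_on_mult_right)

lemma l2time_scale: "0 \<le> c \<Longrightarrow> l2time T (\<lambda>t. c * g t) = c * l2time T g"
  by (simp add: l2time_def power_mult_distrib real_sqrt_mult)

text \<open>The Cauchy--Schwarz inequality against the constant function, from the nonnegative variance
  of \<open>g\<close> around its mean.\<close>

lemma square_of_integral_le:
  fixes g :: "real \<Rightarrow> real"
  assumes "a \<le> b" "g integrable_on {a..b}" "(\<lambda>t. (g t)\<^sup>2) integrable_on {a..b}"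
  shows "(integral {a..b} g)\<^sup>2 \<le> (b - a) * integral {a..b} (\<lambda>t. (g t)\<^sup>2)"
proof (cases "a = b")
  case False
  then have ab: "0 < b - a" using assms(1) by simp
  define m where "m = integral {a..b} g / (b - a)"
  have I: "((\<lambda>t. (g t)\<^sup>2 - 2 * m * g t + m\<^sup>2) has_integral
     (integral {a..b} (\<lambda>t. (g t)\<^sup>2) - 2 * m * integral {a..b} g + m\<^sup>2 * (b - a))) {a..b}"
    using has_integral_const_real[of "m\<^sup>2" a b] assms
    by (intro has_integral_add has_integral_diff has_integral_mult_right)
      (auto simp: integrable_integral mult.commute)
  have "0 \<le> integral {a..b} (\<lambda>t. (g t)\<^sup>2) - 2 * m * integral {a..b} g + m\<^sup>2 * (b - a)"
  proof (rule has_integral_nonneg[OF I])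
    fix t
    have "(g t)\<^sup>2 - 2 * m * g t + m\<^sup>2 = (g t - m)\<^sup>2" by (simp add: power2_eq_square algebra_simps)
    then show "0 \<le> (g t)\<^sup>2 - 2 * m * g t + m\<^sup>2" by simp
  qed
  also have "m\<^sup>2 * (b - a) = m * integral {a..b} g"
    using ab by (simp add: m_def power2_eq_square)
  also have "integral {a..b} (\<lambda>t. (g t)\<^sup>2) - 2 * m * integral {a..b} g + m * integral {a..b} g
      = integral {a..b} (\<lambda>t. (g t)\<^sup>2) - (integral {a..b} g)\<^sup>2 / (b - a)"
    by (simp add: m_def power2_eq_square)
  finally show ?thesis using ab by (simp add: field_simps)
qed simp

lemma sum_step_integrals:
  fixes f :: "real \<Rightarrow> real"
  assumes "f integrable_on {0..T}" "0 \<le> \<tau>" "real N * \<tau> \<le> T"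
  shows "(\<Sum>n<N. integral {real n * \<tau>..real (Suc n) * \<tau>} f) = integral {0..real N * \<tau>} f"
  using assms(3)
proof (induction N)
  case (Suc N)
  have le: "real N * \<tau> \<le> real (Suc N) * \<tau>" using assms(2) by (intro mult_right_mono) auto
  have "f integrable_on {0..real (Suc N) * \<tau>}"
    using integrable_on_subinterval[OF assms(1)] Suc.prems by auto
  then have "integral {0..real N * \<tau>} f + integral {real N * \<tau>..real (Suc N) * \<tau>} f
      = integral {0..real (Suc N) * \<tau>} f"
    using le assms(2) by (intro Henstock_Kurzweil_Integration.integral_combine) auto
  then show ?case using Suc.IH Suc.prems le by simp
qed simp

lemma sum_step_square_integrals_le:
  assumes g: "sq_integrable T g" and "0 \<le> \<tau>" "real N * \<tau> \<le> T"
  shows "(\<Sum>n<N. integral {real n * \<tau>..real (Suc n) * \<tau>} (\<lambda>t. (g t)\<^sup>2)) \<le> (l2time T g)\<^sup>2"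
proof -
  have "(\<Sum>n<N. integral {real n * \<tau>..real (Suc n) * \<tau>} (\<lambda>t. (g t)\<^sup>2))
      = integral {0..real N * \<tau>} (\<lambda>t. (g t)\<^sup>2)"
    using assms by (intro sum_step_integrals) (auto simp: sq_integrable_def)
  also have "\<dots> \<le> integral {0..T} (\<lambda>t. (g t)\<^sup>2)"
    using assms sq_integrableD[OF g] by (intro integral_subset_le) auto
  finally show ?thesis by (simp add: l2time_sq)
qed

section \<open>Semi-inner products\<close>

locale semi_inner_space =
  fixes H :: "'a::real_vector set" and ip :: "'a \<Rightarrow> 'a \<Rightarrow> real"
  assumes subspace_H: "subspace H"
    and ip_commute: "\<And>u v. u \<in> H \<Longrightarrow> v \<in> H \<Longrightarrow> ip u v = ip v u"
    and ip_add_left: "\<And>u v w. u \<in> H \<Longrightarrow> v \<in> H \<Longrightarrow> w \<in> H \<Longrightarrow> ip (u + v) w = ip u w + ip v w"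
    and ip_scale_left: "\<And>c u w. u \<in> H \<Longrightarrow> w \<in> H \<Longrightarrow> ip (c *\<^sub>R u) w = c * ip u w"
    and ip_nonneg: "\<And>u. u \<in> H \<Longrightarrow> 0 \<le> ip u u"
begin

definition nrm :: "'a \<Rightarrow> real" where "nrm u = sqrt (ip u u)"

lemma H_add [simp]: "u \<in> H \<Longrightarrow> v \<in> H \<Longrightarrow> u + v \<in> H"
  and H_diff [simp]: "u \<in> H \<Longrightarrow> v \<in> H \<Longrightarrow> u - v \<in> H"
  and H_scale [simp]: "u \<in> H \<Longrightarrow> c *\<^sub>R u \<in> H"
  and H_zero [simp]: "0 \<in> H"
  using subspace_H by (auto simp: subspace_add subspace_diff subspace_scale subspace_0)

lemma H_sum [simp]: "(\<And>i. i \<in> A \<Longrightarrow> f i \<in> H) \<Longrightarrow> (\<Sum>i\<in>A. f i) \<in> H"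
  using subspace_H by (rule subspace_sum)

lemma ip_add_right: "u \<in> H \<Longrightarrow> v \<in> H \<Longrightarrow> w \<in> H \<Longrightarrow> ip w (u + v) = ip w u + ip w v"
  using ip_add_left[of u v w] by (simp add: ip_commute[of w])

lemma ip_scale_right: "u \<in> H \<Longrightarrow> w \<in> H \<Longrightarrow> ip w (c *\<^sub>R u) = c * ip w u"
  using ip_scale_left[of u w c] by (simp add: ip_commute[of w])

lemma ip_diff_left: "u \<in> H \<Longrightarrow> v \<in> H \<Longrightarrow> w \<in> H \<Longrightarrow> ip (u - v) w = ip u w - ip v w"
  using ip_add_left[of "u - v" v w] by simp

lemma ip_diff_right: "u \<in> H \<Longrightarrow> v \<in> H \<Longrightarrow> w \<in> H \<Longrightarrow> ip w (u - v) = ip w u - ip w v"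
  using ip_diff_left[of u v w] by (simp add: ip_commute[of w])

lemma ip_zero_left: "w \<in> H \<Longrightarrow> ip 0 w = 0"
  using ip_scale_left[of 0 w 0] by simp

lemma ip_zero_right: "w \<in> H \<Longrightarrow> ip w 0 = 0"
  using ip_scale_right[of 0 w 0] by simp

lemma ip_sum_left:
  "(\<And>i. i \<in> A \<Longrightarrow> f i \<in> H) \<Longrightarrow> w \<in> H \<Longrightarrow> ip (\<Sum>i\<in>A. f i) w = (\<Sum>i\<in>A. ip (f i) w)"
  by (induction A rule: infinite_finite_induct) (auto simp: ip_zero_left ip_add_left)

lemmas ip_simps = ip_add_left ip_add_right ip_diff_left ip_diff_right ip_scale_left ip_scale_right
  ip_zero_left ip_zero_right ip_sum_left

lemma nrm_sq: "u \<in> H \<Longrightarrow> (nrm u)\<^sup>2 = ip u u"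
  by (simp add: nrm_def ip_nonneg)

lemma nrm_nonneg [simp]: "u \<in> H \<Longrightarrow> 0 \<le> nrm u"
  by (simp add: nrm_def ip_nonneg)

lemma nrm_scale: "u \<in> H \<Longrightarrow> nrm (c *\<^sub>R u) = \<bar>c\<bar> * nrm u"
  by (simp add: nrm_def ip_simps real_sqrt_mult flip: mult.assoc power2_eq_square)

lemma nrm_minus: "u \<in> H \<Longrightarrow> nrm (- u) = nrm u"
  using nrm_scale[of u "-1"] by simp

lemma nrm_diff_commute: "u \<in> H \<Longrightarrow> v \<in> H \<Longrightarrow> nrm (u - v) = nrm (v - u)"
  using nrm_minus[of "u - v"] by simp

lemma Cauchy_Schwarz:
  assumes [simp]: "u \<in> H" "v \<in> H"
  shows "\<bar>ip u v\<bar> \<le> nrm u * nrm v"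
proof -
  have q: "0 \<le> ip u u * x\<^sup>2 + 2 * ip u v * x + ip v v" for x
    using ip_nonneg[of "x *\<^sub>R u + v"]
    by (simp add: ip_simps ip_commute[of v u] power2_eq_square algebra_simps)
  have "(ip u v)\<^sup>2 \<le> ip u u * ip v v"
  proof (cases "ip u u = 0")
    case True
    have "ip u v = 0"
    proof (rule ccontr)
      assume "ip u v \<noteq> 0"
      then show False using q[of "- (ip v v + 1) / (2 * ip u v)"] True by simp
    qed
    then show ?thesis using True by simp
  next
    case False
    then have "0 < ip u u" using ip_nonneg[of u] by simp
    then show ?thesis using q[of "- ip u v / ip u u"] False
      by (simp add: power2_eq_square field_simps)
  qed
  then have "sqrt ((ip u v)\<^sup>2) \<le> sqrt (ip u u * ip v v)" by (rule real_sqrt_le_mono)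
  then show ?thesis by (simp add: nrm_def real_sqrt_mult)
qed

lemma ip_le: "u \<in> H \<Longrightarrow> v \<in> H \<Longrightarrow> ip u v \<le> nrm u * nrm v"
  and neg_ip_le: "u \<in> H \<Longrightarrow> v \<in> H \<Longrightarrow> - ip u v \<le> nrm u * nrm v"
  using Cauchy_Schwarz[of u v] by auto

lemma nrm_triangle: "u \<in> H \<Longrightarrow> v \<in> H \<Longrightarrow> nrm (u + v) \<le> nrm u + nrm v"
proof (rule power2_le_imp_le)
  assume [simp]: "u \<in> H" "v \<in> H"
  show "(nrm (u + v))\<^sup>2 \<le> (nrm u + nrm v)\<^sup>2"
    using ip_le[of u v] by (simp add: nrm_sq power2_sum ip_simps ip_commute[of v u])
  show "0 \<le> nrm u + nrm v" by simp
qed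

lemma nrm_diff_triangle: "u \<in> H \<Longrightarrow> v \<in> H \<Longrightarrow> nrm (u - v) \<le> nrm u + nrm v"
  using nrm_triangle[of u "- v"] subspace_H by (simp add: nrm_minus subspace_neg)

text \<open>Linearity of the evolution operator is only available after testing, so norms are estimated
  through pairings.\<close>

lemma nrm_le_tested:
  assumes "x \<in> H" "ip x x \<le> B * nrm x" "0 \<le> B"
  shows "nrm x \<le> B"
proof (cases "nrm x = 0")
  case False
  then have "0 < nrm x" using assms(1) nrm_nonneg[of x] by linarith
  moreover have "nrm x * nrm x \<le> B * nrm x" using assms nrm_sq[of x] by (simp add: power2_eq_square)
  ultimately show ?thesis by simp
qed (use assms in simp)

lemma nrm_le_tested_dense:
  assumes dense: "\<And>u \<epsilon>. u \<in> H \<Longrightarrow> 0 < \<epsilon> \<Longrightarrow> \<exists>v\<in>D. nrm (u - v) < \<epsilon>"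
    and D: "D \<subseteq> H" and x[simp]: "x \<in> H" and B: "0 \<le> B"
    and le: "\<And>v. v \<in> D \<Longrightarrow> \<bar>ip x v\<bar> \<le> B * nrm v"
  shows "nrm x \<le> B"
proof (rule nrm_le_tested[OF x _ B], rule field_le_epsilon)
  fix \<epsilon> :: real assume "0 < \<epsilon>"
  define e where "e = \<epsilon> / (B + nrm x + 1)"
  have p: "0 < B + nrm x + 1" using B nrm_nonneg[OF x] by linarith
  then have e: "0 < e" using \<open>0 < \<epsilon>\<close> by (simp add: e_def)
  obtain v where v: "v \<in> D" "nrm (x - v) < e" using dense[OF x e] by auto
  have [simp]: "v \<in> H" using v D by auto
  have "nrm v \<le> nrm x + e"
    using nrm_triangle[of x "v - x"] v(2) nrm_diff_commute[of x v] by simp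
  then have "B * nrm v \<le> B * (nrm x + e)" using B by (rule mult_left_mono)
  moreover have "ip x (x - v) \<le> nrm x * e"
    using ip_le[of x "x - v"] v(2) mult_left_mono[of "nrm (x - v)" e "nrm x"] by simp
  moreover have "ip x x = ip x v + ip x (x - v)" by (simp add: ip_simps)
  ultimately have "ip x x \<le> B * nrm x + e * (B + nrm x)"
    using le[OF v(1)] by (simp add: algebra_simps)
  also have "e * (B + nrm x) \<le> \<epsilon>"
  proof -
    have "e * (B + nrm x) \<le> e * (B + nrm x + 1)" using e by simp
    also have "\<dots> = \<epsilon>" using p by (simp add: e_def)
    finally show ?thesis .
  qed
  finally show "ip x x \<le> B * nrm x + \<epsilon>" by simp
qed

lemma ip_null:
  assumes "u \<in> H" "v \<in> H" "nrm u = 0"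
  shows "ip u v = 0"
  using Cauchy_Schwarz[of u v] assms by simp

section \<open>Differentiable paths\<close>

text \<open>Only the norm of the remainder is required to vanish, so that limits are unique up to null
  vectors; at the end points the derivative is one-sided.\<close>

definition path_derivative :: "real \<Rightarrow> (real \<Rightarrow> 'a) \<Rightarrow> (real \<Rightarrow> 'a) \<Rightarrow> bool" where
  "path_derivative T X X' \<longleftrightarrow> (\<forall>t\<in>{0..T}. X t \<in> H \<and> X' t \<in> H \<and>
     ((\<lambda>s. nrm ((X s - X t) /\<^sub>R (s - t) - X' t)) \<longlongrightarrow> 0) (at t within {0..T}))"

lemma path_derivative_mem:
  "path_derivative T X X' \<Longrightarrow> t \<in> {0..T} \<Longrightarrow> X t \<in> H"
  "path_derivative T X X' \<Longrightarrow> t \<in> {0..T} \<Longrightarrow> X' t \<in> H"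
  by (auto simp: path_derivative_def)

lemma tested_path_derivative:
  assumes X: "path_derivative T X X'" and t: "t \<in> {0..T}" and w[simp]: "w \<in> H"
  shows "((\<lambda>s. ip (X s) w) has_real_derivative ip (X' t) w) (at t within {0..T})"
proof -
  have [simp]: "X t \<in> H" "X' t \<in> H" using X t by (auto simp: path_derivative_def)
  have "((\<lambda>s. nrm ((X s - X t) /\<^sub>R (s - t) - X' t) * nrm w) \<longlongrightarrow> 0 * nrm w) (at t within {0..T})"
    using X t by (intro tendsto_mult_right) (auto simp: path_derivative_def)
  then have lim: "((\<lambda>s. nrm ((X s - X t) /\<^sub>R (s - t) - X' t) * nrm w) \<longlongrightarrow> 0) (at t within {0..T})"
    by simp
  have "((\<lambda>s. (ip (X s) w - ip (X t) w) / (s - t) - ip (X' t) w) \<longlongrightarrow> 0) (at t within {0..T})"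
  proof (rule Lim_null_comparison[OF _ lim])
    show "\<forall>\<^sub>F s in at t within {0..T}. norm ((ip (X s) w - ip (X t) w) / (s - t) - ip (X' t) w)
        \<le> nrm ((X s - X t) /\<^sub>R (s - t) - X' t) * nrm w"
      unfolding eventually_at_filter
    proof (rule always_eventually, intro allI impI)
      fix s assume "s \<noteq> t" "s \<in> {0..T}"
      then have [simp]: "X s \<in> H" using X by (auto simp: path_derivative_def)
      have "ip ((X s - X t) /\<^sub>R (s - t) - X' t) w = (ip (X s) w - ip (X t) w) / (s - t) - ip (X' t) w"
        by (simp add: ip_simps divide_inverse mult.commute)
      then show "norm ((ip (X s) w - ip (X t) w) / (s - t) - ip (X' t) w)
          \<le> nrm ((X s - X t) /\<^sub>R (s - t) - X' t) * nrm w"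
        using Cauchy_Schwarz[of "(X s - X t) /\<^sub>R (s - t) - X' t" w] by simp
    qed
  qed
  then show ?thesis unfolding has_field_derivative_iff by (subst LIM_zero_iff[symmetric])
qed

lemma tested_path_integral:
  assumes X: "path_derivative T X X'" and "0 \<le> a" "a \<le> b" "b \<le> T" and w: "w \<in> H"
  shows "((\<lambda>t. ip (X' t) w) has_integral ip (X b) w - ip (X a) w) {a..b}"
proof (rule fundamental_theorem_of_calculus[OF \<open>a \<le> b\<close>])
  fix t assume "t \<in> {a..b}"
  then have "((\<lambda>s. ip (X s) w) has_real_derivative ip (X' t) w) (at t within {0..T})"
    using assms by (intro tested_path_derivative[OF X _ w]) auto
  then show "((\<lambda>s. ip (X s) w) has_vector_derivative ip (X' t) w) (at t within {a..b})"
    using assms unfolding has_real_derivative_iff_has_vector_derivative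
    by (elim has_vector_derivative_within_subset) auto
qed

text \<open>The tested derivative is integrable by the fundamental theorem for the gauge integral, although
  nothing is known about the measurability of \<open>X'\<close> in time.\<close>

lemma tested_increment_le:
  assumes X: "path_derivative T X X'" and ab: "0 \<le> a" "a \<le> b" "b \<le> T" and w: "w \<in> H"
    and g: "g integrable_on {a..b}"
    and le: "\<And>t. t \<in> {a..b} \<Longrightarrow> \<bar>ip (X' t) w\<bar> \<le> K * g t"
  shows "\<bar>ip (X b - X a) w\<bar> \<le> K * integral {a..b} g"
proof -
  note I = tested_path_integral[OF X ab w]
  have "norm (integral {a..b} (\<lambda>t. ip (X' t) w)) \<le> integral {a..b} (\<lambda>t. K * g t)"
    using I g le by (intro Henstock_Kurzweil_Integration.integral_norm_bound_integral)
      (auto intro: integrable_on_mult_right)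
  moreover have "integral {a..b} (\<lambda>t. ip (X' t) w) = ip (X b - X a) w"
    using I path_derivative_mem(1)[OF X] ab w by (simp add: integral_unique ip_simps)
  ultimately show ?thesis by simp
qed

lemma increment_le:
  assumes X: "path_derivative T X X'" and ab: "0 \<le> a" "a \<le> b" "b \<le> T"
    and g: "g integrable_on {a..b}"
    and le: "\<And>t. t \<in> {a..b} \<Longrightarrow> nrm (X' t) \<le> g t"
  shows "nrm (X b - X a) \<le> integral {a..b} g"
proof -
  have [simp]: "X b \<in> H" "X a \<in> H" using path_derivative_mem[OF X] ab by auto
  have X'H: "X' t \<in> H" if "t \<in> {a..b}" for t using path_derivative_mem[OF X] ab that by auto
  have "0 \<le> g t" if "t \<in> {a..b}" for t using le[OF that] nrm_nonneg[OF X'H[OF that]] by linarith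
  then have "0 \<le> integral {a..b} g" using g by (intro integral_nonneg)
  moreover have "\<bar>ip (X b - X a) (X b - X a)\<bar> \<le> nrm (X b - X a) * integral {a..b} g"
  proof (rule tested_increment_le[OF X ab _ g])
    fix t assume t: "t \<in> {a..b}"
    have "\<bar>ip (X' t) (X b - X a)\<bar> \<le> nrm (X' t) * nrm (X b - X a)"
      using X'H[OF t] by (intro Cauchy_Schwarz) auto
    also have "\<dots> \<le> g t * nrm (X b - X a)" using le[OF t] by (intro mult_right_mono) auto
    finally show "\<bar>ip (X' t) (X b - X a)\<bar> \<le> nrm (X b - X a) * g t" by (simp add: mult.commute)
  qed simp
  ultimately show ?thesis by (intro nrm_le_tested) (auto simp: mult.commute)
qed

text \<open>If the derivative stays within \<open>M\<close> of a fixed vector, then the path stays close to a straight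
  line; two such estimates control a second difference.\<close>

lemma linearisation_le:
  assumes X: "path_derivative T X X'" and ab: "0 \<le> a" "a \<le> b" "b \<le> T" and v[simp]: "v \<in> H"
    and M: "0 \<le> M"
    and le: "\<And>t. t \<in> {a..b} \<Longrightarrow> nrm (X' t - v) \<le> M"
  shows "nrm (X b - X a - (b - a) *\<^sub>R v) \<le> (b - a) * M"
proof (rule nrm_le_tested)
  have [simp]: "X b \<in> H" "X a \<in> H" using path_derivative_mem[OF X] ab by auto
  define w where "w = X b - X a - (b - a) *\<^sub>R v"
  have [simp]: "w \<in> H" by (simp add: w_def)
  show "X b - X a - (b - a) *\<^sub>R v \<in> H" by simp
  show "0 \<le> (b - a) * M" using M ab by simp
  have I: "((\<lambda>t. ip (X' t) w - ip v w) has_integral (ip (X b) w - ip (X a) w) - (b - a) * ip v w) {a..b}"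
    using tested_path_integral[OF X ab, of w] has_integral_const_real[of "ip v w" a b] ab
    by (intro has_integral_diff) auto
  have "norm (ip (X' t) w - ip v w) \<le> nrm w * M" if t: "t \<in> {a..b}" for t
  proof -
    have [simp]: "X' t \<in> H" using path_derivative_mem[OF X] ab t by auto
    have "norm (ip (X' t) w - ip v w) = \<bar>ip (X' t - v) w\<bar>" by (simp add: ip_simps)
    also have "\<dots> \<le> nrm (X' t - v) * nrm w" by (intro Cauchy_Schwarz) auto
    also have "\<dots> \<le> M * nrm w" using le[OF t] by (intro mult_right_mono) auto
    finally show ?thesis by (simp add: mult.commute)
  qed
  then have "norm ((ip (X b) w - ip (X a) w) - (b - a) * ip v w) \<le> (nrm w * M) * measure lborel {a..b}"
    using M by (intro has_integral_bound_real[OF _ _ I]) auto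
  then have "(ip (X b) w - ip (X a) w) - (b - a) * ip v w \<le> (b - a) * M * nrm w"
    using ab by (simp add: mult_ac)
  then show "ip (X b - X a - (b - a) *\<^sub>R v) (X b - X a - (b - a) *\<^sub>R v)
      \<le> (b - a) * M * nrm (X b - X a - (b - a) *\<^sub>R v)"
    unfolding w_def[symmetric]
    by (subst (1) w_def) (simp add: ip_simps)
qed

end

section \<open>Discrete square norms\<close>

definition l2seq :: "real \<Rightarrow> nat set \<Rightarrow> (nat \<Rightarrow> real) \<Rightarrow> real" where
  "l2seq \<tau> A f = sqrt \<tau> * L2_set f A"

lemma l2seq_nonneg [simp]: "0 \<le> \<tau> \<Longrightarrow> 0 \<le> l2seq \<tau> A f"
  by (simp add: l2seq_def)

lemma l2seq_sq: "0 \<le> \<tau> \<Longrightarrow> (l2seq \<tau> A f)\<^sup>2 = \<tau> * (\<Sum>n\<in>A. (f n)\<^sup>2)"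
  by (simp add: l2seq_def L2_set_def power_mult_distrib sum_nonneg)

lemma l2seq_leI: "0 \<le> \<tau> \<Longrightarrow> \<tau> * (\<Sum>n\<in>A. (f n)\<^sup>2) \<le> B\<^sup>2 \<Longrightarrow> 0 \<le> B \<Longrightarrow> l2seq \<tau> A f \<le> B"
  by (rule power2_le_imp_le) (simp_all add: l2seq_sq)

lemma l2seq_mono:
  assumes "0 \<le> \<tau>" "finite B" "A \<subseteq> B" "\<And>n. n \<in> A \<Longrightarrow> 0 \<le> f n \<and> f n \<le> g n"
  shows "l2seq \<tau> A f \<le> l2seq \<tau> B g"
proof -
  have "L2_set f A \<le> L2_set g A" using assms by (intro L2_set_mono) auto
  also have "\<dots> \<le> L2_set g B"
    unfolding L2_set_def using assms by (intro real_sqrt_le_mono sum_mono2) auto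
  finally show ?thesis using assms by (simp add: l2seq_def mult_left_mono)
qed

lemma l2seq_triangle:
  "0 \<le> \<tau> \<Longrightarrow> l2seq \<tau> A (\<lambda>n. f n + g n) \<le> l2seq \<tau> A f + l2seq \<tau> A g"
  using mult_left_mono[OF L2_set_triangle_ineq[of f g A], of "sqrt \<tau>"]
  by (simp add: l2seq_def distrib_left)

lemma l2seq_scale: "0 \<le> c \<Longrightarrow> l2seq \<tau> A (\<lambda>n. c * f n) = c * l2seq \<tau> A f"
  by (simp add: l2seq_def L2_set_right_distrib)

lemma l2seq_sum:
  assumes "0 \<le> \<tau>" "finite J"
  shows "l2seq \<tau> A (\<lambda>n. \<Sum>j\<in>J. f j n) \<le> (\<Sum>j\<in>J. l2seq \<tau> A (f j))"
  using assms(2)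
proof (induction J rule: finite_induct)
  case empty
  show ?case by (simp add: l2seq_def L2_set_def)
next
  case (insert j J)
  then have "l2seq \<tau> A (\<lambda>n. \<Sum>j\<in>insert j J. f j n) \<le> l2seq \<tau> A (f j) + l2seq \<tau> A (\<lambda>n. \<Sum>j\<in>J. f j n)"
    using l2seq_triangle[OF assms(1), of A "f j" "\<lambda>n. \<Sum>j\<in>J. f j n"] by simp
  then show ?case using insert by simp
qed

lemma sum_mult_le_l2seq:
  assumes "0 \<le> \<tau>"
  shows "\<tau> * (\<Sum>n\<in>A. f n * g n) \<le> l2seq \<tau> A f * l2seq \<tau> A g"
proof -
  have "(\<Sum>n\<in>A. f n * g n) \<le> (\<Sum>n\<in>A. \<bar>f n\<bar> * \<bar>g n\<bar>)"
    by (intro sum_mono) (simp add: abs_mult[symmetric])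
  also have "\<dots> \<le> L2_set f A * L2_set g A" by (rule L2_set_mult_ineq)
  finally have "\<tau> * (\<Sum>n\<in>A. f n * g n) \<le> \<tau> * (L2_set f A * L2_set g A)"
    using assms by (rule mult_left_mono)
  also have "\<dots> = l2seq \<tau> A f * l2seq \<tau> A g"
    using assms by (simp add: l2seq_def)
  finally show ?thesis .
qed

lemma sum_le_l2seq:
  assumes "0 \<le> \<tau>" "\<tau> * real (card A) \<le> T"
  shows "\<tau> * (\<Sum>n\<in>A. f n) \<le> sqrt T * l2seq \<tau> A f"
proof -
  have "\<tau> * (\<Sum>n\<in>A. f n) \<le> l2seq \<tau> A (\<lambda>_. 1) * l2seq \<tau> A f"
    using sum_mult_le_l2seq[OF assms(1), where f = "\<lambda>_. 1" and g = f and A = A] by simp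
  also have "l2seq \<tau> A (\<lambda>_. 1) = sqrt (\<tau> * real (card A))"
    using assms by (simp add: l2seq_def L2_set_def real_sqrt_mult)
  also have "\<dots> * l2seq \<tau> A f \<le> sqrt T * l2seq \<tau> A f"
    using assms by (intro mult_right_mono) auto
  finally show ?thesis .
qed

lemma l2seq_shift_le:
  assumes "0 \<le> \<tau>" "finite A'" and f: "\<And>n. n \<in> A' \<Longrightarrow> 0 \<le> f n"
    and A: "\<And>n. n \<in> A \<Longrightarrow> j \<le> n" "\<And>n. n \<in> A \<Longrightarrow> n - j \<in> A'"
  shows "l2seq \<tau> A (\<lambda>n. f (n - j)) \<le> l2seq \<tau> A' f"
proof -
  have "inj_on (\<lambda>n. n - j) A"
    using A(1) by (intro inj_onI) (metis eq_diff_iff)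
  then have "l2seq \<tau> A (\<lambda>n. f (n - j)) = l2seq \<tau> ((\<lambda>n. n - j) ` A) f"
    by (simp add: l2seq_def L2_set_def sum.reindex)
  also have "\<dots> \<le> l2seq \<tau> A' f"
    using assms by (intro l2seq_mono) auto
  finally show ?thesis .
qed

lemma l2seq_shifted_average_le:
  assumes \<tau>: "0 \<le> \<tau>" and fin: "finite A'" and c: "\<And>j. 0 \<le> c j"
    and f: "\<And>n. n \<in> A' \<Longrightarrow> 0 \<le> f n"
    and A: "\<And>n. n \<in> A \<Longrightarrow> l \<le> n" "\<And>n j. n \<in> A \<Longrightarrow> j \<le> l \<Longrightarrow> n - j \<in> A'"
  shows "l2seq \<tau> A (\<lambda>n. \<Sum>j\<le>l. c j * f (n - j)) \<le> (\<Sum>j\<le>l. c j) * l2seq \<tau> A' f"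
proof -
  have "l2seq \<tau> A (\<lambda>n. \<Sum>j\<le>l. c j * f (n - j)) \<le> (\<Sum>j\<le>l. l2seq \<tau> A (\<lambda>n. c j * f (n - j)))"
    using \<tau> by (intro l2seq_sum) auto
  also have "\<dots> \<le> (\<Sum>j\<le>l. c j * l2seq \<tau> A' f)"
  proof (intro sum_mono)
    fix j assume j: "j \<in> {..l}"
    have "l2seq \<tau> A (\<lambda>n. f (n - j)) \<le> l2seq \<tau> A' f"
      using \<tau> fin f A j by (intro l2seq_shift_le) (auto intro: order_trans)
    then show "l2seq \<tau> A (\<lambda>n. c j * f (n - j)) \<le> c j * l2seq \<tau> A' f"
      using c[of j] by (simp add: l2seq_scale mult_left_mono)
  qed
  finally show ?thesis by (simp add: sum_distrib_right)
qed

text \<open>The two indices keep apart the factor that is differenced and the one that stays.\<close>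

lemma summation_by_parts:
  fixes P :: "nat \<Rightarrow> nat \<Rightarrow> real"
  assumes "1 \<le> n0" "n0 \<le> m"
  shows "(\<Sum>n=n0..m. P n n - P n (n - 1))
    = P m m - P n0 (n0 - 1) - (\<Sum>n=n0..m - 1. P (n + 1) n - P n n)"
  using assms(2)
proof (induction m rule: dec_induct)
  case base
  then show ?case using assms(1) by simp
next
  case (step m)
  then have "{n0..m} = insert m {n0..m - 1}" "m \<notin> {n0..m - 1}" using assms(1) by auto
  then have "(\<Sum>n=n0..m. P (n + 1) n - P n n) = (P (m + 1) m - P m m) + (\<Sum>n=n0..m - 1. P (n + 1) n - P n n)"
    by simp
  then show ?case using step by simp
qed

section \<open>Sampling paths that vary in a controlled way\<close>

text \<open>At index \<open>0\<close> the truncated subtraction makes the backward difference zero, and \<open>wavg\<close> repeats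
  the initial value below index \<open>0\<close>; neither case occurs from the first computed index on.\<close>

definition bdiff :: "real \<Rightarrow> (nat \<Rightarrow> 'a::real_vector) \<Rightarrow> nat \<Rightarrow> 'a" where
  "bdiff \<tau> V n = (V n - V (n - 1)) /\<^sub>R \<tau>"

definition fdiff :: "real \<Rightarrow> (nat \<Rightarrow> 'a::real_vector) \<Rightarrow> nat \<Rightarrow> 'a" where
  "fdiff \<tau> V n = (V (n + 1) - V n) /\<^sub>R \<tau>"

definition wavg :: "nat \<Rightarrow> (nat \<Rightarrow> real) \<Rightarrow> (nat \<Rightarrow> 'a::real_vector) \<Rightarrow> nat \<Rightarrow> 'a" where
  "wavg l b V n = (\<Sum>j\<le>l. b j *\<^sub>R V (n - j))"

context semi_inner_space
begin

lemma nrm_wavg_le: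
  assumes "\<And>j. j \<le> l \<Longrightarrow> V (n - j) \<in> H"
  shows "nrm (wavg l b V n) \<le> (\<Sum>j\<le>l. \<bar>b j\<bar> * nrm (V (n - j)))"
proof -
  have "nrm (\<Sum>j\<in>J. b j *\<^sub>R V (n - j)) \<le> (\<Sum>j\<in>J. \<bar>b j\<bar> * nrm (V (n - j)))"
    if "finite J" "J \<subseteq> {..l}" for J
    using that
  proof (induction J rule: finite_induct)
    case empty
    show ?case by (simp add: nrm_def ip_simps)
  next
    case (insert j J)
    have "nrm (b j *\<^sub>R V (n - j) + (\<Sum>j\<in>J. b j *\<^sub>R V (n - j)))
        \<le> nrm (b j *\<^sub>R V (n - j)) + nrm (\<Sum>j\<in>J. b j *\<^sub>R V (n - j))"
      using insert assms by (intro nrm_triangle H_sum H_scale) auto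
    then show ?case using insert assms by (simp add: nrm_scale)
  qed
  then show ?thesis unfolding wavg_def by blast
qed

text \<open>The two majorants play the role of the norms of \<open>Y\<close> and of its time derivative. No derivative is
  mentioned, because the definition is also applied to the image of a path under an unbounded operator.\<close>

definition controlled :: "real \<Rightarrow> (real \<Rightarrow> 'a) \<Rightarrow> (real \<Rightarrow> real) \<Rightarrow> (real \<Rightarrow> real) \<Rightarrow> bool" where
  "controlled T Y g0 g1 \<longleftrightarrow> sq_integrable T g0 \<and> sq_integrable T g1 \<and>
     (\<forall>t\<in>{0..T}. Y t \<in> H \<and> nrm (Y t) \<le> g0 t) \<and>
     (\<forall>a b. 0 \<le> a \<longrightarrow> a \<le> b \<longrightarrow> b \<le> T \<longrightarrow> nrm (Y b - Y a) \<le> integral {a..b} g1)"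

text \<open>The values of \<open>Y\<close> differ from \<open>Y c\<close> by at most the integral of \<open>g1\<close>, and averaging over the
  interval turns the pointwise bound \<open>g0\<close> into an integral. On a time step this bounds a sampled
  value, on all of \<open>{0..T}\<close> it is the Sobolev embedding in time.\<close>

lemma controlled_trace:
  assumes Y: "controlled T Y g0 g1" and ab: "0 \<le> a" "a \<le> b" "b \<le> T" and c: "c \<in> {a..b}"
  shows "(b - a) * (nrm (Y c))\<^sup>2
    \<le> 2 * integral {a..b} (\<lambda>t. (g0 t)\<^sup>2) + 2 * (b - a)\<^sup>2 * integral {a..b} (\<lambda>t. (g1 t)\<^sup>2)"
proof -
  have g: "sq_integrable T g0" "sq_integrable T g1" using Y by (auto simp: controlled_def)
  note i0 = sq_integrableD[OF g(1) ab(1,3)] and i1 = sq_integrableD[OF g(2) ab(1,3)]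
  define J where "J = integral {a..b} g1"
  have YH: "Y t \<in> H" if "t \<in> {a..b}" for t using Y ab that by (auto simp: controlled_def)
  have sub: "integral {x..y} g1 \<le> J" if "a \<le> x" "x \<le> y" "y \<le> b" for x y
    unfolding J_def using that ab i1
    by (intro integral_subset_le sq_integrableD(1)[OF g(2)]) auto
  have diff: "nrm (Y c - Y t) \<le> J" if t: "t \<in> {a..b}" for t
  proof (cases "t \<le> c")
    case True
    then have "nrm (Y c - Y t) \<le> integral {t..c} g1"
      using Y t c ab by (auto simp: controlled_def)
    then show ?thesis using sub[of t c] True t c by simp
  next
    case False
    then have "nrm (Y t - Y c) \<le> integral {c..t} g1"
      using Y t c ab by (auto simp: controlled_def)
    then show ?thesis using sub[of c t] False t c YH by (simp add: nrm_diff_commute[of "Y c"])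
  qed
  have pt: "(nrm (Y c))\<^sup>2 \<le> 2 * (g0 t)\<^sup>2 + 2 * J\<^sup>2" if t: "t \<in> {a..b}" for t
  proof -
    have "nrm (Y c) \<le> nrm (Y t) + nrm (Y c - Y t)"
      using nrm_triangle[of "Y t" "Y c - Y t"] YH[OF t] YH[OF c] by simp
    also have "\<dots> \<le> g0 t + J"
      using diff[OF t] Y t ab by (auto simp: controlled_def intro!: add_mono)
    finally have "(nrm (Y c))\<^sup>2 \<le> (g0 t + J)\<^sup>2" using YH[OF c] by (intro power_mono) auto
    also have "\<dots> \<le> 2 * (g0 t)\<^sup>2 + 2 * J\<^sup>2"
      using zero_le_power2[of "g0 t - J"] by (simp add: power2_sum power2_diff)
    finally show ?thesis .
  qed
  have "((\<lambda>t. 2 * (g0 t)\<^sup>2 + 2 * J\<^sup>2) has_integral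
      2 * integral {a..b} (\<lambda>t. (g0 t)\<^sup>2) + (b - a) *\<^sub>R (2 * J\<^sup>2)) {a..b}"
    using has_integral_const_real[of "2 * J\<^sup>2" a b] i0 ab
    by (intro has_integral_add has_integral_mult_right) (auto simp: integrable_integral)
  from has_integral_le[OF has_integral_const_real this pt]
  have "(b - a) * (nrm (Y c))\<^sup>2 \<le> 2 * integral {a..b} (\<lambda>t. (g0 t)\<^sup>2) + (b - a) * (2 * J\<^sup>2)"
    using ab by simp
  moreover have "J\<^sup>2 \<le> (b - a) * integral {a..b} (\<lambda>t. (g1 t)\<^sup>2)"
    unfolding J_def using ab i1 by (intro square_of_integral_le)
  then have "(b - a) * (2 * J\<^sup>2) \<le> (b - a) * (2 * ((b - a) * integral {a..b} (\<lambda>t. (g1 t)\<^sup>2)))"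
    using ab by (intro mult_left_mono) auto
  moreover have "\<dots> = 2 * (b - a)\<^sup>2 * integral {a..b} (\<lambda>t. (g1 t)\<^sup>2)"
    by (simp add: power2_eq_square)
  ultimately show ?thesis by linarith
qed

lemma controlled_sup_le:
  assumes Y: "controlled T Y g0 g1" and T: "0 < T" and c: "c \<in> {0..T}"
  shows "nrm (Y c) \<le> (sqrt (2 / T) + sqrt (2 * T)) * (l2time T g0 + l2time T g1)"
proof -
  have "T * (nrm (Y c))\<^sup>2 \<le> 2 * (l2time T g0)\<^sup>2 + 2 * T\<^sup>2 * (l2time T g1)\<^sup>2"
    using controlled_trace[OF Y, of 0 T c] T c by (simp add: l2time_sq)
  then have "(nrm (Y c))\<^sup>2 \<le> (2 / T) * (l2time T g0)\<^sup>2 + (2 * T) * (l2time T g1)\<^sup>2"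
    using T by (simp add: field_simps power2_eq_square)
  also have "\<dots> = (sqrt (2 / T) * l2time T g0)\<^sup>2 + (sqrt (2 * T) * l2time T g1)\<^sup>2"
    using T by (simp add: power_mult_distrib)
  also have "\<dots> \<le> (sqrt (2 / T) * l2time T g0 + sqrt (2 * T) * l2time T g1)\<^sup>2"
    using T by (simp add: power2_sum)
  finally have "nrm (Y c) \<le> sqrt (2 / T) * l2time T g0 + sqrt (2 * T) * l2time T g1"
    by (rule power2_le_imp_le) (use T in auto)
  also have "\<dots> \<le> (sqrt (2 / T) + sqrt (2 * T)) * (l2time T g0 + l2time T g1)"
    using T by (simp add: algebra_simps)
  finally show ?thesis .
qed

text \<open>The value at time \<open>0\<close> is compared with the first step, all others with the step that they end.\<close>

lemma controlled_samples_le: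
  assumes Y: "controlled T Y g0 g1" and \<tau>: "0 < \<tau>" and N: "1 \<le> N" "real N * \<tau> \<le> T"
  shows "l2seq \<tau> {0..N} (\<lambda>n. nrm (Y (real n * \<tau>))) \<le> 2 * (l2time T g0 + \<tau> * l2time T g1)"
proof -
  have g: "sq_integrable T g0" "sq_integrable T g1" using Y by (auto simp: controlled_def)
  define I where "I n = 2 * integral {real n * \<tau>..real (Suc n) * \<tau>} (\<lambda>t. (g0 t)\<^sup>2)
    + 2 * \<tau>\<^sup>2 * integral {real n * \<tau>..real (Suc n) * \<tau>} (\<lambda>t. (g1 t)\<^sup>2)" for n
  have in_T: "real (Suc n) * \<tau> \<le> T" if "n < N" for n
  proof -
    have "real (Suc n) * \<tau> \<le> real N * \<tau>" using that \<tau> by (intro mult_right_mono) auto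
    then show ?thesis using N by simp
  qed
  have step: "\<tau> * (nrm (Y c))\<^sup>2 \<le> I n" if n: "n < N" and c: "c \<in> {real n * \<tau>..real (Suc n) * \<tau>}" for n c
  proof -
    have "real (Suc n) * \<tau> - real n * \<tau> = \<tau>" by (simp add: algebra_simps)
    moreover have "real n * \<tau> \<le> real (Suc n) * \<tau>" using \<tau> by (intro mult_right_mono) auto
    ultimately show ?thesis using controlled_trace[OF Y _ _ in_T[OF n] c] \<tau> by (simp add: I_def)
  qed
  have I0: "0 \<le> I n" if "n < N" for n
    using sq_integrableD(5)[OF g(1) _ in_T[OF that]] sq_integrableD(5)[OF g(2) _ in_T[OF that]] \<tau>
    by (simp add: I_def)
  have "(\<Sum>n=0..N. \<tau> * (nrm (Y (real n * \<tau>)))\<^sup>2)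
      = \<tau> * (nrm (Y (real 0 * \<tau>)))\<^sup>2 + (\<Sum>n<N. \<tau> * (nrm (Y (real (Suc n) * \<tau>)))\<^sup>2)"
    unfolding atLeast0AtMost sum.atMost_shift by simp
  also have "\<dots> \<le> I 0 + (\<Sum>n<N. I n)"
    using N \<tau> by (intro add_mono sum_mono step) (auto simp: algebra_simps)
  also have "I 0 \<le> (\<Sum>n<N. I n)"
    using N I0 by (intro member_le_sum) auto
  also have "(\<Sum>n<N. I n) \<le> 2 * (l2time T g0)\<^sup>2 + 2 * \<tau>\<^sup>2 * (l2time T g1)\<^sup>2"
    unfolding I_def sum.distrib sum_distrib_left[symmetric]
    using \<tau> N g by (intro add_mono mult_left_mono sum_step_square_integrals_le) auto
  finally have "\<tau> * (\<Sum>n=0..N. (nrm (Y (real n * \<tau>)))\<^sup>2) \<le> 4 * ((l2time T g0)\<^sup>2 + \<tau>\<^sup>2 * (l2time T g1)\<^sup>2)"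
    by (simp add: sum_distrib_left)
  also have "\<dots> \<le> (2 * (l2time T g0 + \<tau> * l2time T g1))\<^sup>2"
    using \<tau> by (simp add: power_mult_distrib power2_sum)
  finally show ?thesis
    using \<tau> by (intro l2seq_leI) (auto simp: sum_distrib_left)
qed

lemma controlled_differences_le:
  assumes Y: "controlled T Y g0 g1" and \<tau>: "0 < \<tau>" and N: "real N * \<tau> \<le> T"
  shows "l2seq \<tau> {..<N} (\<lambda>n. nrm (fdiff \<tau> (\<lambda>n. Y (real n * \<tau>)) n)) \<le> l2time T g1"
proof -
  have g: "sq_integrable T g1" using Y by (auto simp: controlled_def)
  have "\<tau> * (nrm (fdiff \<tau> (\<lambda>n. Y (real n * \<tau>)) n))\<^sup>2
      \<le> integral {real n * \<tau>..real (Suc n) * \<tau>} (\<lambda>t. (g1 t)\<^sup>2)" if n: "n < N" for n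
  proof -
    have "real (Suc n) * \<tau> \<le> real N * \<tau>" using n \<tau> by (intro mult_right_mono) auto
    then have T: "real (Suc n) * \<tau> \<le> T" using N by simp
    have len: "real (Suc n) * \<tau> - real n * \<tau> = \<tau>" by (simp add: algebra_simps)
    have le: "0 \<le> real n * \<tau>" "real n * \<tau> \<le> real (Suc n) * \<tau>" using \<tau> by (auto intro: mult_right_mono)
    define w where "w = Y (real (Suc n) * \<tau>) - Y (real n * \<tau>)"
    have "Y (real (Suc n) * \<tau>) \<in> H" "Y (real n * \<tau>) \<in> H" using Y T le by (auto simp: controlled_def)
    then have w[simp]: "w \<in> H" by (simp add: w_def)
    have "nrm w \<le> integral {real n * \<tau>..real (Suc n) * \<tau>} g1"
      using Y T le by (auto simp: controlled_def w_def)
    then have "(nrm w)\<^sup>2 \<le> (integral {real n * \<tau>..real (Suc n) * \<tau>} g1)\<^sup>2" by (intro power_mono) auto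
    also have "\<dots> \<le> \<tau> * integral {real n * \<tau>..real (Suc n) * \<tau>} (\<lambda>t. (g1 t)\<^sup>2)"
      using square_of_integral_le[OF le(2)] sq_integrableD(1,2)[OF g le(1) T] len by simp
    finally have "(nrm w)\<^sup>2 \<le> \<tau> * integral {real n * \<tau>..real (Suc n) * \<tau>} (\<lambda>t. (g1 t)\<^sup>2)" .
    moreover have "fdiff \<tau> (\<lambda>n. Y (real n * \<tau>)) n = inverse \<tau> *\<^sub>R w"
      by (simp add: fdiff_def w_def)
    then have "\<tau> * (nrm (fdiff \<tau> (\<lambda>n. Y (real n * \<tau>)) n))\<^sup>2 = (nrm w)\<^sup>2 / \<tau>"
      using \<tau> by (simp add: nrm_scale power_mult_distrib power2_eq_square divide_inverse)
    ultimately show ?thesis using \<tau> by (simp add: pos_divide_le_eq mult.commute)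
  qed
  then have "(\<Sum>n<N. \<tau> * (nrm (fdiff \<tau> (\<lambda>n. Y (real n * \<tau>)) n))\<^sup>2)
      \<le> (\<Sum>n<N. integral {real n * \<tau>..real (Suc n) * \<tau>} (\<lambda>t. (g1 t)\<^sup>2))"
    by (intro sum_mono) auto
  also have "\<dots> \<le> (l2time T g1)\<^sup>2" using g \<tau> N by (intro sum_step_square_integrals_le) auto
  finally show ?thesis
    using \<tau> by (intro l2seq_leI) (auto simp: sum_distrib_left)
qed

lemma controlled_path:
  assumes X: "path_derivative T X X'"
    and g: "sq_integrable T g0" "sq_integrable T g1"
    and le: "\<And>t. t \<in> {0..T} \<Longrightarrow> nrm (X t) \<le> g0 t" "\<And>t. t \<in> {0..T} \<Longrightarrow> nrm (X' t) \<le> g1 t"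
  shows "controlled T X g0 g1"
  unfolding controlled_def
proof (intro conjI ballI allI impI)
  fix a b :: real assume ab: "0 \<le> a" "a \<le> b" "b \<le> T"
  show "nrm (X b - X a) \<le> integral {a..b} g1"
    using le(2) ab by (intro increment_le[OF X ab] sq_integrableD(1)[OF g(2)]) auto
qed (use g le(1) path_derivative_mem(1)[OF X] in auto)

text \<open>Subtracting from the path its tangent in the middle point leaves, on either side, an increment
  that the variation of \<open>X'\<close> over the two steps controls.\<close>

lemma second_difference_le:
  assumes X: "path_derivative T X X'" and X': "controlled T X' g1 g2"
    and \<tau>: "0 < \<tau>" and c: "\<tau> \<le> c" "c + \<tau> \<le> T"
  shows "nrm ((X (c + \<tau>) - X c) - (X c - X (c - \<tau>))) \<le> 2 * \<tau> * integral {c - \<tau>..c + \<tau>} g2"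
proof -
  define J where "J = integral {c - \<tau>..c + \<tau>} g2"
  have g: "sq_integrable T g2" using X' by (auto simp: controlled_def)
  have XH: "X t \<in> H" "X' t \<in> H" if "t \<in> {c - \<tau>..c + \<tau>}" for t
    using path_derivative_mem[OF X] that \<tau> c by auto
  have [simp]: "X (c + \<tau>) \<in> H" "X c \<in> H" "X (c - \<tau>) \<in> H" "X' c \<in> H" using XH \<tau> by auto
  have J: "0 \<le> J" unfolding J_def using c by (intro sq_integrableD(4)[OF g]) auto
  have sub: "integral {x..y} g2 \<le> J" if "c - \<tau> \<le> x" "x \<le> y" "y \<le> c + \<tau>" for x y
    unfolding J_def using that \<tau> c
    by (intro integral_subset_le sq_integrableD[OF g]) (auto intro: sq_integrableD(3)[OF g, of 0 T])
  have diff: "nrm (X' t - X' c) \<le> J" if t: "t \<in> {c - \<tau>..c + \<tau>}" for t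
  proof (cases "t \<le> c")
    case True
    then have "nrm (X' c - X' t) \<le> integral {t..c} g2"
      using X' t c \<tau> by (auto simp: controlled_def)
    then show ?thesis using sub[of t c] True t \<tau> XH by (simp add: nrm_diff_commute[of "X' t"])
  next
    case False
    then have "nrm (X' t - X' c) \<le> integral {c..t} g2"
      using X' t c \<tau> by (auto simp: controlled_def)
    then show ?thesis using sub[of c t] False t \<tau> by simp
  qed
  define p q where "p = X (c + \<tau>) - X c - \<tau> *\<^sub>R X' c" and "q = X c - X (c - \<tau>) - \<tau> *\<^sub>R X' c"
  have [simp]: "p \<in> H" "q \<in> H" by (auto simp: p_def q_def)
  have "nrm p \<le> \<tau> * J"
    using linearisation_le[OF X, of c "c + \<tau>" "X' c" J] diff J \<tau> c by (simp add: p_def)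
  moreover have "nrm q \<le> \<tau> * J"
    using linearisation_le[OF X, of "c - \<tau>" c "X' c" J] diff J \<tau> c by (simp add: q_def)
  moreover have "(X (c + \<tau>) - X c) - (X c - X (c - \<tau>)) = p - q" by (simp add: p_def q_def)
  ultimately show ?thesis using nrm_diff_triangle[of p q] by (simp add: J_def)
qed

text \<open>Every step is covered by the two windows centred at its end points, which doubles the integral.\<close>

lemma second_differences_le:
  assumes X: "path_derivative T X X'" and X': "controlled T X' g1 g2"
    and \<tau>: "0 < \<tau>" and N: "real N * \<tau> \<le> T" and n0: "1 \<le> n0"
  shows "l2seq \<tau> {n0..N - 1} (\<lambda>n. nrm (fdiff \<tau> (bdiff \<tau> (\<lambda>n. X (real n * \<tau>))) n)) \<le> 4 * l2time T g2"
proof -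
  have g: "sq_integrable T g2" using X' by (auto simp: controlled_def)
  define I where "I n = integral {real n * \<tau>..real (Suc n) * \<tau>} (\<lambda>t. (g2 t)\<^sup>2)" for n
  have in_T: "real (Suc n) * \<tau> \<le> T" if "n < N" for n
  proof -
    have "real (Suc n) * \<tau> \<le> real N * \<tau>" using that \<tau> by (intro mult_right_mono) auto
    then show ?thesis using N by simp
  qed
  have I0: "0 \<le> I n" if "n < N" for n
    unfolding I_def using \<tau> by (intro sq_integrableD(5)[OF g _ in_T[OF that]]) auto
  have step: "\<tau> * (nrm (fdiff \<tau> (bdiff \<tau> (\<lambda>n. X (real n * \<tau>))) n))\<^sup>2 \<le> 8 * (I (n - 1) + I n)"
    if n: "n \<in> {n0..N - 1}" for n
  proof -
    define c where "c = real n * \<tau>"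
    have nN: "n < N" "n - 1 < N" "1 \<le> n" using n n0 by auto
    have ct: "real (n - 1) * \<tau> = c - \<tau>" "real (Suc (n - 1)) * \<tau> = c" "real (Suc n) * \<tau> = c + \<tau>"
      using nN by (auto simp: c_def algebra_simps of_nat_diff)
    have c: "\<tau> \<le> c" "c + \<tau> \<le> T" using in_T[OF nN(1)] ct nN \<tau> by (auto simp: c_def)
    define w where "w = (X (c + \<tau>) - X c) - (X c - X (c - \<tau>))"
    have [simp]: "w \<in> H"
      unfolding w_def using path_derivative_mem(1)[OF X] c \<tau> by (intro H_diff) auto
    have "nrm w \<le> 2 * \<tau> * integral {c - \<tau>..c + \<tau>} g2"
      unfolding w_def by (rule second_difference_le[OF X X' \<tau> c])
    then have "(nrm w)\<^sup>2 \<le> (2 * \<tau> * integral {c - \<tau>..c + \<tau>} g2)\<^sup>2" by (intro power_mono) auto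
    also have "\<dots> = 4 * \<tau>\<^sup>2 * (integral {c - \<tau>..c + \<tau>} g2)\<^sup>2" by (simp add: power_mult_distrib)
    also have "\<dots> \<le> 4 * \<tau>\<^sup>2 * (2 * \<tau> * integral {c - \<tau>..c + \<tau>} (\<lambda>t. (g2 t)\<^sup>2))"
      using square_of_integral_le[of "c - \<tau>" "c + \<tau>" g2] sq_integrableD(1,2)[OF g, of "c - \<tau>" "c + \<tau>"] c \<tau>
      by (intro mult_left_mono) auto
    also have "integral {c - \<tau>..c + \<tau>} (\<lambda>t. (g2 t)\<^sup>2) = I (n - 1) + I n"
      unfolding I_def ct c_def[symmetric] using c \<tau>
      by (intro Henstock_Kurzweil_Integration.integral_combine[symmetric] sq_integrableD(2)[OF g]) auto
    finally have "(nrm w)\<^sup>2 \<le> 8 * \<tau> ^ 3 * (I (n - 1) + I n)"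
      by (simp add: power2_eq_square power3_eq_cube mult_ac)
    moreover have "fdiff \<tau> (bdiff \<tau> (\<lambda>n. X (real n * \<tau>))) n = inverse (\<tau>\<^sup>2) *\<^sub>R w"
      using ct by (simp add: fdiff_def bdiff_def w_def c_def power2_eq_square scaleR_diff_right)
    then have "(nrm (fdiff \<tau> (bdiff \<tau> (\<lambda>n. X (real n * \<tau>))) n))\<^sup>2 = (nrm w)\<^sup>2 / \<tau> ^ 4"
      by (simp add: nrm_scale power_mult_distrib divide_inverse power_inverse mult.commute)
    moreover have "\<tau> * ((nrm w)\<^sup>2 / \<tau> ^ 4) = (nrm w)\<^sup>2 / \<tau> ^ 3"
      using \<tau> by (simp add: power4_eq_xxxx power3_eq_cube)
    ultimately show ?thesis using \<tau> by (simp add: pos_divide_le_eq mult_ac distrib_left)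
  qed
  have "(\<Sum>n=n0..N - 1. I (n - 1)) = (\<Sum>n\<in>(\<lambda>n. n - 1) ` {n0..N - 1}. I n)"
    using n0 by (subst sum.reindex) (auto simp: inj_on_def)
  also have "\<dots> \<le> (\<Sum>n<N. I n)" using n0 I0 by (intro sum_mono2) auto
  finally have a: "(\<Sum>n=n0..N - 1. I (n - 1)) \<le> (\<Sum>n<N. I n)" .
  have b: "(\<Sum>n=n0..N - 1. I n) \<le> (\<Sum>n<N. I n)" using n0 I0 by (intro sum_mono2) auto
  have "(\<Sum>n=n0..N - 1. \<tau> * (nrm (fdiff \<tau> (bdiff \<tau> (\<lambda>n. X (real n * \<tau>))) n))\<^sup>2)
      \<le> (\<Sum>n=n0..N - 1. 8 * (I (n - 1) + I n))"
    by (intro sum_mono step)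
  also have "\<dots> = 8 * ((\<Sum>n=n0..N - 1. I (n - 1)) + (\<Sum>n=n0..N - 1. I n))"
    by (simp add: sum_distrib_left[symmetric] sum.distrib)
  also have "\<dots> \<le> 16 * (\<Sum>n<N. I n)" using a b by simp
  also have "\<dots> \<le> 16 * (l2time T g2)\<^sup>2"
    unfolding I_def using sum_step_square_integrals_le[OF g _ N] \<tau> by simp
  also have "\<dots> = (4 * l2time T g2)\<^sup>2" by (simp add: power_mult_distrib)
  finally show ?thesis
    using \<tau> by (intro l2seq_leI) (auto simp: sum_distrib_left)
qed

end

section \<open>A skew-symmetric operator with dense domain\<close>

locale skew_operator = semi_inner_space H ip
  for H :: "'a::real_vector set" and ip :: "'a \<Rightarrow> 'a \<Rightarrow> real" +
  fixes V :: "'a set" and G :: "'a \<Rightarrow> 'a"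
  assumes subspace_V: "subspace V" and V_subset: "V \<subseteq> H"
    and V_dense: "\<And>u \<epsilon>. u \<in> H \<Longrightarrow> 0 < \<epsilon> \<Longrightarrow> \<exists>v\<in>V. nrm (u - v) < \<epsilon>"
    and G_mem: "\<And>u. u \<in> V \<Longrightarrow> G u \<in> H"
    and ip_G_linear: "\<And>u v w \<alpha> \<beta>. u \<in> V \<Longrightarrow> v \<in> V \<Longrightarrow> w \<in> H \<Longrightarrow>
      ip (G (\<alpha> *\<^sub>R u + \<beta> *\<^sub>R v)) w = \<alpha> * ip (G u) w + \<beta> * ip (G v) w"
    and skew: "\<And>u v. u \<in> V \<Longrightarrow> v \<in> V \<Longrightarrow> ip (G u) v = - ip u (G v)"
begin

lemma V_H [simp]: "u \<in> V \<Longrightarrow> u \<in> H"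
  using V_subset by auto

lemma G_H [simp]: "u \<in> V \<Longrightarrow> G u \<in> H"
  by (rule G_mem)

lemma V_add [simp]: "u \<in> V \<Longrightarrow> v \<in> V \<Longrightarrow> u + v \<in> V"
  and V_diff [simp]: "u \<in> V \<Longrightarrow> v \<in> V \<Longrightarrow> u - v \<in> V"
  and V_scale [simp]: "u \<in> V \<Longrightarrow> c *\<^sub>R u \<in> V"
  using subspace_V by (auto simp: subspace_add subspace_diff subspace_scale)

lemma V_sum: "(\<And>i. i \<in> A \<Longrightarrow> f i \<in> V) \<Longrightarrow> (\<Sum>i\<in>A. f i) \<in> V"
  using subspace_V by (rule subspace_sum)

lemma V_bdiff [simp]: "\<psi> n \<in> V \<Longrightarrow> \<psi> (n - 1) \<in> V \<Longrightarrow> bdiff \<tau> \<psi> n \<in> V"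
  by (simp add: bdiff_def)

lemma V_wavg: "(\<And>j. j \<le> l \<Longrightarrow> \<psi> (n - j) \<in> V) \<Longrightarrow> wavg l b \<psi> n \<in> V"
  unfolding wavg_def by (intro V_sum V_scale) auto

lemma ip_G_add: "u \<in> V \<Longrightarrow> v \<in> V \<Longrightarrow> w \<in> H \<Longrightarrow> ip (G (u + v)) w = ip (G u) w + ip (G v) w"
  using ip_G_linear[of u v w 1 1] by simp

lemma ip_G_diff: "u \<in> V \<Longrightarrow> v \<in> V \<Longrightarrow> w \<in> H \<Longrightarrow> ip (G (u - v)) w = ip (G u) w - ip (G v) w"
  using ip_G_linear[of u v w 1 "-1"] by simp

lemma ip_G_scale: "u \<in> V \<Longrightarrow> w \<in> H \<Longrightarrow> ip (G (c *\<^sub>R u)) w = c * ip (G u) w"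
  using ip_G_linear[of u u w c 0] by simp

lemma ip_G_zero: "w \<in> H \<Longrightarrow> ip (G 0) w = 0"
  using ip_G_scale[of 0 w 0] subspace_0[OF subspace_V] by simp

lemma ip_G_sum:
  "(\<And>i. i \<in> A \<Longrightarrow> f i \<in> V) \<Longrightarrow> w \<in> H \<Longrightarrow> ip (G (\<Sum>i\<in>A. f i)) w = (\<Sum>i\<in>A. ip (G (f i)) w)"
  by (induction A rule: infinite_finite_induct) (auto simp: ip_G_zero ip_G_add V_sum)

lemma ip_G_wavg:
  assumes V: "\<And>j. j \<le> l \<Longrightarrow> \<psi> (n - j) \<in> V" and [simp]: "w \<in> H"
  shows "ip (G (wavg l b \<psi> n)) w = ip (wavg l b (\<lambda>n. G (\<psi> n)) n) w"
proof -
  have "ip (G (wavg l b \<psi> n)) w = (\<Sum>j\<le>l. ip (G (b j *\<^sub>R \<psi> (n - j))) w)"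
    unfolding wavg_def using V by (intro ip_G_sum) auto
  also have "\<dots> = (\<Sum>j\<le>l. ip (b j *\<^sub>R G (\<psi> (n - j))) w)"
    using V by (intro sum.cong refl) (simp add: ip_G_scale ip_simps)
  also have "\<dots> = ip (wavg l b (\<lambda>n. G (\<psi> n)) n) w"
    unfolding wavg_def using V by (intro ip_sum_left[symmetric]) auto
  finally show ?thesis .
qed

lemma ip_G_bdiff:
  "\<psi> n \<in> V \<Longrightarrow> \<psi> (n - 1) \<in> V \<Longrightarrow> w \<in> H \<Longrightarrow>
    ip (G (bdiff \<tau> \<psi> n)) w = (ip (G (\<psi> n)) w - ip (G (\<psi> (n - 1))) w) / \<tau>"
  by (simp add: bdiff_def ip_G_scale ip_G_diff divide_inverse mult.commute)

text \<open>Skew symmetry moves \<open>G\<close> to the test vectors, which are dense, and a null vector pairs to zero with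
  everything.\<close>

lemma nrm_G_null:
  assumes "u \<in> V" "nrm u = 0"
  shows "nrm (G u) = 0"
proof -
  have "nrm (G u) \<le> 0"
    using assms ip_null[of u] V_subset
    by (intro nrm_le_tested_dense[of V]) (auto simp: V_dense skew)
  moreover have "0 \<le> nrm (G u)" using assms by simp
  ultimately show ?thesis by simp
qed

lemma nrm_stabilized_sq:
  assumes [simp]: "u \<in> V"
  shows "(nrm (u + \<delta> *\<^sub>R G u))\<^sup>2 = (nrm u)\<^sup>2 + (\<delta> * nrm (G u))\<^sup>2"
proof -
  have "ip (G u) u = 0" using skew[of u u] ip_commute[of u "G u"] by simp
  then show ?thesis
    by (simp add: nrm_sq power_mult_distrib ip_simps ip_commute[of u "G u"])
      (simp add: power2_eq_square)
qed

lemma nrm_le_stabilized: "u \<in> V \<Longrightarrow> nrm u \<le> nrm (u + \<delta> *\<^sub>R G u)"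
  by (rule power2_le_imp_le) (simp_all add: nrm_stabilized_sq)

lemma nrm_G_le_stabilized: "u \<in> V \<Longrightarrow> \<delta> * nrm (G u) \<le> nrm (u + \<delta> *\<^sub>R G u)"
  by (rule power2_le_imp_le) (simp_all add: nrm_stabilized_sq)

text \<open>As \<open>G\<close> is unbounded, the image path may fail to be differentiable; tested against the domain, \<open>G\<close> moves over to the other factor, where the fundamental theorem applies.\<close>

lemma controlled_G_path:
  assumes X: "path_derivative T X X'"
    and V: "\<And>t. t \<in> {0..T} \<Longrightarrow> X t \<in> V" "\<And>t. t \<in> {0..T} \<Longrightarrow> X' t \<in> V"
    and g: "sq_integrable T g0" "sq_integrable T g1"
    and le: "\<And>t. t \<in> {0..T} \<Longrightarrow> nrm (G (X t)) \<le> g0 t" "\<And>t. t \<in> {0..T} \<Longrightarrow> nrm (G (X' t)) \<le> g1 t"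
  shows "controlled T (\<lambda>t. G (X t)) g0 g1"
  unfolding controlled_def
proof (intro conjI ballI allI impI)
  fix a b :: real assume ab: "0 \<le> a" "a \<le> b" "b \<le> T"
  note g1 = sq_integrableD[OF g(2) ab(1,3)]
  have [simp]: "X a \<in> V" "X b \<in> V" using V ab by auto
  show "nrm (G (X b) - G (X a)) \<le> integral {a..b} g1"
  proof (rule nrm_le_tested_dense[OF V_dense V_subset])
    fix v assume [simp]: "v \<in> V"
    have "\<bar>ip (X b - X a) (G v)\<bar> \<le> nrm v * integral {a..b} g1"
    proof (rule tested_increment_le[OF X ab _ g1(1)])
      fix t assume "t \<in> {a..b}"
      then have t: "t \<in> {0..T}" using ab by auto
      then have [simp]: "X' t \<in> V" by (rule V)
      have "\<bar>ip (X' t) (G v)\<bar> = \<bar>ip (G (X' t)) v\<bar>" by (simp add: skew)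
      also have "\<dots> \<le> nrm (G (X' t)) * nrm v" by (intro Cauchy_Schwarz) auto
      also have "\<dots> \<le> g1 t * nrm v" using le(2)[OF t] by (intro mult_right_mono) auto
      finally show "\<bar>ip (X' t) (G v)\<bar> \<le> nrm v * g1 t" by (simp add: mult.commute)
    qed simp
    moreover have "ip (G (X b) - G (X a)) v = - ip (X b - X a) (G v)" by (simp add: ip_simps skew)
    ultimately show "\<bar>ip (G (X b) - G (X a)) v\<bar> \<le> integral {a..b} g1 * nrm v"
      by (simp add: mult.commute)
  qed (use g1 in auto)
qed (use g V le in auto)

text \<open>The operator \<open>A\<^sub>\<tau>\<close> of the scheme, acting on sequences.\<close>

definition material :: "nat \<Rightarrow> (nat \<Rightarrow> real) \<Rightarrow> real \<Rightarrow> (nat \<Rightarrow> 'a) \<Rightarrow> nat \<Rightarrow> 'a" where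
  "material l b \<tau> \<psi> n = bdiff \<tau> \<psi> n + G (wavg l b \<psi> n)"

end

section \<open>Stability of the discrete error\<close>

text \<open>The discrete error \<open>\<phi>\<close> is driven by the projection error \<open>\<eta>\<close> and the truncation residual \<open>\<rho>\<close>.
  The Galerkin equation that links them is left out: it enters only through the energy inequality, which
  is an assumption of the stability theorem.\<close>

locale scheme_error = skew_operator H ip V G
  for H :: "'a::real_vector set" and ip V G +
  fixes Vh :: "'a set" and l n0 N :: nat and b :: "nat \<Rightarrow> real" and \<tau> \<delta> T :: real
    and \<phi> \<eta> \<rho> :: "nat \<Rightarrow> 'a"
  assumes subspace_Vh: "subspace Vh" and Vh_subset: "Vh \<subseteq> V"
    and steps: "l \<le> n0" "1 \<le> n0" "n0 \<le> N" "0 < \<tau>" "real N * \<tau> \<le> T" and \<delta>: "0 < \<delta>"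
    and \<phi>_mem: "\<And>n. n \<le> N \<Longrightarrow> \<phi> n \<in> Vh"
    and \<phi>_init: "\<And>j. j < n0 \<Longrightarrow> nrm (\<phi> j) = 0"
    and \<eta>_mem: "\<And>n. n \<le> N \<Longrightarrow> \<eta> n \<in> V"
    and \<eta>_orthogonal: "\<And>n w. n \<le> N \<Longrightarrow> w \<in> Vh \<Longrightarrow> ip (\<eta> n) w = 0"
    and \<rho>_mem: "\<And>n. n0 \<le> n \<Longrightarrow> n \<le> N \<Longrightarrow> \<rho> n \<in> H"
begin

definition forcing :: "nat \<Rightarrow> 'a" where
  "forcing n = material l b \<tau> \<eta> n - \<rho> n"

text \<open>The test function \<open>P\<^sub>\<delta>\<phi> = T\<^sub>\<delta>S\<^sub>\<delta>\<phi>\<close> of the energy argument.\<close>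

definition multiplier :: "nat \<Rightarrow> 'a" where
  "multiplier n = (let S = wavg l b \<phi> n + \<delta> *\<^sub>R bdiff \<tau> \<phi> n in S + \<delta> *\<^sub>R G S)"

lemma earlier_index [simp]: "n \<le> N \<Longrightarrow> n - j \<le> N"
  by simp

lemma \<phi>_V [simp]: "n \<le> N \<Longrightarrow> \<phi> n \<in> V"
  using \<phi>_mem Vh_subset by auto

lemma \<eta>_V [simp]: "n \<le> N \<Longrightarrow> \<eta> n \<in> V"
  by (rule \<eta>_mem)

lemma wavg_V [simp]: "n \<le> N \<Longrightarrow> wavg l b \<phi> n \<in> V" "n \<le> N \<Longrightarrow> wavg l b \<eta> n \<in> V"
  by (auto intro!: V_wavg)

lemma wavg_\<phi>_Vh: "n \<le> N \<Longrightarrow> wavg l b \<phi> n \<in> Vh"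
  unfolding wavg_def using \<phi>_mem subspace_Vh by (intro subspace_sum subspace_scale) auto

lemma bdiff_\<phi>_Vh: "n \<le> N \<Longrightarrow> bdiff \<tau> \<phi> n \<in> Vh"
  unfolding bdiff_def using \<phi>_mem subspace_Vh by (intro subspace_scale subspace_diff) auto

lemma bdiff_V [simp]: "n \<le> N \<Longrightarrow> bdiff \<tau> \<phi> n \<in> V" "n \<le> N \<Longrightarrow> bdiff \<tau> \<eta> n \<in> V"
  by (auto simp: bdiff_def)

lemma material_H [simp]: "n \<le> N \<Longrightarrow> material l b \<tau> \<phi> n \<in> H" "n \<le> N \<Longrightarrow> material l b \<tau> \<eta> n \<in> H"
  by (auto simp: material_def)

lemma forcing_H [simp]: "n0 \<le> n \<Longrightarrow> n \<le> N \<Longrightarrow> forcing n \<in> H"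
  using \<rho>_mem by (auto simp: forcing_def)

lemma bdiff_\<eta>_orthogonal: "n \<le> N \<Longrightarrow> w \<in> Vh \<Longrightarrow> ip (bdiff \<tau> \<eta> n) w = 0"
  using Vh_subset by (auto simp: bdiff_def ip_simps \<eta>_orthogonal subset_iff)

lemma wavg_\<eta>_orthogonal: "n \<le> N \<Longrightarrow> w \<in> Vh \<Longrightarrow> ip (wavg l b \<eta> n) w = 0"
  using Vh_subset by (auto simp: wavg_def ip_simps \<eta>_orthogonal subset_iff)

text \<open>Orthogonality of the projection error removes its difference quotient from the first pairing.
  The term with \<open>G\<close> loses no power of the mesh size: skew symmetry moves \<open>G\<close> to the
  average of \<open>\<phi>\<close>, where it is completed to the material residual, again by orthogonality. Only the
  second-order part of the multiplier is left, as the last summand.\<close>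

lemma forcing_multiplier:
  assumes n: "n0 \<le> n" "n \<le> N"
  shows "ip (forcing n) (multiplier n)
    = - ip (\<rho> n) (wavg l b \<phi> n) - ip (wavg l b \<eta> n) (material l b \<tau> \<phi> n)
      + \<delta> * ip (forcing n) (material l b \<tau> \<phi> n) + \<delta>\<^sup>2 * ip (forcing n) (G (bdiff \<tau> \<phi> n))"
proof -
  note [simp] = n
  have [simp]: "\<rho> n \<in> H" by (rule \<rho>_mem) auto
  let ?M = "wavg l b \<phi> n" and ?D = "bdiff \<tau> \<phi> n" and ?R = "forcing n"
  have "ip ?R (G (?M + \<delta> *\<^sub>R ?D)) = ip ?R (G ?M) + \<delta> * ip ?R (G ?D)"
    by (simp add: ip_commute[of ?R] ip_G_add ip_G_scale)
  then have "ip ?R (multiplier n)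
      = ip ?R ?M + \<delta> * ip ?R (material l b \<tau> \<phi> n) + \<delta>\<^sup>2 * ip ?R (G ?D)"
    by (simp add: multiplier_def Let_def material_def ip_simps power2_eq_square algebra_simps)
  moreover have "ip ?R ?M = - ip (\<rho> n) ?M - ip (wavg l b \<eta> n) (material l b \<tau> \<phi> n)"
  proof -
    have "ip ?R ?M = ip (bdiff \<tau> \<eta> n) ?M + ip (G (wavg l b \<eta> n)) ?M - ip (\<rho> n) ?M"
      by (simp add: forcing_def material_def ip_simps)
    also have "ip (bdiff \<tau> \<eta> n) ?M = 0" by (simp add: bdiff_\<eta>_orthogonal wavg_\<phi>_Vh)
    also have "ip (G (wavg l b \<eta> n)) ?M = - ip (wavg l b \<eta> n) (G ?M)" by (simp add: skew)
    also have "\<dots> = - ip (wavg l b \<eta> n) (material l b \<tau> \<phi> n)"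
      using wavg_\<eta>_orthogonal[OF n(2) bdiff_\<phi>_Vh[OF n(2)]] by (simp add: material_def ip_simps)
    finally show ?thesis by simp
  qed
  ultimately show ?thesis by simp
qed

text \<open>The initial values of \<open>\<phi>\<close> are null vectors; that \<open>G\<close> maps them to null vectors is a consequence
  of skew symmetry.\<close>

lemma nrm_\<phi>_init_stabilized:
  assumes "j < n0"
  shows "nrm (\<phi> j + \<delta> *\<^sub>R G (\<phi> j)) = 0" "nrm (G (\<phi> j)) = 0"
proof -
  have j: "\<phi> j \<in> V" using assms steps by simp
  then show 0: "nrm (G (\<phi> j)) = 0" using assms by (intro nrm_G_null \<phi>_init)
  then have "(nrm (\<phi> j + \<delta> *\<^sub>R G (\<phi> j)))\<^sup>2 = 0"
    using \<phi>_init[OF assms] j by (simp add: nrm_stabilized_sq)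
  then show "nrm (\<phi> j + \<delta> *\<^sub>R G (\<phi> j)) = 0" by simp
qed

abbreviation "weights \<equiv> \<Sum>j\<le>l. \<bar>b j\<bar>"

text \<open>Summation by parts moves the difference quotient from \<open>G \<phi>\<close>, which one factor \<open>\<delta>\<close> makes
  part of the energy, to the forcing. The initial boundary term vanishes.\<close>

lemma second_order_part_le:
  assumes m: "n0 \<le> m" "m \<le> N"
    and Y: "\<And>n. n \<le> N \<Longrightarrow> nrm (\<phi> n + \<delta> *\<^sub>R G (\<phi> n)) \<le> Y"
    and Rs: "\<And>n. n0 \<le> n \<Longrightarrow> n \<le> N \<Longrightarrow> nrm (forcing n) \<le> Rs"
  shows "\<tau> * (\<Sum>n=n0..m. \<delta>\<^sup>2 * ip (forcing n) (G (bdiff \<tau> \<phi> n)))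
    \<le> \<delta> * (Rs + sqrt T * l2seq \<tau> {n0..N - 1} (\<lambda>n. nrm (fdiff \<tau> forcing n))) * Y"
proof -
  define P where "P i j = ip (forcing i) (G (\<phi> j))" for i j
  have \<tau>: "0 < \<tau>" "0 \<le> \<tau>" using steps by auto
  have Y0: "0 \<le> Y" by (rule order_trans[OF _ Y[of 0]]) auto
  have G_le: "\<delta> * nrm (G (\<phi> n)) \<le> Y" if "n \<le> N" for n
    using Y[OF that] nrm_G_le_stabilized[of "\<phi> n" \<delta>] that by simp
  have "\<tau> * (\<Sum>n=n0..m. ip (forcing n) (G (bdiff \<tau> \<phi> n))) = (\<Sum>n=n0..m. P n n - P n (n - 1))"
    unfolding sum_distrib_left
  proof (intro sum.cong refl)
    fix n assume n: "n \<in> {n0..m}"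
    then have "ip (forcing n) (G (bdiff \<tau> \<phi> n)) = (P n n - P n (n - 1)) / \<tau>"
      using m by (simp add: P_def ip_commute[of "forcing n"] ip_G_bdiff)
    then show "\<tau> * ip (forcing n) (G (bdiff \<tau> \<phi> n)) = P n n - P n (n - 1)" using \<tau> by simp
  qed
  also have "\<dots> = P m m - P n0 (n0 - 1) - (\<Sum>n=n0..m - 1. P (n + 1) n - P n n)"
    using steps m by (intro summation_by_parts) auto
  also have "P n0 (n0 - 1) = 0"
  proof -
    have "ip (G (\<phi> (n0 - 1))) (forcing n0) = 0"
      using steps nrm_\<phi>_init_stabilized(2)[of "n0 - 1"] by (intro ip_null) auto
    then show ?thesis using steps by (simp add: P_def ip_commute)
  qed
  finally have parts: "\<tau> * (\<Sum>n=n0..m. ip (forcing n) (G (bdiff \<tau> \<phi> n)))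
      = P m m + (\<Sum>n=n0..m - 1. P n n - P (n + 1) n)"
    by (simp add: sum_subtractf)
  have "\<tau> * (\<Sum>n=n0..m. \<delta>\<^sup>2 * ip (forcing n) (G (bdiff \<tau> \<phi> n)))
      = \<delta>\<^sup>2 * (\<tau> * (\<Sum>n=n0..m. ip (forcing n) (G (bdiff \<tau> \<phi> n))))"
    by (simp add: sum_distrib_left mult_ac)
  then have eq: "\<tau> * (\<Sum>n=n0..m. \<delta>\<^sup>2 * ip (forcing n) (G (bdiff \<tau> \<phi> n)))
      = \<delta>\<^sup>2 * P m m + (\<Sum>n=n0..m - 1. \<delta>\<^sup>2 * (P n n - P (n + 1) n))"
    unfolding parts by (simp only: distrib_left sum_distrib_left)
  have "\<delta>\<^sup>2 * P m m \<le> \<delta> * Rs * Y"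
  proof -
    have "P m m \<le> nrm (forcing m) * nrm (G (\<phi> m))" unfolding P_def using m by (intro ip_le) auto
    also have "\<dots> \<le> Rs * nrm (G (\<phi> m))" using m Rs by (intro mult_right_mono) auto
    finally have "\<delta>\<^sup>2 * P m m \<le> \<delta> * Rs * (\<delta> * nrm (G (\<phi> m)))"
      using \<delta> by (simp add: power2_eq_square)
    also have "\<dots> \<le> \<delta> * Rs * Y"
    proof (intro mult_left_mono G_le mult_nonneg_nonneg)
      show "0 \<le> Rs" by (rule order_trans[OF _ Rs[OF m]]) (use m in simp)
    qed (use \<delta> m in auto)
    finally show ?thesis .
  qed
  moreover have "(\<Sum>n=n0..m - 1. \<delta>\<^sup>2 * (P n n - P (n + 1) n))
      \<le> \<delta> * (sqrt T * l2seq \<tau> {n0..N - 1} (\<lambda>n. nrm (fdiff \<tau> forcing n))) * Y"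
  proof -
    have mem: "fdiff \<tau> forcing n \<in> H" if "n \<in> {n0..N - 1}" for n
      using that steps by (auto simp: fdiff_def)
    have "(\<Sum>n=n0..m - 1. \<delta>\<^sup>2 * (P n n - P (n + 1) n))
        \<le> (\<Sum>n=n0..m - 1. \<delta> * Y * (\<tau> * nrm (fdiff \<tau> forcing n)))"
    proof (intro sum_mono)
      fix n assume n: "n \<in> {n0..m - 1}"
      then have nN: "n0 \<le> n" "n + 1 \<le> N" using m steps by auto
      have f: "fdiff \<tau> forcing n \<in> H" using mem n m by auto
      have "P n n - P (n + 1) n = - \<tau> * ip (fdiff \<tau> forcing n) (G (\<phi> n))"
        using \<tau> nN by (simp add: P_def fdiff_def ip_simps flip: mult.assoc)
      also have "\<dots> \<le> \<tau> * (nrm (fdiff \<tau> forcing n) * nrm (G (\<phi> n)))"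
        using \<tau> f nN mult_left_mono[OF neg_ip_le[of "fdiff \<tau> forcing n" "G (\<phi> n)"], of \<tau>] by simp
      finally have "\<delta>\<^sup>2 * (P n n - P (n + 1) n)
          \<le> \<delta> * (\<tau> * nrm (fdiff \<tau> forcing n)) * (\<delta> * nrm (G (\<phi> n)))"
        using \<delta> by (simp add: power2_eq_square mult_ac)
      also have "\<dots> \<le> \<delta> * (\<tau> * nrm (fdiff \<tau> forcing n)) * Y"
        using \<delta> \<tau> f nN by (intro mult_left_mono G_le) auto
      finally show "\<delta>\<^sup>2 * (P n n - P (n + 1) n) \<le> \<delta> * Y * (\<tau> * nrm (fdiff \<tau> forcing n))"
        by (simp add: mult_ac)
    qed
    also have "\<dots> = \<delta> * Y * (\<tau> * (\<Sum>n=n0..m - 1. nrm (fdiff \<tau> forcing n)))"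
      by (simp add: sum_distrib_left)
    also have "\<tau> * (\<Sum>n=n0..m - 1. nrm (fdiff \<tau> forcing n))
        \<le> sqrt T * l2seq \<tau> {n0..m - 1} (\<lambda>n. nrm (fdiff \<tau> forcing n))"
    proof (rule sum_le_l2seq[OF \<tau>(2)])
      have "card {n0..m - 1} \<le> N" unfolding card_atLeastAtMost using m steps by linarith
      then have "\<tau> * real (card {n0..m - 1}) \<le> \<tau> * real N" using \<tau> by (intro mult_left_mono) linarith+
      then show "\<tau> * real (card {n0..m - 1}) \<le> T" using steps(5) by (simp only: mult.commute[of \<tau>])
    qed
    also have "\<dots> \<le> sqrt T * l2seq \<tau> {n0..N - 1} (\<lambda>n. nrm (fdiff \<tau> forcing n))"
    proof (rule mult_left_mono)
      show "l2seq \<tau> {n0..m - 1} (\<lambda>n. nrm (fdiff \<tau> forcing n))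
          \<le> l2seq \<tau> {n0..N - 1} (\<lambda>n. nrm (fdiff \<tau> forcing n))"
        using \<tau> m mem by (intro l2seq_mono) auto
      have "0 \<le> T" by (rule order_trans[OF _ steps(5)]) (use \<tau> in simp)
      then show "0 \<le> sqrt T" by simp
    qed
    finally have "(\<Sum>n=n0..m - 1. \<delta>\<^sup>2 * (P n n - P (n + 1) n))
        \<le> \<delta> * Y * (sqrt T * l2seq \<tau> {n0..N - 1} (\<lambda>n. nrm (fdiff \<tau> forcing n)))"
      using \<delta> Y0 by (simp add: mult_left_mono)
    then show ?thesis by (simp add: mult_ac)
  qed
  ultimately show ?thesis unfolding eq by (simp add: algebra_simps)
qed

lemma pairing_sum_le:
  assumes m: "n0 \<le> m" "m \<le> N"
    and Y: "\<And>n. n \<le> N \<Longrightarrow> nrm (\<phi> n + \<delta> *\<^sub>R G (\<phi> n)) \<le> Y"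
    and Rs: "\<And>n. n0 \<le> n \<Longrightarrow> n \<le> N \<Longrightarrow> nrm (forcing n) \<le> Rs"
  shows "\<tau> * (\<Sum>n=n0..m. ip (forcing n) (multiplier n))
    \<le> (weights * sqrt T * l2seq \<tau> {n0..N} (\<lambda>n. nrm (\<rho> n))
        + \<delta> * (Rs + sqrt T * l2seq \<tau> {n0..N - 1} (\<lambda>n. nrm (fdiff \<tau> forcing n)))) * Y
      + (l2seq \<tau> {n0..N} (\<lambda>n. nrm (wavg l b \<eta> n))
        + \<delta> * l2seq \<tau> {n0..N} (\<lambda>n. nrm (forcing n)))
        * l2seq \<tau> {n0..N} (\<lambda>n. nrm (material l b \<tau> \<phi> n))"
proof -
  have \<tau>: "0 < \<tau>" "0 \<le> \<tau>" using steps by auto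
  have Y0: "0 \<le> Y" by (rule order_trans[OF _ Y[of 0]]) auto
  let ?A = "\<lambda>n. nrm (material l b \<tau> \<phi> n)"
  have ext: "(\<Sum>n=n0..m. f n) \<le> (\<Sum>n=n0..N. f n)" if "\<And>n. n0 \<le> n \<Longrightarrow> n \<le> N \<Longrightarrow> 0 \<le> f n" for f :: "nat \<Rightarrow> real"
    using m that by (intro sum_mono2) auto
  have "\<tau> * (\<Sum>n=n0..m. - ip (\<rho> n) (wavg l b \<phi> n)) \<le> weights * sqrt T * l2seq \<tau> {n0..N} (\<lambda>n. nrm (\<rho> n)) * Y"
  proof -
    have "(\<Sum>n=n0..m. - ip (\<rho> n) (wavg l b \<phi> n)) \<le> (\<Sum>n=n0..m. nrm (\<rho> n) * (weights * Y))"
    proof (intro sum_mono)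
      fix n assume n: "n \<in> {n0..m}"
      then have nN: "n \<le> N" using m by auto
      have [simp]: "\<rho> n \<in> H" using \<rho>_mem n m by auto
      have "nrm (wavg l b \<phi> n) \<le> (\<Sum>j\<le>l. \<bar>b j\<bar> * nrm (\<phi> (n - j)))"
        using nN by (intro nrm_wavg_le) auto
      also have "\<dots> \<le> (\<Sum>j\<le>l. \<bar>b j\<bar> * Y)"
      proof (intro sum_mono mult_left_mono)
        fix j show "nrm (\<phi> (n - j)) \<le> Y"
          using nN by (intro order_trans[OF nrm_le_stabilized Y]) auto
      qed auto
      finally have "nrm (wavg l b \<phi> n) \<le> weights * Y" by (simp add: sum_distrib_right)
      then have "nrm (\<rho> n) * nrm (wavg l b \<phi> n) \<le> nrm (\<rho> n) * (weights * Y)"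
        by (intro mult_left_mono) auto
      then show "- ip (\<rho> n) (wavg l b \<phi> n) \<le> nrm (\<rho> n) * (weights * Y)"
        using neg_ip_le[of "\<rho> n" "wavg l b \<phi> n"] nN by simp
    qed
    also have "\<dots> \<le> (\<Sum>n=n0..N. nrm (\<rho> n) * (weights * Y))"
      using \<rho>_mem Y0 by (intro ext mult_nonneg_nonneg sum_nonneg) auto
    finally have "\<tau> * (\<Sum>n=n0..m. - ip (\<rho> n) (wavg l b \<phi> n))
        \<le> \<tau> * (\<Sum>n=n0..N. nrm (\<rho> n) * (weights * Y))"
      using \<tau> by (intro mult_left_mono) auto
    also have "\<dots> = (\<tau> * (\<Sum>n=n0..N. nrm (\<rho> n))) * (weights * Y)"
      by (simp add: sum_distrib_right)
    also have "\<dots> \<le> (sqrt T * l2seq \<tau> {n0..N} (\<lambda>n. nrm (\<rho> n))) * (weights * Y)"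
    proof (intro mult_right_mono sum_le_l2seq)
      have "card {n0..N} \<le> N" using steps by simp
      then have "\<tau> * real (card {n0..N}) \<le> \<tau> * real N" using \<tau> by (intro mult_left_mono) linarith+
      then show "\<tau> * real (card {n0..N}) \<le> T" using steps(5) by (simp only: mult.commute[of \<tau>])
    qed (use \<tau> Y0 in \<open>auto intro!: mult_nonneg_nonneg sum_nonneg\<close>)
    finally show ?thesis by (simp add: mult_ac)
  qed
  moreover have "\<tau> * (\<Sum>n=n0..m. - ip (wavg l b \<eta> n) (material l b \<tau> \<phi> n))
      \<le> l2seq \<tau> {n0..N} (\<lambda>n. nrm (wavg l b \<eta> n)) * l2seq \<tau> {n0..N} ?A"
  proof -
    have "(\<Sum>n=n0..m. - ip (wavg l b \<eta> n) (material l b \<tau> \<phi> n)) \<le> (\<Sum>n=n0..m. nrm (wavg l b \<eta> n) * ?A n)"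
      using m by (intro sum_mono neg_ip_le) auto
    also have "\<dots> \<le> (\<Sum>n=n0..N. nrm (wavg l b \<eta> n) * ?A n)" by (intro ext) auto
    finally have "\<tau> * (\<Sum>n=n0..m. - ip (wavg l b \<eta> n) (material l b \<tau> \<phi> n)) \<le> \<tau> * \<dots>"
      using \<tau> by (intro mult_left_mono) auto
    then show ?thesis using sum_mult_le_l2seq[OF \<tau>(2)] by (rule order_trans)
  qed
  moreover have "\<tau> * (\<Sum>n=n0..m. \<delta> * ip (forcing n) (material l b \<tau> \<phi> n))
      \<le> \<delta> * l2seq \<tau> {n0..N} (\<lambda>n. nrm (forcing n)) * l2seq \<tau> {n0..N} ?A"
  proof -
    have "(\<Sum>n=n0..m. ip (forcing n) (material l b \<tau> \<phi> n)) \<le> (\<Sum>n=n0..m. nrm (forcing n) * ?A n)"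
      using m by (intro sum_mono ip_le) auto
    also have "\<dots> \<le> (\<Sum>n=n0..N. nrm (forcing n) * ?A n)" by (intro ext) auto
    finally have "\<tau> * (\<Sum>n=n0..m. ip (forcing n) (material l b \<tau> \<phi> n)) \<le> \<tau> * \<dots>"
      using \<tau> by (intro mult_left_mono) auto
    also have "\<dots> \<le> l2seq \<tau> {n0..N} (\<lambda>n. nrm (forcing n)) * l2seq \<tau> {n0..N} ?A"
      by (rule sum_mult_le_l2seq[OF \<tau>(2)])
    finally have "\<delta> * (\<tau> * (\<Sum>n=n0..m. ip (forcing n) (material l b \<tau> \<phi> n)))
        \<le> \<delta> * (l2seq \<tau> {n0..N} (\<lambda>n. nrm (forcing n)) * l2seq \<tau> {n0..N} ?A)"
      using \<delta> by (intro mult_left_mono) auto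
    then show ?thesis by (simp add: sum_distrib_left[symmetric] mult_ac)
  qed
  moreover note second_order_part_le[OF m Y Rs]
  moreover have "(\<Sum>n=n0..m. ip (forcing n) (multiplier n))
      = (\<Sum>n=n0..m. - ip (\<rho> n) (wavg l b \<phi> n))
        + (\<Sum>n=n0..m. - ip (wavg l b \<eta> n) (material l b \<tau> \<phi> n))
        + (\<Sum>n=n0..m. \<delta> * ip (forcing n) (material l b \<tau> \<phi> n))
        + (\<Sum>n=n0..m. \<delta>\<^sup>2 * ip (forcing n) (G (bdiff \<tau> \<phi> n)))"
    unfolding sum.distrib[symmetric] using m by (intro sum.cong refl) (simp add: forcing_multiplier)
  ultimately show ?thesis by (simp add: distrib_left distrib_right)
qed

end

lemma quadratic_absorption:
  fixes s q Z k :: real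
  assumes "0 \<le> s" "0 \<le> q" "0 \<le> Z" "0 \<le> k" and le: "s\<^sup>2 \<le> k * (q * s + Z\<^sup>2)"
  shows "s \<le> (1 + k) * (q + Z)"
proof (rule ccontr)
  assume "\<not> s \<le> (1 + k) * (q + Z)"
  then have s: "(1 + k) * (q + Z) < s" by simp
  have "0 \<le> k * (q + Z)" using assms by simp
  then have sZ: "Z \<le> s" using s assms(2) by (simp add: distrib_right)
  have "0 \<le> (1 + k) * (q + Z)" using assms by simp
  then have s0: "0 < s" using s by simp
  have "k * (q * s + Z\<^sup>2) \<le> k * (q * s + Z * s)"
    using sZ assms by (intro mult_left_mono) (auto simp: power2_eq_square mult_left_mono)
  also have "\<dots> \<le> (1 + k) * (q + Z) * s" using assms by (simp add: algebra_simps)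
  also have "\<dots> < s * s" using s s0 by (intro mult_strict_right_mono)
  finally show False using le by (simp add: power2_eq_square)
qed

context scheme_error
begin

text \<open>The sum \<open>Y + D\<close> of the largest stabilized norm and the accumulated dissipation satisfies a
  quadratic inequality whose linear coefficient is the size of the data. The largest stabilized norm is
  attained at some index, where the energy inequality is read; the dissipation is read off at the last
  index.\<close>

theorem stability:
  fixes e d :: "nat \<Rightarrow> real"
  assumes c: "0 < cE" "0 < CE"
    and e: "\<And>n. n0 \<le> n \<Longrightarrow> n \<le> N \<Longrightarrow> cE * (nrm (\<phi> n + \<delta> *\<^sub>R G (\<phi> n)))\<^sup>2 \<le> e n"
    and d: "\<And>n. n0 \<le> n \<Longrightarrow> n \<le> N \<Longrightarrow> cE * \<delta> * (nrm (material l b \<tau> \<phi> n))\<^sup>2 \<le> d n"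
    and energy: "\<And>m. n0 \<le> m \<Longrightarrow> m \<le> N \<Longrightarrow> e m + \<tau> * (\<Sum>n=n0..m. d n)
      \<le> CE * \<tau> * (\<Sum>n=n0..m. ip (forcing n) (multiplier n))
        + CE * \<tau> * (l2seq \<tau> {n0..m} (\<lambda>n. nrm (forcing n)))\<^sup>2"
    and Rs: "\<And>n. n0 \<le> n \<Longrightarrow> n \<le> N \<Longrightarrow> nrm (forcing n) \<le> Rs"
    and B: "B = (1 + 4 * CE / cE) * (weights * sqrt T * l2seq \<tau> {n0..N} (\<lambda>n. nrm (\<rho> n))
        + \<delta> * (Rs + sqrt T * l2seq \<tau> {n0..N - 1} (\<lambda>n. nrm (fdiff \<tau> forcing n)))
        + (l2seq \<tau> {n0..N} (\<lambda>n. nrm (wavg l b \<eta> n)) / sqrt \<delta>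
          + sqrt \<delta> * l2seq \<tau> {n0..N} (\<lambda>n. nrm (forcing n)))
        + sqrt \<tau> * l2seq \<tau> {n0..N} (\<lambda>n. nrm (forcing n)))"
  shows "\<And>n. n0 \<le> n \<Longrightarrow> n \<le> N \<Longrightarrow> nrm (\<phi> n + \<delta> *\<^sub>R G (\<phi> n)) \<le> B"
    and "sqrt \<delta> * l2seq \<tau> {n0..N} (\<lambda>n. nrm (material l b \<tau> \<phi> n)) \<le> B"
proof -
  have \<tau>: "0 < \<tau>" "0 \<le> \<tau>" using steps by auto
  have T: "0 \<le> T" by (rule order_trans[OF _ steps(5)]) (use \<tau> in simp)
  define y where "y n = nrm (\<phi> n + \<delta> *\<^sub>R G (\<phi> n))" for n
  have y0: "0 \<le> y n" if "n \<le> N" for n unfolding y_def using that by simp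
  define Y where "Y = Max (y ` {n0..N})"
  define D where "D = sqrt \<delta> * l2seq \<tau> {n0..N} (\<lambda>n. nrm (material l b \<tau> \<phi> n))"
  define LR where "LR = l2seq \<tau> {n0..N} (\<lambda>n. nrm (forcing n))"
  define Q where "Q = weights * sqrt T * l2seq \<tau> {n0..N} (\<lambda>n. nrm (\<rho> n))
        + \<delta> * (Rs + sqrt T * l2seq \<tau> {n0..N - 1} (\<lambda>n. nrm (fdiff \<tau> forcing n)))"
  define Q' where "Q' = l2seq \<tau> {n0..N} (\<lambda>n. nrm (wavg l b \<eta> n)) / sqrt \<delta> + sqrt \<delta> * LR"
  define Z where "Z = sqrt \<tau> * LR"
  have Y_mem: "Y \<in> y ` {n0..N}" unfolding Y_def using steps by (intro Max_in) auto
  have Y_n0: "y n \<le> Y" if "n0 \<le> n" "n \<le> N" for n unfolding Y_def using that by (intro Max_ge) auto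
  have Y0: "0 \<le> Y" using Y_n0[of N] y0[of N] steps by simp
  have Y_le: "y n \<le> Y" if "n \<le> N" for n
    using Y_n0[of n] that Y0 nrm_\<phi>_init_stabilized(1)[of n] by (cases "n < n0") (auto simp: y_def)
  have Rs0: "0 \<le> Rs" by (rule order_trans[OF _ Rs[of N]]) (use steps in auto)
  have nn: "0 \<le> D" "0 \<le> LR" "0 \<le> Q" "0 \<le> Q'" "0 \<le> Z"
    using \<tau> \<delta> T Rs0 by (auto simp: D_def LR_def Q_def Q'_def Z_def
        intro!: add_nonneg_nonneg mult_nonneg_nonneg divide_nonneg_nonneg sum_nonneg)
  have sd: "sqrt \<delta> * sqrt \<delta> = \<delta>" "0 < sqrt \<delta>" using \<delta> by auto
  have main: "e m + \<tau> * (\<Sum>n=n0..m. d n) \<le> CE * (Q * Y + Q' * D + Z\<^sup>2)" if m: "n0 \<le> m" "m \<le> N" for m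
  proof -
    have "\<tau> * (\<Sum>n=n0..m. ip (forcing n) (multiplier n)) \<le> Q * Y
        + (l2seq \<tau> {n0..N} (\<lambda>n. nrm (wavg l b \<eta> n)) + \<delta> * LR)
          * l2seq \<tau> {n0..N} (\<lambda>n. nrm (material l b \<tau> \<phi> n))"
      unfolding Q_def LR_def using Y_le Rs by (intro pairing_sum_le[OF m]) (auto simp: y_def)
    also have "(l2seq \<tau> {n0..N} (\<lambda>n. nrm (wavg l b \<eta> n)) + \<delta> * LR)
          * l2seq \<tau> {n0..N} (\<lambda>n. nrm (material l b \<tau> \<phi> n)) = Q' * D"
    proof -
      have "Q' * sqrt \<delta> = l2seq \<tau> {n0..N} (\<lambda>n. nrm (wavg l b \<eta> n)) + (sqrt \<delta> * sqrt \<delta>) * LR"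
      proof -
        have "(x / t + t * LR) * t = x + (t * t) * LR" if "t \<noteq> 0" for x t :: real
          using that by (simp add: field_simps)
        from this[of "sqrt \<delta>" "l2seq \<tau> {n0..N} (\<lambda>n. nrm (wavg l b \<eta> n))"] show ?thesis using sd(2) unfolding Q'_def by simp
      qed
      then show ?thesis unfolding sd(1) D_def by (simp add: mult.assoc[symmetric])
    qed
    finally have "\<tau> * (\<Sum>n=n0..m. ip (forcing n) (multiplier n)) \<le> Q * Y + Q' * D" .
    moreover have "\<tau> * (l2seq \<tau> {n0..m} (\<lambda>n. nrm (forcing n)))\<^sup>2 \<le> Z\<^sup>2"
    proof -
      have "l2seq \<tau> {n0..m} (\<lambda>n. nrm (forcing n)) \<le> LR"
        unfolding LR_def using \<tau> m by (intro l2seq_mono) auto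
      then have "\<tau> * (l2seq \<tau> {n0..m} (\<lambda>n. nrm (forcing n)))\<^sup>2 \<le> \<tau> * LR\<^sup>2"
        using \<tau> by (intro mult_left_mono power_mono) auto
      then show ?thesis using \<tau> by (simp add: Z_def power_mult_distrib)
    qed
    ultimately have "CE * (\<tau> * (\<Sum>n=n0..m. ip (forcing n) (multiplier n))
        + \<tau> * (l2seq \<tau> {n0..m} (\<lambda>n. nrm (forcing n)))\<^sup>2) \<le> CE * (Q * Y + Q' * D + Z\<^sup>2)"
      using c by (intro mult_left_mono) auto
    then show ?thesis using energy[OF m] by (simp add: distrib_left mult_ac)
  qed
  have e0: "0 \<le> e n" if "n0 \<le> n" "n \<le> N" for n
    using order_trans[OF _ e[OF that]] c by simp
  have d0: "0 \<le> d n" if "n0 \<le> n" "n \<le> N" for n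
    using order_trans[OF _ d[OF that]] c \<delta> by simp
  have "cE * Y\<^sup>2 \<le> CE * (Q * Y + Q' * D + Z\<^sup>2)"
  proof -
    obtain m where m: "n0 \<le> m" "m \<le> N" "Y = y m" using Y_mem by auto
    have "0 \<le> \<tau> * (\<Sum>n=n0..m. d n)" using \<tau> m d0 by (intro mult_nonneg_nonneg sum_nonneg) auto
    then show ?thesis using main[OF m(1,2)] e[OF m(1,2)] m(3) by (simp add: y_def)
  qed
  moreover have "cE * D\<^sup>2 \<le> CE * (Q * Y + Q' * D + Z\<^sup>2)"
  proof -
    have "cE * D\<^sup>2 = \<tau> * (\<Sum>n=n0..N. cE * \<delta> * (nrm (material l b \<tau> \<phi> n))\<^sup>2)"
      using \<delta> \<tau> by (simp add: D_def power_mult_distrib l2seq_sq sum_distrib_left mult_ac)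
    also have "\<dots> \<le> \<tau> * (\<Sum>n=n0..N. d n)" using \<tau> d by (intro mult_left_mono sum_mono) auto
    finally show ?thesis using main[of N] e0[of N] steps by simp
  qed
  ultimately have "cE * (Y\<^sup>2 + D\<^sup>2) \<le> 2 * CE * (Q * Y + Q' * D + Z\<^sup>2)"
    by (simp add: distrib_left)
  then have "Y\<^sup>2 + D\<^sup>2 \<le> 2 * CE / cE * (Q * Y + Q' * D + Z\<^sup>2)" using c by (simp add: field_simps)
  moreover have "(Y + D)\<^sup>2 \<le> 2 * (Y\<^sup>2 + D\<^sup>2)"
    using zero_le_power2[of "Y - D"] by (simp add: power2_sum power2_diff)
  ultimately have "(Y + D)\<^sup>2 \<le> 4 * CE / cE * (Q * Y + Q' * D + Z\<^sup>2)" by simp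
  also have "\<dots> \<le> 4 * CE / cE * ((Q + Q') * (Y + D) + Z\<^sup>2)"
    using c nn Y0 by (intro mult_left_mono) (auto simp: algebra_simps)
  finally have "Y + D \<le> (1 + 4 * CE / cE) * ((Q + Q') + Z)"
    using c nn Y0 by (intro quadratic_absorption) auto
  then have YD: "Y + D \<le> B" by (simp add: B Q_def Q'_def Z_def LR_def)
  show "nrm (\<phi> n + \<delta> *\<^sub>R G (\<phi> n)) \<le> B" if "n0 \<le> n" "n \<le> N" for n
    using Y_n0[OF that] YD nn by (simp add: y_def)
  show "sqrt \<delta> * l2seq \<tau> {n0..N} (\<lambda>n. nrm (material l b \<tau> \<phi> n)) \<le> B"
    using YD Y0 by (simp add: D_def)
qed

end

section \<open>The error estimate in a semi-inner product space\<close>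

context skew_operator
begin

lemma nrm_tested_eq:
  assumes [simp]: "x \<in> H" "y \<in> H" and eq: "\<And>w. w \<in> H \<Longrightarrow> ip x w = ip y w"
  shows "nrm x = nrm y"
  using eq[of x] eq[of y] by (simp add: nrm_def ip_commute[of y x])

lemma nrm_G_wavg:
  assumes "\<And>j. j \<le> l \<Longrightarrow> \<psi> (n - j) \<in> V"
  shows "nrm (G (wavg l b \<psi> n)) = nrm (wavg l b (\<lambda>n. G (\<psi> n)) n)"
proof (rule nrm_tested_eq)
  show "G (wavg l b \<psi> n) \<in> H" using assms by (intro G_H V_wavg)
  show "wavg l b (\<lambda>n. G (\<psi> n)) n \<in> H" unfolding wavg_def using assms by (intro H_sum H_scale) auto
qed (simp add: assms ip_G_wavg)

text \<open>Up to null vectors, \<open>G\<close>, averaging and differencing commute. The hypothesis \<open>l \<le> n\<close> excludes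
  truncated indices, for which shifting and averaging do not commute.\<close>

lemma nrm_fdiff_G_wavg:
  assumes l: "l \<le> n" and V: "\<And>j. j \<le> n + 1 \<Longrightarrow> \<psi> j \<in> V"
  shows "nrm (fdiff \<tau> (\<lambda>n. G (wavg l b \<psi> n)) n) = nrm (wavg l b (fdiff \<tau> (\<lambda>n. G (\<psi> n))) n)"
proof (rule nrm_tested_eq)
  have V': "\<psi> (n - j) \<in> V" "\<psi> (n + 1 - j) \<in> V" for j using V by auto
  have wV: "wavg l b \<psi> n \<in> V" "wavg l b \<psi> (n + 1) \<in> V" using V' by (auto intro!: V_wavg)
  then show "fdiff \<tau> (\<lambda>n. G (wavg l b \<psi> n)) n \<in> H" unfolding fdiff_def by (intro H_scale H_diff G_H)
  have f: "fdiff \<tau> (\<lambda>n. G (\<psi> n)) (n - j) \<in> H" for j unfolding fdiff_def using V by (intro H_scale H_diff G_H) auto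
  show "wavg l b (fdiff \<tau> (\<lambda>n. G (\<psi> n))) n \<in> H" unfolding wavg_def using f by (intro H_sum H_scale)
  fix w assume [simp]: "w \<in> H"
  have w: "wavg l b (\<lambda>n. G (\<psi> n)) n \<in> H" "wavg l b (\<lambda>n. G (\<psi> n)) (n + 1) \<in> H"
    unfolding wavg_def using V' by (auto intro!: H_sum)
  have "wavg l b (fdiff \<tau> (\<lambda>n. G (\<psi> n))) n
      = inverse \<tau> *\<^sub>R (wavg l b (\<lambda>n. G (\<psi> n)) (n + 1) - wavg l b (\<lambda>n. G (\<psi> n)) n)"
    unfolding wavg_def fdiff_def scaleR_sum_right scaleR_diff_right sum_subtractf[symmetric]
  proof (intro sum.cong refl)
    fix j assume "j \<in> {..l}"
    then have "n - j + 1 = n + 1 - j" using l by simp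
    then show "b j *\<^sub>R (G (\<psi> (n - j + 1)) /\<^sub>R \<tau>) - b j *\<^sub>R (G (\<psi> (n - j)) /\<^sub>R \<tau>)
        = b j *\<^sub>R G (\<psi> (n + 1 - j)) /\<^sub>R \<tau> - b j *\<^sub>R G (\<psi> (n - j)) /\<^sub>R \<tau>"
      by (simp add: mult.commute)
  qed
  then show "ip (fdiff \<tau> (\<lambda>n. G (wavg l b \<psi> n)) n) w = ip (wavg l b (fdiff \<tau> (\<lambda>n. G (\<psi> n))) n) w"
    using w wV V' by (simp add: fdiff_def ip_simps ip_G_wavg)
qed

lemma ip_material_diff:
  assumes "\<And>j. j \<le> n \<Longrightarrow> \<psi> j \<in> V" "\<And>j. j \<le> n \<Longrightarrow> \<omega> j \<in> V" and [simp]: "w \<in> H"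
  shows "ip (material l b \<tau> (\<lambda>n. \<psi> n - \<omega> n) n) w
    = ip (material l b \<tau> \<psi> n) w - ip (material l b \<tau> \<omega> n) w"
proof -
  have [simp]: "\<psi> (n - j) \<in> V" "\<omega> (n - j) \<in> V" "\<psi> n \<in> V" "\<omega> n \<in> V" for j using assms by auto
  have "wavg l b (\<lambda>n. \<psi> n - \<omega> n) n = wavg l b \<psi> n - wavg l b \<omega> n"
    by (simp add: wavg_def scaleR_diff_right sum_subtractf)
  moreover have "bdiff \<tau> (\<lambda>n. \<psi> n - \<omega> n) n = bdiff \<tau> \<psi> n - bdiff \<tau> \<omega> n"
    by (simp add: bdiff_def scaleR_diff_right algebra_simps)
  moreover have [simp]: "wavg l b \<psi> n \<in> V" "wavg l b \<omega> n \<in> V" by (auto intro: V_wavg)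
  moreover have [simp]: "bdiff \<tau> \<psi> n \<in> V" "bdiff \<tau> \<omega> n \<in> V" by (auto simp: bdiff_def)
  ultimately show ?thesis by (simp add: material_def ip_simps ip_G_diff)
qed

end

context semi_inner_space
begin

lemma nrm_le_orthogonal_sum:
  assumes [simp]: "y \<in> H" "z \<in> H" and "ip y z = 0"
  shows "nrm y \<le> nrm (y + z)"
  unfolding nrm_def using assms(3) ip_nonneg[of z]
  by (simp add: ip_simps ip_commute[of z y])

text \<open>A projection onto the discrete space is linear only up to null vectors. It is enough that the
  difference quotient of the projection errors, minus the projection error of the derivative, is the
  component orthogonal to \<open>Vh\<close> of the same expression for \<open>X\<close>, hence not longer.\<close>

lemma path_derivative_projection_error:
  assumes X: "path_derivative T X X'" and Vh: "subspace Vh" "Vh \<subseteq> H"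
    and P: "\<And>u. u \<in> H \<Longrightarrow> P u \<in> Vh" "\<And>u w. u \<in> H \<Longrightarrow> w \<in> Vh \<Longrightarrow> ip (u - P u) w = 0"
  shows "path_derivative T (\<lambda>t. X t - P (X t)) (\<lambda>t. X' t - P (X' t))"
  unfolding path_derivative_def
proof (intro ballI conjI)
  fix t assume t: "t \<in> {0..T}"
  have PH: "P u \<in> H" if "u \<in> H" for u using P(1)[OF that] Vh(2) by auto
  have [simp]: "X t \<in> H" "X' t \<in> H" using path_derivative_mem[OF X] t by auto
  show "X t - P (X t) \<in> H" "X' t - P (X' t) \<in> H" using PH by auto
  have lim: "((\<lambda>s. nrm ((X s - X t) /\<^sub>R (s - t) - X' t)) \<longlongrightarrow> 0) (at t within {0..T})"
    using X t by (auto simp: path_derivative_def)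
  show "((\<lambda>s. nrm (((X s - P (X s)) - (X t - P (X t))) /\<^sub>R (s - t) - (X' t - P (X' t)))) \<longlongrightarrow> 0)
      (at t within {0..T})"
  proof (rule Lim_null_comparison[OF _ lim])
    show "\<forall>\<^sub>F s in at t within {0..T}.
        norm (nrm (((X s - P (X s)) - (X t - P (X t))) /\<^sub>R (s - t) - (X' t - P (X' t))))
        \<le> nrm ((X s - X t) /\<^sub>R (s - t) - X' t)"
      unfolding eventually_at_filter
    proof (rule always_eventually, intro allI impI)
      fix s assume "s \<noteq> t" "s \<in> {0..T}"
      then have [simp]: "X s \<in> H" using path_derivative_mem[OF X] by auto
      define y where "y = ((X s - P (X s)) - (X t - P (X t))) /\<^sub>R (s - t) - (X' t - P (X' t))"
      define z where "z = (P (X s) - P (X t)) /\<^sub>R (s - t) - P (X' t)"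
      have z: "z \<in> Vh" unfolding z_def using P(1) Vh by (intro subspace_diff subspace_scale) auto
      have mem [simp]: "y \<in> H" "z \<in> H" using z Vh(2) by (auto simp: y_def PH)
      have "ip y z = inverse (s - t) * (ip (X s - P (X s)) z - ip (X t - P (X t)) z) - ip (X' t - P (X' t)) z"
        unfolding y_def by (simp add: ip_simps PH)
      also have "\<dots> = 0" by (simp add: P(2) z)
      finally have "ip y z = 0" .
      then have "nrm y \<le> nrm (y + z)" by (rule nrm_le_orthogonal_sum[OF mem])
      also have "y + z = (X s - X t) /\<^sub>R (s - t) - X' t"
        by (simp add: y_def z_def scaleR_diff_right)
      finally show "norm (nrm y) \<le> nrm ((X s - X t) /\<^sub>R (s - t) - X' t)" by simp
    qed
  qed
qed

end

abbreviation embedding_constant :: "real \<Rightarrow> real" where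
  "embedding_constant T \<equiv> sqrt (2 / T) + sqrt (2 * T)"

text \<open>An upper bound for all coefficients that arise when the terms of \<open>stability\<close> are collected.
  \<open>W\<close> stands for the sum of the absolute weights and \<open>k\<close> for four times the ratio of the constants of
  the energy hypothesis.\<close>

definition stability_constant :: "real \<Rightarrow> real \<Rightarrow> real \<Rightarrow> real" where
  "stability_constant W T k = (1 + k) * (4 + 4 * W * (1 + T) + embedding_constant T
     + W * embedding_constant T + 5 * sqrt T + W * sqrt T)"

context scheme_error
begin

abbreviation "embedding \<equiv> embedding_constant T"

text \<open>The path \<open>X 0\<close> is the projection error as a function of time, with derivatives \<open>X 1\<close> and \<open>X 2\<close>.
  In the application \<open>\<alpha>\<close> is of order \<open>h\<close> to the power \<open>r\<close> and \<open>\<beta>\<close> of order \<open>h\<close> to the power \<open>r - 1\<close>. The terms with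
  the factor \<open>sqrt \<tau>\<close> in \<open>E\<close> stem from the square of the forcing in the energy inequality.\<close>

theorem error_estimate:
  fixes e d :: "nat \<Rightarrow> real" and X :: "nat \<Rightarrow> real \<Rightarrow> 'a" and g :: "nat \<Rightarrow> real \<Rightarrow> real"
  assumes c: "0 < cE" "0 < CE" and \<delta>1: "\<delta> \<le> 1" and T: "0 < T"
    and e: "\<And>n. n0 \<le> n \<Longrightarrow> n \<le> N \<Longrightarrow> cE * (nrm (\<phi> n + \<delta> *\<^sub>R G (\<phi> n)))\<^sup>2 \<le> e n"
    and d: "\<And>n. n0 \<le> n \<Longrightarrow> n \<le> N \<Longrightarrow> cE * \<delta> * (nrm (material l b \<tau> \<phi> n))\<^sup>2 \<le> d n"
    and energy: "\<And>m. n0 \<le> m \<Longrightarrow> m \<le> N \<Longrightarrow> e m + \<tau> * (\<Sum>n=n0..m. d n)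
      \<le> CE * \<tau> * (\<Sum>n=n0..m. ip (forcing n) (multiplier n))
        + CE * \<tau> * (l2seq \<tau> {n0..m} (\<lambda>n. nrm (forcing n)))\<^sup>2"
    and \<eta>: "\<eta> = (\<lambda>n. X 0 (real n * \<tau>))"
    and X: "path_derivative T (X 0) (X 1)" "path_derivative T (X 1) (X 2)"
    and XV: "\<And>j t. j \<le> 2 \<Longrightarrow> t \<in> {0..T} \<Longrightarrow> X j t \<in> V"
    and g: "\<And>j. j \<le> 2 \<Longrightarrow> sq_integrable T (g j)"
    and \<alpha>: "0 \<le> \<alpha>" "\<And>j t. j \<le> 2 \<Longrightarrow> t \<in> {0..T} \<Longrightarrow> nrm (X j t) \<le> \<alpha> * g j t"
    and \<beta>: "0 \<le> \<beta>" "\<And>j t. j \<le> 2 \<Longrightarrow> t \<in> {0..T} \<Longrightarrow> nrm (G (X j t)) \<le> \<beta> * g j t"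
    and \<rho>: "l2seq \<tau> {n0..N} (\<lambda>n. nrm (\<rho> n)) \<le> P"
      "\<And>n. n0 \<le> n \<Longrightarrow> n \<le> N \<Longrightarrow> nrm (\<rho> n) \<le> P"
      "l2seq \<tau> {n0..N - 1} (\<lambda>n. nrm (fdiff \<tau> \<rho> n)) \<le> P"
    and E: "E = (sqrt \<delta> * \<beta> + \<alpha> / sqrt \<delta>) * (\<Sum>j\<le>2. l2time T (g j)) + P
      + sqrt \<tau> * (\<alpha> + \<tau> * \<beta>) * l2time T (g 1) + sqrt \<tau> * \<beta> * l2time T (g 0) + sqrt \<tau> * P"
  shows "\<And>n. n0 \<le> n \<Longrightarrow> n \<le> N \<Longrightarrow>
      nrm (\<phi> n + \<delta> *\<^sub>R G (\<phi> n)) \<le> stability_constant weights T (4 * CE / cE) * E"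
    and "sqrt \<delta> * l2seq \<tau> {n0..N} (\<lambda>n. nrm (material l b \<tau> \<phi> n)) \<le> stability_constant weights T (4 * CE / cE) * E"
    and "\<And>n. n \<le> N \<Longrightarrow> nrm (\<eta> n + \<delta> *\<^sub>R G (\<eta> n)) \<le> embedding * E"
proof -
  have \<tau>: "0 < \<tau>" "0 \<le> \<tau>" using steps by auto
  define p where "p j = l2time T (g j)" for j
  define S where "S = p 0 + p 1 + p 2"
  have p0: "0 \<le> p j" for j by (simp add: p_def)
  have S0: "0 \<le> S" and pS: "p 0 + p 1 \<le> S" "p 1 + p 2 \<le> S" "p 1 \<le> S" "p 2 \<le> S"
    using p0[of 0] p0[of 1] p0[of 2] by (auto simp: S_def)
  have W0: "0 \<le> weights" by (intro sum_nonneg) auto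
  have K0: "0 \<le> embedding" using T by simp
  have P0: "0 \<le> P" using order_trans[OF l2seq_nonneg[OF \<tau>(2)] \<rho>(1)] .
  have tn: "real n * \<tau> \<in> {0..T}" if "n \<le> N" for n
  proof -
    have "real n * \<tau> \<le> real N * \<tau>" using that \<tau> by (intro mult_right_mono) auto
    moreover have "0 \<le> real n * \<tau>" using \<tau> by simp
    ultimately show ?thesis unfolding atLeastAtMost_iff using steps(5) by linarith
  qed
  have X0V: "X 0 (real n * \<tau>) \<in> V" if "n \<le> N" for n using tn[OF that] by (intro XV) auto
  have \<tau>T: "\<tau> \<le> T" using tn[of 1] steps by simp
  have \<rho>H: "\<rho> n \<in> H" if "n0 \<le> n" "n \<le> N" for n using \<rho>_mem that by auto
  have c0: "controlled T (X 0) (\<lambda>t. \<alpha> * g 0 t) (\<lambda>t. \<alpha> * g 1 t)"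
    using \<alpha> g by (intro controlled_path[OF X(1)] sq_integrable_scale) auto
  have c1: "controlled T (X 1) (\<lambda>t. \<alpha> * g 1 t) (\<lambda>t. \<alpha> * g 2 t)"
    using \<alpha> g by (intro controlled_path[OF X(2)] sq_integrable_scale) auto
  have cG: "controlled T (\<lambda>t. G (X 0 t)) (\<lambda>t. \<beta> * g 0 t) (\<lambda>t. \<beta> * g 1 t)"
    using \<beta> g XV by (intro controlled_G_path[OF X(1)] sq_integrable_scale) auto

  have avg: "l2seq \<tau> {n0..N} (\<lambda>n. nrm (wavg l b \<psi> n)) \<le> weights * l2seq \<tau> {0..N} (\<lambda>n. nrm (\<psi> n))"
    if \<psi>: "\<And>n. n \<le> N \<Longrightarrow> \<psi> n \<in> H" for \<psi>
  proof -
    have "l2seq \<tau> {n0..N} (\<lambda>n. nrm (wavg l b \<psi> n))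
        \<le> l2seq \<tau> {n0..N} (\<lambda>n. \<Sum>j\<le>l. \<bar>b j\<bar> * nrm (\<psi> (n - j)))"
    proof (rule l2seq_mono[OF \<tau>(2)])
      fix n assume "n \<in> {n0..N}"
      then have m: "\<psi> (n - j) \<in> H" for j using \<psi> by auto
      then show "0 \<le> nrm (wavg l b \<psi> n) \<and> nrm (wavg l b \<psi> n) \<le> (\<Sum>j\<le>l. \<bar>b j\<bar> * nrm (\<psi> (n - j)))"
        by (auto intro!: nrm_wavg_le nrm_nonneg H_sum simp: wavg_def[of l b \<psi> n, symmetric])
          (auto simp: wavg_def)
    qed auto
    also have "\<dots> \<le> weights * l2seq \<tau> {0..N} (\<lambda>n. nrm (\<psi> n))"
      using \<tau> steps \<psi> by (intro l2seq_shifted_average_le) auto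
    finally show ?thesis .
  qed

  have M\<eta>: "l2seq \<tau> {n0..N} (\<lambda>n. nrm (wavg l b \<eta> n)) \<le> 2 * weights * (1 + T) * (\<alpha> * S)"
  proof -
    have "l2seq \<tau> {n0..N} (\<lambda>n. nrm (wavg l b \<eta> n)) \<le> weights * (2 * (\<alpha> * p 0 + \<tau> * (\<alpha> * p 1)))"
      using controlled_samples_le[OF c0 \<tau>(1), of N] steps W0 \<alpha>(1)
      by (intro order_trans[OF avg] mult_left_mono) (auto simp: \<eta> l2time_scale p_def X0V)
    also have "\<dots> = 2 * weights * (\<alpha> * (p 0 + \<tau> * p 1))" by (simp add: algebra_simps)
    also have "\<dots> \<le> 2 * weights * (\<alpha> * ((1 + T) * S))"
    proof -
      have "p 0 + \<tau> * p 1 \<le> S + T * S"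
        using \<tau>T \<tau> pS p0[of 1] p0[of 2] by (intro add_mono mult_mono) (auto simp: S_def)
      then show ?thesis using \<alpha>(1) W0 by (intro mult_left_mono) (auto simp: algebra_simps)
    qed
    finally show ?thesis by (simp add: mult_ac)
  qed

  have GM: "l2seq \<tau> {n0..N} (\<lambda>n. nrm (G (wavg l b \<eta> n))) \<le> 2 * weights * \<beta> * (p 0 + \<tau> * p 1)"
  proof -
    have "l2seq \<tau> {n0..N} (\<lambda>n. nrm (G (wavg l b \<eta> n)))
        = l2seq \<tau> {n0..N} (\<lambda>n. nrm (wavg l b (\<lambda>n. G (\<eta> n)) n))"
      unfolding l2seq_def by (intro arg_cong2[where f = "(*)"] refl L2_set_cong nrm_G_wavg) auto
    also have "\<dots> \<le> weights * (2 * (\<beta> * p 0 + \<tau> * (\<beta> * p 1)))"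
      using controlled_samples_le[OF cG \<tau>(1), of N] steps W0 \<beta>(1)
      by (intro order_trans[OF avg] mult_left_mono) (auto simp: \<eta> l2time_scale p_def X0V)
    finally show ?thesis by (simp add: algebra_simps)
  qed

  have D\<eta>: "l2seq \<tau> {n0..N} (\<lambda>n. nrm (bdiff \<tau> \<eta> n)) \<le> \<alpha> * p 1"
  proof -
    have "l2seq \<tau> {n0..N} (\<lambda>n. nrm (bdiff \<tau> \<eta> n)) = l2seq \<tau> {n0..N} (\<lambda>n. nrm (fdiff \<tau> \<eta> (n - 1)))"
      unfolding l2seq_def using steps
      by (intro arg_cong2[where f = "(*)"] refl L2_set_cong) (auto simp: bdiff_def fdiff_def)
    also have "\<dots> \<le> l2seq \<tau> {..<N} (\<lambda>n. nrm (fdiff \<tau> \<eta> n))"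
      using steps by (intro l2seq_shift_le[where f = "\<lambda>n. nrm (fdiff \<tau> \<eta> n)"]) (auto simp: fdiff_def)
    also have "\<dots> \<le> \<alpha> * p 1"
      using controlled_differences_le[OF c0 \<tau>(1) steps(5)] \<alpha>(1) by (simp add: \<eta> l2time_scale p_def)
    finally show ?thesis .
  qed

  define LR where "LR = l2seq \<tau> {n0..N} (\<lambda>n. nrm (forcing n))"
  have LR: "LR \<le> \<alpha> * p 1 + 2 * weights * \<beta> * (p 0 + \<tau> * p 1) + P"
  proof -
    have "LR \<le> l2seq \<tau> {n0..N} (\<lambda>n. nrm (bdiff \<tau> \<eta> n) + nrm (G (wavg l b \<eta> n)) + nrm (\<rho> n))"
      unfolding LR_def
    proof (rule l2seq_mono[OF \<tau>(2)])
      fix n assume n: "n \<in> {n0..N}"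
      have "nrm (forcing n) \<le> nrm (material l b \<tau> \<eta> n) + nrm (\<rho> n)"
        unfolding forcing_def using n \<rho>H by (intro nrm_diff_triangle) auto
      also have "nrm (material l b \<tau> \<eta> n) \<le> nrm (bdiff \<tau> \<eta> n) + nrm (G (wavg l b \<eta> n))"
        unfolding material_def using n by (intro nrm_triangle) auto
      finally show "0 \<le> nrm (forcing n) \<and>
          nrm (forcing n) \<le> nrm (bdiff \<tau> \<eta> n) + nrm (G (wavg l b \<eta> n)) + nrm (\<rho> n)"
        using n by auto
    qed auto
    also have "\<dots> \<le> l2seq \<tau> {n0..N} (\<lambda>n. nrm (bdiff \<tau> \<eta> n)) + l2seq \<tau> {n0..N} (\<lambda>n. nrm (G (wavg l b \<eta> n)))
        + l2seq \<tau> {n0..N} (\<lambda>n. nrm (\<rho> n))"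
      by (rule order_trans[OF l2seq_triangle[OF \<tau>(2)] add_right_mono[OF l2seq_triangle[OF \<tau>(2)]]])
    finally show ?thesis using D\<eta> GM \<rho>(1) by simp
  qed

  have sup0: "nrm (X 0 t) \<le> embedding * (\<alpha> * S)" if "t \<in> {0..T}" for t
  proof -
    have "nrm (X 0 t) \<le> embedding * (\<alpha> * p 0 + \<alpha> * p 1)"
      using controlled_sup_le[OF c0 T that] \<alpha>(1) by (simp add: l2time_scale p_def)
    also have "\<dots> \<le> embedding * (\<alpha> * S)"
      using K0 \<alpha>(1) pS unfolding distrib_left[symmetric] by (intro mult_left_mono) auto
    finally show ?thesis .
  qed
  have sup1: "nrm (X 1 t) \<le> embedding * (\<alpha> * S)" if "t \<in> {0..T}" for t
  proof -
    have "nrm (X 1 t) \<le> embedding * (\<alpha> * p 1 + \<alpha> * p 2)"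
      using controlled_sup_le[OF c1 T that] \<alpha>(1) by (simp add: l2time_scale p_def)
    also have "\<dots> \<le> embedding * (\<alpha> * S)"
      using K0 \<alpha>(1) pS unfolding distrib_left[symmetric] by (intro mult_left_mono) auto
    finally show ?thesis .
  qed
  have supG: "nrm (G (X 0 t)) \<le> embedding * (\<beta> * S)" if "t \<in> {0..T}" for t
  proof -
    have "nrm (G (X 0 t)) \<le> embedding * (\<beta> * p 0 + \<beta> * p 1)"
      using controlled_sup_le[OF cG T that] \<beta>(1) by (simp add: l2time_scale p_def)
    also have "\<dots> \<le> embedding * (\<beta> * S)"
      using K0 \<beta>(1) pS unfolding distrib_left[symmetric] by (intro mult_left_mono) auto
    finally show ?thesis .
  qed

  define Rs where "Rs = embedding * (\<alpha> * S) + weights * (embedding * (\<beta> * S)) + P"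
  have Rs: "nrm (forcing n) \<le> Rs" if n: "n0 \<le> n" "n \<le> N" for n
  proof -
    have n1: "n - 1 \<le> N" "real n * \<tau> - real (n - 1) * \<tau> = \<tau>" "real (n - 1) * \<tau> \<le> real n * \<tau>"
      using n steps \<tau> by (auto simp: algebra_simps of_nat_diff)
    define w where "w = X 0 (real n * \<tau>) - X 0 (real (n - 1) * \<tau>)"
    have wH: "w \<in> H" unfolding w_def using n n1 X0V by (intro H_diff V_H) auto
    have "nrm (w - (real n * \<tau> - real (n - 1) * \<tau>) *\<^sub>R 0)
        \<le> (real n * \<tau> - real (n - 1) * \<tau>) * (embedding * (\<alpha> * S))"
      unfolding w_def
    proof (rule linearisation_le[OF X(1)])
      fix t assume "t \<in> {real (n - 1) * \<tau>..real n * \<tau>}"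
      then show "nrm (X 1 t - 0) \<le> embedding * (\<alpha> * S)"
        using tn[OF n(2)] tn[OF n1(1)] sup1[of t] by simp
    qed (use tn[OF n(2)] n1 \<tau> K0 \<alpha>(1) S0 in auto)
    then have "nrm w \<le> \<tau> * (embedding * (\<alpha> * S))" unfolding n1(2) by simp
    then have "nrm (bdiff \<tau> \<eta> n) \<le> embedding * (\<alpha> * S)"
    proof -
      have "nrm (bdiff \<tau> \<eta> n) = nrm w / \<tau>"
        using \<tau> nrm_scale[OF wH, of "inverse \<tau>"]
        by (simp add: bdiff_def \<eta> w_def divide_inverse mult.commute)
      then show ?thesis
        using \<tau> \<open>nrm w \<le> \<tau> * (embedding * (\<alpha> * S))\<close> by (simp add: pos_divide_le_eq mult.commute)
    qed
    moreover have "nrm (G (wavg l b \<eta> n)) \<le> weights * (embedding * (\<beta> * S))"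
    proof -
      have "nrm (G (wavg l b \<eta> n)) = nrm (wavg l b (\<lambda>n. G (\<eta> n)) n)"
        using n by (intro nrm_G_wavg) auto
      also have "\<dots> \<le> (\<Sum>j\<le>l. \<bar>b j\<bar> * nrm (G (\<eta> (n - j))))" using n by (intro nrm_wavg_le) auto
      also have "\<dots> \<le> (\<Sum>j\<le>l. \<bar>b j\<bar> * (embedding * (\<beta> * S)))"
      proof (intro sum_mono mult_left_mono)
        fix j show "nrm (G (\<eta> (n - j))) \<le> embedding * (\<beta> * S)"
          unfolding \<eta> using n by (intro supG tn) auto
      qed auto
      finally show ?thesis by (simp add: sum_distrib_right)
    qed
    moreover have "nrm (forcing n) \<le> nrm (material l b \<tau> \<eta> n) + nrm (\<rho> n)"
      unfolding forcing_def using n \<rho>H by (intro nrm_diff_triangle) auto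
    moreover have "nrm (material l b \<tau> \<eta> n) \<le> nrm (bdiff \<tau> \<eta> n) + nrm (G (wavg l b \<eta> n))"
      unfolding material_def using n by (intro nrm_triangle) auto
    ultimately show ?thesis using \<rho>(2)[OF n] by (simp add: Rs_def)
  qed

  define LF where "LF = l2seq \<tau> {n0..N - 1} (\<lambda>n. nrm (fdiff \<tau> forcing n))"
  have LF: "LF \<le> 4 * (\<alpha> * S) + weights * (\<beta> * S) + P"
  proof -
    let ?d2 = "\<lambda>n. nrm (fdiff \<tau> (bdiff \<tau> \<eta>) n)" and ?dG = "\<lambda>n. nrm (fdiff \<tau> (\<lambda>n. G (wavg l b \<eta> n)) n)"
    have "LF \<le> l2seq \<tau> {n0..N - 1} (\<lambda>n. ?d2 n + ?dG n + nrm (fdiff \<tau> \<rho> n))"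
      unfolding LF_def
    proof (rule l2seq_mono[OF \<tau>(2)])
      fix n assume "n \<in> {n0..N - 1}"
      then have n: "n0 \<le> n" "n \<le> N" "n + 1 \<le> N" using steps by auto
      let ?x = "fdiff \<tau> (bdiff \<tau> \<eta>) n" and ?y = "fdiff \<tau> (\<lambda>n. G (wavg l b \<eta> n)) n" and ?z = "fdiff \<tau> \<rho> n"
      have [simp]: "?x \<in> H" "?y \<in> H" "?z \<in> H" using n \<rho>H by (auto simp: fdiff_def)
      have eq: "fdiff \<tau> forcing n = (?x + ?y) - ?z"
        by (simp add: fdiff_def forcing_def material_def scaleR_diff_right scaleR_add_right)
      have "nrm ((?x + ?y) - ?z) \<le> nrm (?x + ?y) + nrm ?z" by (intro nrm_diff_triangle) auto
      also have "nrm (?x + ?y) \<le> nrm ?x + nrm ?y" by (intro nrm_triangle) auto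
      finally show "0 \<le> nrm (fdiff \<tau> forcing n) \<and> nrm (fdiff \<tau> forcing n) \<le> ?d2 n + ?dG n + nrm (fdiff \<tau> \<rho> n)"
        unfolding eq by simp
    qed auto
    also have "\<dots> \<le> l2seq \<tau> {n0..N - 1} ?d2 + l2seq \<tau> {n0..N - 1} ?dG + l2seq \<tau> {n0..N - 1} (\<lambda>n. nrm (fdiff \<tau> \<rho> n))"
      by (rule order_trans[OF l2seq_triangle[OF \<tau>(2)] add_right_mono[OF l2seq_triangle[OF \<tau>(2)]]])
    also have "l2seq \<tau> {n0..N - 1} ?d2 \<le> 4 * (\<alpha> * S)"
    proof -
      have "l2seq \<tau> {n0..N - 1} ?d2 \<le> 4 * (\<alpha> * p 2)"
        using second_differences_le[OF X(1) c1 \<tau>(1) steps(5,2)] \<alpha>(1) by (simp add: \<eta> l2time_scale p_def)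
      also have "\<dots> \<le> 4 * (\<alpha> * S)" using \<alpha>(1) pS by (intro mult_left_mono) auto
      finally show ?thesis .
    qed
    also have "l2seq \<tau> {n0..N - 1} ?dG \<le> weights * (\<beta> * S)"
    proof -
      have "l2seq \<tau> {n0..N - 1} ?dG \<le> l2seq \<tau> {n0..N - 1} (\<lambda>n. \<Sum>j\<le>l. \<bar>b j\<bar> * nrm (fdiff \<tau> (\<lambda>n. G (\<eta> n)) (n - j)))"
      proof (rule l2seq_mono[OF \<tau>(2)])
        fix n assume "n \<in> {n0..N - 1}"
        then have n: "l \<le> n" "n + 1 \<le> N" using steps by auto
        have "?dG n = nrm (wavg l b (fdiff \<tau> (\<lambda>n. G (\<eta> n))) n)"
          using n by (intro nrm_fdiff_G_wavg) auto
        also have "\<dots> \<le> (\<Sum>j\<le>l. \<bar>b j\<bar> * nrm (fdiff \<tau> (\<lambda>n. G (\<eta> n)) (n - j)))"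
          using n by (intro nrm_wavg_le) (auto simp: fdiff_def)
        finally show "0 \<le> ?dG n \<and> ?dG n \<le> (\<Sum>j\<le>l. \<bar>b j\<bar> * nrm (fdiff \<tau> (\<lambda>n. G (\<eta> n)) (n - j)))"
          using n by (auto simp: fdiff_def)
      qed auto
      also have "\<dots> \<le> weights * l2seq \<tau> {..<N} (\<lambda>n. nrm (fdiff \<tau> (\<lambda>n. G (\<eta> n)) n))"
        using \<tau> steps by (intro l2seq_shifted_average_le) (auto simp: fdiff_def)
      also have "\<dots> \<le> weights * (\<beta> * p 1)"
        using controlled_differences_le[OF cG \<tau>(1) steps(5)] \<beta>(1) W0
        by (intro mult_left_mono) (auto simp: \<eta> l2time_scale p_def)
      also have "\<dots> \<le> weights * (\<beta> * S)" using \<beta>(1) W0 pS by (intro mult_left_mono) auto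
      finally show ?thesis .
    qed
    finally show ?thesis using \<rho>(3) by simp
  qed

  \<comment> \<open>The right-hand side \<open>E\<close> is the sum of these five terms and \<open>P\<close>; every part of the stability
    estimate is a combination of them.\<close>
  define a where "a = \<alpha> / sqrt \<delta> * S"
  define c where "c = sqrt \<delta> * \<beta> * S"
  define u where "u = sqrt \<tau> * (\<alpha> + \<tau> * \<beta>) * p 1"
  define v where "v = sqrt \<tau> * \<beta> * p 0"
  define z where "z = sqrt \<tau> * P"
  have sd: "0 < sqrt \<delta>" "sqrt \<delta> \<le> 1" "sqrt \<delta> * sqrt \<delta> = \<delta>" using \<delta> \<delta>1 by auto
  have nn: "0 \<le> a" "0 \<le> c" "0 \<le> u" "0 \<le> v" "0 \<le> z"
    using \<alpha>(1) \<beta>(1) \<tau> \<delta> S0 P0 p0 by (auto simp: a_def c_def u_def v_def z_def)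
  have EE: "E = c + a + P + u + v + z"
  proof -
    have "(\<Sum>j\<le>2. l2time T (g j)) = S" by (simp add: S_def p_def numeral_2_eq_2)
    then show ?thesis by (simp add: E a_def c_def u_def v_def z_def p_def distrib_right)
  qed
  have \<alpha>a: "\<alpha> * S = sqrt \<delta> * a" using sd by (simp add: a_def)
  have \<alpha>a1: "\<alpha> * S \<le> a" unfolding \<alpha>a using sd nn by (intro mult_left_le_one_le) auto
  have \<delta>\<beta>: "\<delta> * (\<beta> * S) \<le> c"
  proof -
    have "\<delta> * (\<beta> * S) = sqrt \<delta> * c" using \<delta> by (simp add: c_def mult.assoc[symmetric])
    also have "\<dots> \<le> c" using sd nn by (intro mult_left_le_one_le) auto
    finally show ?thesis .
  qed
  have \<delta>\<alpha>: "\<delta> * (\<alpha> * S) \<le> a"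
    using \<alpha>a1 \<delta> \<delta>1 \<alpha>(1) S0 mult_left_le_one_le[of "\<alpha> * S" \<delta>] by simp
  have \<delta>P: "\<delta> * P \<le> P" using \<delta> \<delta>1 P0 by (intro mult_left_le_one_le) auto
  have t1: "\<delta> * Rs \<le> embedding * a + weights * embedding * c + P"
  proof -
    have "\<delta> * Rs = embedding * (\<delta> * (\<alpha> * S)) + weights * embedding * (\<delta> * (\<beta> * S)) + \<delta> * P"
      by (simp add: Rs_def algebra_simps)
    also have "\<dots> \<le> embedding * a + weights * embedding * c + P"
      using \<delta>\<alpha> \<delta>\<beta> \<delta>P K0 W0 by (intro add_mono mult_left_mono mult_nonneg_nonneg) auto
    finally show ?thesis .
  qed
  have t2: "\<delta> * (sqrt T * LF) \<le> sqrt T * (4 * a + weights * c + P)"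
  proof -
    have "\<delta> * LF \<le> \<delta> * (4 * (\<alpha> * S) + weights * (\<beta> * S) + P)" using LF \<delta> by (intro mult_left_mono) auto
    also have "\<dots> = 4 * (\<delta> * (\<alpha> * S)) + weights * (\<delta> * (\<beta> * S)) + \<delta> * P" by (simp add: algebra_simps)
    also have "\<dots> \<le> 4 * a + weights * c + P"
      using \<delta>\<alpha> \<delta>\<beta> \<delta>P W0 by (intro add_mono mult_left_mono) auto
    finally have "sqrt T * (\<delta> * LF) \<le> sqrt T * (4 * a + weights * c + P)"
      using T by (intro mult_left_mono) auto
    then show ?thesis by (simp add: mult_ac)
  qed
  have t3: "l2seq \<tau> {n0..N} (\<lambda>n. nrm (wavg l b \<eta> n)) / sqrt \<delta> \<le> 2 * weights * (1 + T) * a"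
    using M\<eta>[unfolded \<alpha>a] sd by (simp add: pos_divide_le_eq mult_ac)
  have t4: "sqrt \<delta> * LR \<le> a + 2 * weights * (1 + T) * c + P"
  proof -
    have "sqrt \<delta> * LR \<le> sqrt \<delta> * (\<alpha> * p 1 + 2 * weights * \<beta> * (p 0 + \<tau> * p 1) + P)"
      using LR sd by (intro mult_left_mono) auto
    also have "\<dots> = sqrt \<delta> * (\<alpha> * p 1) + 2 * weights * (sqrt \<delta> * \<beta> * (p 0 + \<tau> * p 1)) + sqrt \<delta> * P"
      by (simp add: algebra_simps)
    also have "\<dots> \<le> a + 2 * weights * ((1 + T) * c) + P"
    proof (intro add_mono)
      have "sqrt \<delta> * (\<alpha> * p 1) \<le> \<alpha> * p 1" using sd \<alpha>(1) p0 by (intro mult_left_le_one_le) auto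
      also have "\<dots> \<le> \<alpha> * S" using \<alpha>(1) pS by (intro mult_left_mono) auto
      finally show "sqrt \<delta> * (\<alpha> * p 1) \<le> a" using \<alpha>a1 by simp
      have "p 0 + \<tau> * p 1 \<le> S + T * S"
        using \<tau>T \<tau> pS p0[of 1] p0[of 2] by (intro add_mono mult_mono) (auto simp: S_def)
      then have "sqrt \<delta> * \<beta> * (p 0 + \<tau> * p 1) \<le> sqrt \<delta> * \<beta> * (S + T * S)"
        using sd \<beta>(1) by (intro mult_left_mono) auto
      also have "\<dots> = (1 + T) * c" by (simp add: c_def algebra_simps)
      finally show "2 * weights * (sqrt \<delta> * \<beta> * (p 0 + \<tau> * p 1)) \<le> 2 * weights * ((1 + T) * c)"
        using W0 by (intro mult_left_mono) auto
      show "sqrt \<delta> * P \<le> P" using sd P0 by (intro mult_left_le_one_le) auto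
    qed
    finally show ?thesis by (simp add: mult_ac)
  qed
  have t5: "sqrt \<tau> * LR \<le> (1 + 2 * weights) * u + 2 * weights * v + z"
  proof -
    have "sqrt \<tau> * LR \<le> sqrt \<tau> * (\<alpha> * p 1 + 2 * weights * \<beta> * (p 0 + \<tau> * p 1) + P)"
      using LR \<tau> by (intro mult_left_mono) auto
    also have "\<dots> = sqrt \<tau> * \<alpha> * p 1 + 2 * weights * (sqrt \<tau> * (\<tau> * \<beta>) * p 1) + 2 * weights * v + z"
      by (simp add: v_def z_def algebra_simps)
    also have "\<dots> \<le> u + 2 * weights * u + 2 * weights * v + z"
    proof (intro add_mono order_refl)
      show "sqrt \<tau> * \<alpha> * p 1 \<le> u"
        unfolding u_def using \<tau> \<beta>(1) p0 by (intro mult_right_mono mult_left_mono) auto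
      have "sqrt \<tau> * (\<tau> * \<beta>) * p 1 \<le> u"
        unfolding u_def using \<tau> \<alpha>(1) p0 by (intro mult_right_mono mult_left_mono) auto
      then show "2 * weights * (sqrt \<tau> * (\<tau> * \<beta>) * p 1) \<le> 2 * weights * u"
        using W0 by (intro mult_left_mono) auto
    qed
    finally show ?thesis by (simp add: algebra_simps)
  qed
  have t6: "weights * sqrt T * l2seq \<tau> {n0..N} (\<lambda>n. nrm (\<rho> n)) \<le> weights * sqrt T * P"
    using \<rho>(1) W0 T by (intro mult_left_mono) auto

  define C where "C = 4 + 4 * weights * (1 + T) + embedding + weights * embedding
     + 5 * sqrt T + weights * sqrt T"
  have k0: "0 \<le> 4 * CE / cE" using assms(1,2) by simp
  define B where "B = (1 + 4 * CE / cE) * (weights * sqrt T * l2seq \<tau> {n0..N} (\<lambda>n. nrm (\<rho> n))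
        + \<delta> * (Rs + sqrt T * LF)
        + (l2seq \<tau> {n0..N} (\<lambda>n. nrm (wavg l b \<eta> n)) / sqrt \<delta> + sqrt \<delta> * LR) + sqrt \<tau> * LR)"
  have "B \<le> stability_constant weights T (4 * CE / cE) * E"
  proof -
    have WT: "0 \<le> weights * T" "0 \<le> weights * embedding" "0 \<le> weights * sqrt T" "0 \<le> sqrt T"
      using W0 K0 T by (auto intro!: mult_nonneg_nonneg)
    have C_ge: "embedding + 4 * sqrt T + 2 * weights * (1 + T) + 1 \<le> C"
      "weights * embedding + weights * sqrt T + 2 * weights * (1 + T) \<le> C"
      "weights * sqrt T + 1 + sqrt T + 1 \<le> C" "1 + 2 * weights \<le> C" "2 * weights \<le> C" "1 \<le> C"
      using WT W0 K0 unfolding C_def distrib_left by linarith+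
    have "weights * sqrt T * l2seq \<tau> {n0..N} (\<lambda>n. nrm (\<rho> n)) + \<delta> * (Rs + sqrt T * LF)
        + (l2seq \<tau> {n0..N} (\<lambda>n. nrm (wavg l b \<eta> n)) / sqrt \<delta> + sqrt \<delta> * LR) + sqrt \<tau> * LR
      \<le> weights * sqrt T * P + (embedding * a + weights * embedding * c + P)
        + sqrt T * (4 * a + weights * c + P) + 2 * weights * (1 + T) * a
        + (a + 2 * weights * (1 + T) * c + P) + ((1 + 2 * weights) * u + 2 * weights * v + z)"
      using t1 t2 t3 t4 t5 t6 unfolding distrib_left[of \<delta>] by linarith
    also have "\<dots> = (embedding + 4 * sqrt T + 2 * weights * (1 + T) + 1) * a
        + (weights * embedding + weights * sqrt T + 2 * weights * (1 + T)) * c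
        + (weights * sqrt T + 1 + sqrt T + 1) * P + (1 + 2 * weights) * u + (2 * weights) * v + 1 * z"
      by (simp only: distrib_left distrib_right mult_1_left mult_1_right add_ac mult_ac)
    also have "\<dots> \<le> C * a + C * c + C * P + C * u + C * v + C * z"
      using nn P0 by (intro add_mono mult_right_mono C_ge) auto
    also have "\<dots> = C * E" by (simp add: EE algebra_simps)
    finally have "B \<le> (1 + 4 * CE / cE) * (C * E)"
      unfolding B_def using k0 by (intro mult_left_mono) auto
    also have "\<dots> = stability_constant weights T (4 * CE / cE) * E"
      by (simp add: stability_constant_def C_def)
    finally show ?thesis .
  qed
  note B_le = this
  note stab = stability[OF assms(1,2) _ _ _ _ B_def[unfolded LR_def LF_def], where e = e and d = d]
  show "nrm (\<phi> n + \<delta> *\<^sub>R G (\<phi> n)) \<le> stability_constant weights T (4 * CE / cE) * E"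
    if "n0 \<le> n" "n \<le> N" for n
    by (rule order_trans[OF stab(1) B_le]) ((erule (1) e d energy Rs)+, fact+)
  show "sqrt \<delta> * l2seq \<tau> {n0..N} (\<lambda>n. nrm (material l b \<tau> \<phi> n))
      \<le> stability_constant weights T (4 * CE / cE) * E"
    by (rule order_trans[OF stab(2) B_le]) (erule (1) e d energy Rs)+
  show "nrm (\<eta> n + \<delta> *\<^sub>R G (\<eta> n)) \<le> embedding * E" if n: "n \<le> N" for n
  proof -
    have "nrm (\<eta> n + \<delta> *\<^sub>R G (\<eta> n)) \<le> nrm (\<eta> n) + nrm (\<delta> *\<^sub>R G (\<eta> n))"
      using n by (intro nrm_triangle) auto
    also have "\<dots> \<le> embedding * (\<alpha> * S) + \<delta> * (embedding * (\<beta> * S))"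
      using n \<delta> sup0[OF tn[OF n]] supG[OF tn[OF n]]
      by (intro add_mono) (auto simp: \<eta> nrm_scale X0V)
    also have "\<dots> = embedding * (\<alpha> * S + \<delta> * (\<beta> * S))" by (simp add: algebra_simps)
    also have "\<dots> \<le> embedding * E"
      using \<alpha>a1 \<delta>\<beta> nn P0 K0 by (intro mult_left_mono) (auto simp: EE)
    finally show ?thesis .
  qed
qed

end

section \<open>Square-integrable fields\<close>

lemma L2_measurable: "u \<in> L2 \<Omega> \<Longrightarrow> u \<in> borel_measurable (lebesgue_on \<Omega>)"
  and L2_integrable: "u \<in> L2 \<Omega> \<Longrightarrow> integrable (lebesgue_on \<Omega>) (\<lambda>x. (norm (u x))\<^sup>2)"
  by (auto simp: L2_def)

lemma integrable_inner_L2: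
  assumes u: "u \<in> L2 \<Omega>" and v: "v \<in> L2 \<Omega>"
  shows "integrable (lebesgue_on \<Omega>) (\<lambda>x. u x \<bullet> v x)"
proof (rule Bochner_Integration.integrable_bound)
  show "integrable (lebesgue_on \<Omega>) (\<lambda>x. (norm (u x))\<^sup>2 + (norm (v x))\<^sup>2)"
    using assms by (intro Bochner_Integration.integrable_add L2_integrable)
  show "(\<lambda>x. u x \<bullet> v x) \<in> borel_measurable (lebesgue_on \<Omega>)"
    using assms by (intro borel_measurable_inner L2_measurable)
  have "\<bar>u x \<bullet> v x\<bar> \<le> (norm (u x))\<^sup>2 + (norm (v x))\<^sup>2" for x
  proof -
    have "\<bar>u x \<bullet> v x\<bar> \<le> norm (u x) * norm (v x)" by (rule Cauchy_Schwarz_ineq2)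
    also have "\<dots> \<le> (norm (u x))\<^sup>2 + (norm (v x))\<^sup>2"
      using sum_squares_bound[of "norm (u x)" "norm (v x)"]
        mult_nonneg_nonneg[OF norm_ge_zero norm_ge_zero, of "u x" "v x"] by linarith
    finally show ?thesis .
  qed
  then show "AE x in lebesgue_on \<Omega>. norm (u x \<bullet> v x) \<le> norm ((norm (u x))\<^sup>2 + (norm (v x))\<^sup>2)"
    by (intro AE_I2) simp
qed

lemma subspace_L2:
  fixes \<Omega> :: "(real^'d::finite) set"
  shows "subspace (L2 \<Omega> :: ('d, 'm::finite) field set)"
  unfolding subspace_def
proof (intro conjI ballI allI)
  show "0 \<in> L2 \<Omega>" by (simp add: L2_def zero_fun_def)
  fix u :: "('d, 'm) field" and c :: real assume u: "u \<in> L2 \<Omega>"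
  show "c *\<^sub>R u \<in> L2 \<Omega>"
    using L2_integrable[OF u] L2_measurable[OF u]
    by (auto simp: L2_def scaleR_fun_def power_mult_distrib)
  fix v :: "('d, 'm) field" assume v: "v \<in> L2 \<Omega>"
  have "(\<lambda>x. (norm (u x + v x))\<^sup>2) = (\<lambda>x. (norm (u x))\<^sup>2 + 2 * (u x \<bullet> v x) + (norm (v x))\<^sup>2)"
    by (simp add: power2_norm_eq_inner inner_add_left inner_add_right inner_commute fun_eq_iff)
  then show "u + v \<in> L2 \<Omega>"
    using L2_integrable[OF u] L2_integrable[OF v] integrable_inner_L2[OF u v]
      L2_measurable[OF u] L2_measurable[OF v]
    by (auto simp: L2_def plus_fun_def)
qed

lemma semi_inner_space_L2: "semi_inner_space (L2 \<Omega>) (ip \<Omega>)"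
proof
  show "subspace (L2 \<Omega>)" by (rule subspace_L2)
  show "ip \<Omega> u v = ip \<Omega> v u" for u v by (simp add: ip_def inner_commute)
qed (simp_all add: ip_def integrable_inner_L2 inner_add_left)

lemma nrm_L2: "semi_inner_space.nrm (ip \<Omega>) = l2norm \<Omega>"
  by (simp add: fun_eq_iff l2norm_def semi_inner_space.nrm_def[OF semi_inner_space_L2])

lemma ip_cong_AE:
  assumes "u \<in> L2 \<Omega>" "v \<in> L2 \<Omega>" "w \<in> L2 \<Omega>" "eq_ae \<Omega> u v"
  shows "ip \<Omega> u w = ip \<Omega> v w"
  unfolding ip_def
proof (rule integral_cong_AE)
  show "AE x in lebesgue_on \<Omega>. u x \<bullet> w x = v x \<bullet> w x"
    using assms(4) unfolding eq_ae_def by eventually_elim simp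
qed (use assms in \<open>auto intro!: borel_measurable_inner L2_measurable\<close>)

lemma l2norm_cong_AE:
  assumes "u \<in> L2 \<Omega>" "v \<in> L2 \<Omega>" "eq_ae \<Omega> u v"
  shows "l2norm \<Omega> u = l2norm \<Omega> v"
proof -
  interpret semi_inner_space "L2 \<Omega>" "ip \<Omega>" by (rule semi_inner_space_L2)
  have "ip \<Omega> u u = ip \<Omega> v u" by (rule ip_cong_AE) fact+
  also have "\<dots> = ip \<Omega> u v" using assms by (intro ip_commute)
  also have "\<dots> = ip \<Omega> v v" by (rule ip_cong_AE) fact+
  finally show ?thesis by (simp add: l2norm_def)
qed

lemma subspace_lin_subspace:
  fixes S :: "('d::finite, 'm::finite) field set"
  shows "lin_subspace S \<Longrightarrow> subspace S"
  unfolding subspace_def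
proof (intro conjI ballI allI)
  assume S: "lin_subspace S"
  show "0 \<in> S" using S by (simp add: lin_subspace_def zero_fun_def)
  fix u :: "('d, 'm) field" and c :: real assume u: "u \<in> S"
  have "(\<lambda>x. c *\<^sub>R u x + 0 *\<^sub>R u x) \<in> S" using S u unfolding lin_subspace_def by blast
  then show "c *\<^sub>R u \<in> S" by (simp add: scaleR_fun_def)
  fix v :: "('d, 'm) field" assume v: "v \<in> S"
  have "(\<lambda>x. 1 *\<^sub>R u x + 1 *\<^sub>R v x) \<in> S" using S u v unfolding lin_subspace_def by blast
  then show "u + v \<in> S" by (simp add: plus_fun_def)
qed

lemma skew_operator_L2:
  fixes \<V> :: "('d::finite, 'm::finite) field set"
  assumes V: "lin_subspace \<V>" "\<V> \<subseteq> L2 \<Omega>" "l2_dense \<Omega> \<V>"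
    and G: "first_order_operator \<Omega> \<V> G" "skew_symmetric \<Omega> \<V> G"
  shows "skew_operator (L2 \<Omega>) (ip \<Omega>) \<V> G"
proof -
  interpret semi_inner_space "L2 \<Omega> :: ('d, 'm) field set" "ip \<Omega>" by (rule semi_inner_space_L2)
  have GL2: "G u \<in> L2 \<Omega>" if "u \<in> \<V>" for u using G(1) that by (auto simp: first_order_operator_def)
  have V': "subspace \<V>" by (rule subspace_lin_subspace[OF V(1)])
  show ?thesis
  proof
    fix u :: "('d, 'm) field" and \<epsilon> :: real assume "u \<in> L2 \<Omega>" "0 < \<epsilon>"
    then show "\<exists>v\<in>\<V>. semi_inner_space.nrm (ip \<Omega>) (u - v) < \<epsilon>"
      using V(3) unfolding l2_dense_def nrm_L2 by (simp add: fun_diff_def)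
  next
    fix u v w :: "('d, 'm) field" and \<alpha> \<beta> assume uv: "u \<in> \<V>" "v \<in> \<V>" and w: "w \<in> L2 \<Omega>"
    have m: "\<alpha> *\<^sub>R u + \<beta> *\<^sub>R v \<in> \<V>" using V' uv by (intro subspace_add subspace_scale)
    have f: "(\<lambda>x. \<alpha> *\<^sub>R u x + \<beta> *\<^sub>R v x) = \<alpha> *\<^sub>R u + \<beta> *\<^sub>R v" for u v :: "('d, 'm) field"
      by (simp add: fun_eq_iff)
    have "eq_ae \<Omega> (G (\<lambda>x. \<alpha> *\<^sub>R u x + \<beta> *\<^sub>R v x)) (\<lambda>x. \<alpha> *\<^sub>R G u x + \<beta> *\<^sub>R G v x)"
      using G(1) uv unfolding first_order_operator_def by blast
    then have "ip \<Omega> (G (\<alpha> *\<^sub>R u + \<beta> *\<^sub>R v)) w = ip \<Omega> (\<alpha> *\<^sub>R G u + \<beta> *\<^sub>R G v) w"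
      unfolding f using uv w m by (intro ip_cong_AE) (auto simp: GL2)
    then show "ip \<Omega> (G (\<alpha> *\<^sub>R u + \<beta> *\<^sub>R v)) w = \<alpha> * ip \<Omega> (G u) w + \<beta> * ip \<Omega> (G v) w"
      using uv w GL2 by (simp add: ip_simps)
  qed (use V V' G GL2 in \<open>auto simp: skew_symmetric_def\<close>)
qed

section \<open>Bochner norms in time and the mesh size\<close>

lemma sq_integrable_L2H:
  assumes "V \<in> L2H \<Omega> r T"
  shows "sq_integrable T (\<lambda>t. sobolev_norm \<Omega> r (V t))"
    and "l2time T (\<lambda>t. sobolev_norm \<Omega> r (V t)) = L2H_norm \<Omega> r T V"
proof -
  let ?g = "\<lambda>t. sobolev_norm \<Omega> r (V t)"
  have meas: "?g \<in> borel_measurable (lebesgue_on {0<..<T})"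
    and sq: "integrable (lebesgue_on {0<..<T}) (\<lambda>t. (?g t)\<^sup>2)"
    using assms by (auto simp: L2H_def)
  have g0: "0 \<le> ?g t" for t by (simp add: sobolev_norm_def)
  have "integrable (lebesgue_on {0<..<T}) ?g"
  proof (rule Bochner_Integration.integrable_bound[OF _ meas])
    show "integrable (lebesgue_on {0<..<T}) (\<lambda>t. 1 + (?g t)\<^sup>2)"
      using sq by (intro Bochner_Integration.integrable_add finite_measure.integrable_const
          finite_measure_lebesgue_on) auto
    have "?g t \<le> 1 + (?g t)\<^sup>2" for t
      using zero_le_power2[of "?g t - 1"] g0[of t] by (simp add: power2_diff)
    then show "AE t in lebesgue_on {0<..<T}. norm (?g t) \<le> norm (1 + (?g t)\<^sup>2)"
      using g0 by (intro AE_I2) simp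
  qed
  then show "sq_integrable T ?g"
    using sq g0 integrable_on_lebesgue_on[of "{0<..<T}" ?g] integrable_on_lebesgue_on[of "{0<..<T}" "\<lambda>t. (?g t)\<^sup>2"]
    by (simp add: sq_integrable_def integrable_on_Icc_iff_Ioo)
  show "l2time T ?g = L2H_norm \<Omega> r T V"
    using sq by (simp add: l2time_def L2H_norm_def lebesgue_integral_eq_integral integral_open_interval_real)
qed

lemma LinfH_norm_nonneg:
  assumes "0 < T"
  shows "0 \<le> LinfH_norm \<Omega> r T V"
proof -
  let ?M = "lebesgue_on {0<..<T}" and ?f = "\<lambda>t. ereal (sobolev_norm \<Omega> r (V t))"
  have "\<not> (AE t in ?M. False)"
    using assms by (simp add: trivial_limit_def[symmetric] ae_filter_eq_bot_iff emeasure_restrict_space)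
  moreover have "AE t in ?M. False" if "\<not> 0 \<le> esssup ?M ?f"
    using esssup_AE[where M = ?M and f = ?f]
  proof eventually_elim
    case (elim t)
    have "0 \<le> ?f t" by (simp add: sobolev_norm_def)
    then have "0 \<le> esssup ?M ?f" using elim by (rule order_trans)
    then show ?case using that by simp
  qed
  ultimately have "0 \<le> esssup ?M ?f" by blast
  then show ?thesis unfolding LinfH_norm_def by (rule real_of_ereal_pos)
qed

lemma mesh_size_pos:
  assumes "shape_regular_mesh \<Omega> \<kappa> \<T>" "\<Omega> \<noteq> {}"
  shows "0 < mesh_size \<T>"
proof -
  have fin: "finite \<T>" and U: "\<Union>\<T> = closure \<Omega>" using assms(1) by (auto simp: shape_regular_mesh_def)
  have "closure \<Omega> \<noteq> {}" using assms(2) closure_subset[of \<Omega>] by auto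
  then have "\<T> \<noteq> {}" unfolding U[symmetric] by auto
  then obtain K where K: "K \<in> \<T>" by auto
  then have "compact K" "interior K \<noteq> {}" using assms(1) by (auto simp: shape_regular_mesh_def)
  then obtain x where "x \<in> interior K" by auto
  then obtain e where e: "0 < e" "ball x e \<subseteq> K" by (auto simp: mem_interior)
  define y where "y = x + (e / 2) *\<^sub>R axis undefined 1"
  have "dist x y = e / 2" using e by (simp add: y_def dist_norm norm_axis_1)
  moreover have "x \<in> K" "y \<in> K" using e \<open>dist x y = e / 2\<close> by auto
  ultimately have "e / 2 \<le> diameter K"
    using diameter_bounded_bound[OF compact_imp_bounded[OF \<open>compact K\<close>], of x y] by simp
  also have "\<dots> \<le> mesh_size \<T>" unfolding mesh_size_def using fin K by (intro Max_ge) auto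
  finally show ?thesis using e by simp
qed

section \<open>The error of the finite element scheme\<close>

lemma Top_eq: "Top G \<delta> u = u + \<delta> *\<^sub>R G u"
  by (simp add: Top_def fun_eq_iff)

lemma Dminus_eq: "Dminus \<tau> V = bdiff \<tau> V"
  by (simp add: Dminus_def bdiff_def fun_eq_iff)

lemma Dplus_eq: "Dplus \<tau> V = fdiff \<tau> V"
  by (simp add: Dplus_def fdiff_def fun_eq_iff)

lemma Mavg_eq: "Mavg l b V = wavg l b V"
  by (simp add: Mavg_def wavg_def fun_eq_iff sum_fun_apply)

lemma Aop_eq: "Aop G l b \<tau> V n = bdiff \<tau> V n + G (wavg l b V n)"
  by (simp add: Aop_def Dminus_eq Mavg_eq fun_eq_iff)

lemma Pop_eq: "Pop G l b \<tau> \<delta> V n =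
    (let S = wavg l b V n + \<delta> *\<^sub>R bdiff \<tau> V n in S + \<delta> *\<^sub>R G S)"
proof -
  have "Sop l b \<tau> \<delta> V n = wavg l b V n + \<delta> *\<^sub>R bdiff \<tau> V n"
    by (simp add: Sop_def Dminus_eq Mavg_eq fun_eq_iff)
  then show ?thesis by (simp add: Pop_def Top_eq Let_def)
qed

lemma lt2norm_eq: "lt2norm \<Omega> \<tau> a c R = l2seq \<tau> {a..c} (\<lambda>n. l2norm \<Omega> (R n))"
  by (simp add: lt2norm_def l2seq_def L2_set_def real_sqrt_mult)

lemma stability_constant_pos:
  assumes "0 \<le> W" "0 < T" "0 \<le> k"
  shows "0 < stability_constant W T k"
proof -
  have "0 \<le> W * T" "0 \<le> W * sqrt (2 / T)" "0 \<le> W * sqrt (2 * T)" "0 \<le> W * sqrt T"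
    "0 \<le> sqrt (2 / T)" "0 \<le> sqrt (2 * T)" "0 \<le> sqrt T"
    using assms by auto
  then have "0 < 4 + 4 * W * (1 + T) + embedding_constant T + W * embedding_constant T + 5 * sqrt T + W * sqrt T"
    using assms(1) unfolding distrib_left by linarith
  then show ?thesis using assms(3) unfolding stability_constant_def by (intro mult_pos_pos) auto
qed

text \<open>The abstract estimate uses \<open>\<delta> \<le> 1\<close> and the embedding in time to express all uniform norms by
  \<open>L\<^sup>2\<close> norms in time; what it produces is dominated term by term by the asserted right-hand side.\<close>

lemma abstract_bound_le_error_bound:
  assumes pos: "0 < T" "0 < \<delta>" "0 < \<tau>" "0 < h" and c: "0 \<le> cA" "0 \<le> cR" and Cs: "0 \<le> Cs"
    and E: "E = (sqrt \<delta> * (cA * h powr (r - 1)) + cA * h powr r / sqrt \<delta>) * (\<Sum>j\<le>2. L2H_norm \<Omega> r T (dU j))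
      + cR * \<tau> ^ \<nu> * Cs
      + sqrt \<tau> * (cA * h powr r + \<tau> * (cA * h powr (r - 1))) * L2H_norm \<Omega> r T (dU 1)
      + sqrt \<tau> * (cA * h powr (r - 1)) * L2H_norm \<Omega> r T (dU 0) + sqrt \<tau> * (cR * \<tau> ^ \<nu> * Cs)"
  shows "0 \<le> E" "E \<le> (cA + cR) * error_bound \<Omega> r T \<nu> \<delta> h \<tau> dU Cs"
proof -
  define a where "a = h powr r"
  define g where "g = h powr (r - 1)"
  define S where "S = (\<Sum>j\<le>2. L2H_norm \<Omega> r T (dU j))"
  define M where "M = (\<Sum>j\<le>1. LinfH_norm \<Omega> r T (dU j))"
  define p0 where "p0 = L2H_norm \<Omega> r T (dU 0)"
  define p1 where "p1 = L2H_norm \<Omega> r T (dU 1)"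
  define q where "q = \<tau> ^ \<nu> * Cs"
  have L: "0 \<le> L2H_norm \<Omega> r T V" for V :: "real \<Rightarrow> ('a, 'b) field"
    by (auto simp: L2H_norm_def intro!: Bochner_Integration.integral_nonneg)
  have nn: "0 \<le> a" "0 \<le> g" "0 \<le> S" "0 \<le> M" "0 \<le> p0" "0 \<le> p1" "0 \<le> q"
    using pos Cs L unfolding a_def g_def S_def M_def p0_def p1_def q_def
    by (auto intro!: sum_nonneg LinfH_norm_nonneg simp del: sum.atMost_Suc)
  have \<delta>: "\<delta> powr (- 1 / 2) = 1 / sqrt \<delta>"
    using pos by (simp add: powr_minus powr_half_sqrt inverse_eq_divide)
  have \<tau>: "\<tau> powr (real \<nu> + 1 / 2) = \<tau> ^ \<nu> * sqrt \<tau>"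
    using pos by (simp add: powr_add powr_realpow powr_half_sqrt)
  have E': "E = cA * (sqrt \<delta> * g * S) + cA * (a / sqrt \<delta> * S) + cR * q + cA * (sqrt \<tau> * (a + \<tau> * g) * p1)
      + cA * (sqrt \<tau> * g * p0) + cR * (sqrt \<tau> * q)"
    unfolding E a_def[symmetric] g_def[symmetric] S_def[symmetric] p0_def[symmetric] p1_def[symmetric] q_def
    by (simp add: algebra_simps)
  define t where "t = sqrt \<delta> * g * S + a / sqrt \<delta> * S + q + sqrt \<tau> * (a + \<tau> * g) * p1
      + sqrt \<tau> * g * p0 + sqrt \<tau> * q"
  have B: "error_bound \<Omega> r T \<nu> \<delta> h \<tau> dU Cs
      = (a + \<delta> * g) * LinfH_norm \<Omega> r T (dU 0) + ((1 + sqrt T) * sqrt \<delta> * g + a / sqrt \<delta>) * (S + M)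
        + (1 + sqrt T) * q + sqrt \<tau> * (a + \<tau> * g) * p1 + sqrt \<tau> * g * p0 + sqrt \<tau> * q"
    unfolding error_bound_def reg_norm2_def \<delta> \<tau> a_def g_def S_def M_def p0_def p1_def q_def
    by (simp add: mult_ac)
  have n: "0 \<le> sqrt \<delta> * g * S" "0 \<le> a / sqrt \<delta> * S" "0 \<le> sqrt \<tau> * (a + \<tau> * g) * p1"
    "0 \<le> sqrt \<tau> * g * p0" "0 \<le> sqrt \<tau> * q"
    using nn pos by auto
  show "0 \<le> E" unfolding E' using nn pos c by auto
  have "E \<le> (cA + cR) * t"
    unfolding E' t_def distrib_left[of "cA + cR"]
    using n nn(7) c by (intro add_mono mult_right_mono) auto
  also have "t \<le> error_bound \<Omega> r T \<nu> \<delta> h \<tau> dU Cs"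
  proof -
    have "sqrt \<delta> * g * S + a / sqrt \<delta> * S = (1 * sqrt \<delta> * g + a / sqrt \<delta>) * S"
      by (simp add: distrib_right)
    also have "\<dots> \<le> ((1 + sqrt T) * sqrt \<delta> * g + a / sqrt \<delta>) * (S + M)"
      using nn pos by (intro mult_mono add_mono mult_right_mono) auto
    finally have "sqrt \<delta> * g * S + a / sqrt \<delta> * S \<le> ((1 + sqrt T) * sqrt \<delta> * g + a / sqrt \<delta>) * (S + M)" .
    moreover have "q \<le> (1 + sqrt T) * q" using nn pos by (simp add: distrib_right)
    moreover have "0 \<le> (a + \<delta> * g) * LinfH_norm \<Omega> r T (dU 0)"
      using nn pos by (intro mult_nonneg_nonneg LinfH_norm_nonneg) auto
    ultimately show ?thesis unfolding B t_def by linarith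
  qed
  finally show "E \<le> (cA + cR) * error_bound \<Omega> r T \<nu> \<delta> h \<tau> dU Cs"
    using c by (simp add: mult_left_mono)
qed

theorem theorem3p2:
  fixes \<Omega> :: "(real^'d) set"
    and \<V> :: "('d::finite, 'm::finite) field set"
    and G :: "('d, 'm) field \<Rightarrow> ('d, 'm) field"
    and T s r \<kappa> cE CE cA cR cR1 cR2 :: real
    and l n0 k \<nu> :: nat
    and b :: "nat \<Rightarrow> real"
  assumes "lipschitz_domain \<Omega>"
    and "lin_subspace \<V>" and "\<V> \<subseteq> sobolev \<Omega> 1" and "l2_dense \<Omega> \<V>"
    and "first_order_operator \<Omega> \<V> G" and "skew_symmetric \<Omega> \<V> G"
    and "0 < T" and "1 \<le> s" and "r = min s (real k + 1)"
    and "l \<le> n0" and "1 \<le> n0"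
    and "0 < \<kappa>" and "0 < cE" and "0 < CE" and "0 < cA" and "0 < cR" and "0 < cR1" and "0 < cR2"
  shows "\<exists>C>0. \<forall>(F :: real \<Rightarrow> ('d, 'm) field) U0 dU
           (CT :: real \<Rightarrow> nat \<Rightarrow> (real \<Rightarrow> ('d, 'm) field) \<Rightarrow> (real \<Rightarrow> ('d, 'm) field) \<Rightarrow> real)
           (CTs :: real \<Rightarrow> nat \<Rightarrow> (real \<Rightarrow> ('d, 'm) field) \<Rightarrow> (real \<Rightarrow> ('d, 'm) field) \<Rightarrow> real)
           \<T> Vh Ph h \<delta> \<tau> N e d Uh.
      exact_solution \<Omega> \<V> G r T F U0 dU \<longrightarrow>
      0 \<le> CT T (\<nu> + 1) (dU 0) F \<longrightarrow>
      CT T (\<nu> + 1) (dU 0) F \<le> CTs T (\<nu> + 2) (dU 0) F \<longrightarrow>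
      shape_regular_mesh \<Omega> \<kappa> \<T> \<longrightarrow> h = mesh_size \<T> \<longrightarrow>
      fe_space \<V> k \<T> Vh \<longrightarrow> l2_projection \<Omega> Vh Ph \<longrightarrow>
      0 < \<delta> \<longrightarrow> \<delta> \<le> 1 \<longrightarrow> 0 < \<tau> \<longrightarrow> n0 \<le> N \<longrightarrow> real N * \<tau> \<le> T \<longrightarrow>
      energy_quantity \<Omega> Vh n0 N e \<longrightarrow> energy_quantity \<Omega> Vh n0 N d \<longrightarrow>
      energy_hypothesis \<Omega> G l b n0 cE CE Vh \<delta> \<tau> N e d \<longrightarrow>
      (\<forall>j\<le>2. \<forall>t\<in>{0..T}.
         l2norm \<Omega> (\<lambda>x. dU j t x - Ph (dU j t) x)
           + h * l2norm \<Omega> (G (\<lambda>x. dU j t x - Ph (dU j t) x))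
         \<le> cA * h powr r * sobolev_norm \<Omega> r (dU j t)) \<longrightarrow>
      lt2norm \<Omega> \<tau> n0 N (residual G l b \<tau> (dU 0) F)
         \<le> cR * \<tau> ^ \<nu> * CT T (\<nu> + 1) (dU 0) F \<longrightarrow>
      Max ((\<lambda>n. l2norm \<Omega> (residual G l b \<tau> (dU 0) F n)) ` {n0..N})
         \<le> cR1 * \<tau> ^ \<nu> * CTs T (\<nu> + 2) (dU 0) F \<longrightarrow>
      lt2norm \<Omega> \<tau> n0 (N - 1) (Dplus \<tau> (residual G l b \<tau> (dU 0) F))
         \<le> cR2 * \<tau> ^ \<nu> * CTs T (\<nu> + 2) (dU 0) F \<longrightarrow>
      (\<forall>n\<le>N. Uh n \<in> Vh) \<longrightarrow>
      (\<forall>j<n0. eq_ae \<Omega> (Uh j) (Ph (sampled \<tau> (dU 0) j))) \<longrightarrow>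
      (\<forall>n\<in>{n0..N}. \<forall>W\<in>Vh.
         ip \<Omega> (Aop G l b \<tau> Uh n) (Top G \<delta> W)
           = ip \<Omega> (Mavg l b (sampled \<tau> F) n) (Top G \<delta> W)) \<longrightarrow>
      Max ((\<lambda>n. l2norm \<Omega> (Top G \<delta> (\<lambda>x. Uh n x - sampled \<tau> (dU 0) n x))) ` {n0..N})
         \<le> C * error_bound \<Omega> r T \<nu> \<delta> h \<tau> dU (CTs T (\<nu> + 2) (dU 0) F)
      \<and> sqrt (\<tau> * \<delta> * (\<Sum>n=n0..N.
           (l2norm \<Omega> (Aop G l b \<tau> (\<lambda>j x. Uh j x - Ph (sampled \<tau> (dU 0) j) x) n))\<^sup>2))
         \<le> C * error_bound \<Omega> r T \<nu> \<delta> h \<tau> dU (CTs T (\<nu> + 2) (dU 0) F)"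
proof -
  define W where "W = (\<Sum>j\<le>l. \<bar>b j\<bar>)"
  \<comment> \<open>The first summand bounds the discrete error, the second one the projection error.\<close>
  define K where "K = stability_constant W T (4 * CE / cE) + embedding_constant T"
  define C where "C = K * (cA + (cR + cR1 + cR2))"
  have "0 \<le> W" unfolding W_def by (intro sum_nonneg) auto
  then have K0: "0 < stability_constant W T (4 * CE / cE)" "0 < embedding_constant T" "0 < K"
    using assms by (auto simp: K_def intro!: stability_constant_pos add_pos_pos)
  have V_L2: "\<V> \<subseteq> L2 \<Omega>" using assms(3) by (auto simp: sobolev_def)
  interpret skew_operator "L2 \<Omega> :: ('d, 'm) field set" "ip \<Omega>" \<V> G
    rewrites nrm: "semi_inner_space.nrm (ip \<Omega>) = l2norm \<Omega>"
    using assms V_L2 by (auto intro!: skew_operator_L2 simp: nrm_L2)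
  show ?thesis
  proof (intro exI[of _ C] conjI allI impI)
    show "0 < C" using K0 assms by (auto simp: C_def intro!: mult_pos_pos add_pos_pos)
  next
    fix F :: "real \<Rightarrow> ('d, 'm) field" and U0 dU
      and CT CTs :: "real \<Rightarrow> nat \<Rightarrow> (real \<Rightarrow> ('d, 'm) field) \<Rightarrow> (real \<Rightarrow> ('d, 'm) field) \<Rightarrow> real"
      and \<T> Vh Ph h \<delta> \<tau> N e d Uh
    assume exact: "exact_solution \<Omega> \<V> G r T F U0 dU"
      and CT: "0 \<le> CT T (\<nu> + 1) (dU 0) F" "CT T (\<nu> + 1) (dU 0) F \<le> CTs T (\<nu> + 2) (dU 0) F"
      and mesh: "shape_regular_mesh \<Omega> \<kappa> \<T>" "h = mesh_size \<T>"
      and Vh: "fe_space \<V> k \<T> Vh" "l2_projection \<Omega> Vh Ph"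
      and \<delta>_range: "0 < \<delta>" "\<delta> \<le> 1" and \<tau>: "0 < \<tau>" "n0 \<le> N" "real N * \<tau> \<le> T"
      and "energy_quantity \<Omega> Vh n0 N e" "energy_quantity \<Omega> Vh n0 N d"
      and EH: "energy_hypothesis \<Omega> G l b n0 cE CE Vh \<delta> \<tau> N e d"
      and approx: "\<forall>j\<le>2. \<forall>t\<in>{0..T}. l2norm \<Omega> (\<lambda>x. dU j t x - Ph (dU j t) x)
           + h * l2norm \<Omega> (G (\<lambda>x. dU j t x - Ph (dU j t) x))
         \<le> cA * h powr r * sobolev_norm \<Omega> r (dU j t)"
      and res: "lt2norm \<Omega> \<tau> n0 N (residual G l b \<tau> (dU 0) F) \<le> cR * \<tau> ^ \<nu> * CT T (\<nu> + 1) (dU 0) F"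
        "Max ((\<lambda>n. l2norm \<Omega> (residual G l b \<tau> (dU 0) F n)) ` {n0..N})
         \<le> cR1 * \<tau> ^ \<nu> * CTs T (\<nu> + 2) (dU 0) F"
        "lt2norm \<Omega> \<tau> n0 (N - 1) (Dplus \<tau> (residual G l b \<tau> (dU 0) F))
         \<le> cR2 * \<tau> ^ \<nu> * CTs T (\<nu> + 2) (dU 0) F"
      and Uh: "\<forall>n\<le>N. Uh n \<in> Vh" "\<forall>j<n0. eq_ae \<Omega> (Uh j) (Ph (sampled \<tau> (dU 0) j))"
      and scheme: "\<forall>n\<in>{n0..N}. \<forall>W\<in>Vh. ip \<Omega> (Aop G l b \<tau> Uh n) (Top G \<delta> W)
           = ip \<Omega> (Mavg l b (sampled \<tau> F) n) (Top G \<delta> W)"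

    define Cs where "Cs = CTs T (\<nu> + 2) (dU 0) F"
    define u where "u = sampled \<tau> (dU 0)"
    define X where "X j t = dU j t - Ph (dU j t)" for j t
    define \<eta> where "\<eta> n = X 0 (real n * \<tau>)" for n
    define \<phi> where "\<phi> n = Uh n - Ph (u n)" for n
    define \<rho> where "\<rho> = residual G l b \<tau> (dU 0) F"
    define P where "P = (cR + cR1 + cR2) * \<tau> ^ \<nu> * Cs"
    \<comment> \<open>The factor \<open>h\<close> in front of the graph norm costs one power of \<open>h\<close>.\<close>
    define \<beta> where "\<beta> = cA * h powr (r - 1)"
    define g where "g j t = sobolev_norm \<Omega> r (dU j t)" for j t

    have h: "0 < h" using mesh assms(1) mesh_size_pos by (auto simp: lipschitz_domain_def)
    have Cs0: "0 \<le> Cs" using CT by (simp add: Cs_def)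
    have tn: "real n * \<tau> \<in> {0..T}" if "n \<le> N" for n
    proof -
      have "real n * \<tau> \<le> real N * \<tau>" using that \<tau> by (intro mult_right_mono) auto
      moreover have "0 \<le> real n * \<tau>" using \<tau> by simp
      ultimately show ?thesis unfolding atLeastAtMost_iff using \<tau>(3) by linarith
    qed
    have dU: "dU j t \<in> \<V>" "dU j \<in> L2H \<Omega> r T" if "j \<le> 2" "t \<in> {0..T}" for j t
      using exact that by (auto simp: exact_solution_def)
    have uV: "u n \<in> \<V>" if "n \<le> N" for n
      using dU(1)[of 0 "real n * \<tau>"] tn[OF that] by (simp add: u_def sampled_def)
    have FL2: "sampled \<tau> F n \<in> L2 \<Omega>" if "n \<le> N" for n
      using exact tn[OF that] by (simp add: exact_solution_def sampled_def)
    have Vh': "subspace Vh" "Vh \<subseteq> \<V>" using Vh(1) by (auto simp: fe_space_def subspace_lin_subspace)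
    have Ph: "Ph v \<in> Vh" "\<And>w. w \<in> Vh \<Longrightarrow> ip \<Omega> (v - Ph v) w = 0" if "v \<in> L2 \<Omega>" for v
      using Vh(2) that by (auto simp: l2_projection_def fun_diff_def)
    have PhV: "Ph v \<in> \<V>" if "v \<in> L2 \<Omega>" for v using Ph(1)[OF that] Vh' by auto
    have XV: "X j t \<in> \<V>" if "j \<le> 2" "t \<in> {0..T}" for j t
      unfolding X_def using dU(1)[OF that] by (intro V_diff PhV) auto
    have \<eta>_eq: "\<eta> n = u n - Ph (u n)" for n by (simp add: \<eta>_def X_def u_def sampled_def)
    have \<phi>_fun: "(\<lambda>j x. Uh j x - Ph (sampled \<tau> (dU 0) j) x) = \<phi>"
      by (simp add: \<phi>_def u_def fun_eq_iff)
    have \<rho>_eq: "\<rho> n = material l b \<tau> u n - wavg l b (sampled \<tau> F) n" for n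
      by (simp add: \<rho>_def residual_def material_def u_def Dminus_eq Mavg_eq fun_eq_iff)
    have \<phi>Vh: "\<phi> n \<in> Vh" if "n \<le> N" for n
      unfolding \<phi>_def using Vh' Uh(1) Ph(1) uV[OF that] that by (intro subspace_diff) auto
    have WF: "wavg l b (sampled \<tau> F) n \<in> L2 \<Omega>" if "n \<le> N" for n
      unfolding wavg_def using FL2 that by (intro H_sum H_scale) auto
    have uM: "material l b \<tau> u n \<in> L2 \<Omega>" if "n \<le> N" for n
      unfolding material_def using uV that by (intro H_add G_H V_wavg V_H V_bdiff) auto

    interpret scheme_error "L2 \<Omega> :: ('d, 'm) field set" "ip \<Omega>" \<V> G Vh l n0 N b \<tau> \<delta> T \<phi> \<eta> \<rho>
      rewrites "semi_inner_space.nrm (ip \<Omega>) = l2norm \<Omega>"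
    proof -
      show "scheme_error (L2 \<Omega>) (ip \<Omega>) \<V> G Vh l n0 N \<tau> \<delta> T \<phi> \<eta> \<rho>"
      proof
        fix j assume j: "j < n0"
        then have jN: "j \<le> N" using \<tau> by simp
        have m: "Uh j \<in> L2 \<Omega>" "Ph (u j) \<in> L2 \<Omega>" using jN Uh(1) Vh' uV PhV by auto
        have "eq_ae \<Omega> (\<phi> j) 0" using Uh(2) j by (simp add: eq_ae_def \<phi>_def u_def)
        then have "l2norm \<Omega> (\<phi> j) = l2norm \<Omega> (0 :: ('d, 'm) field)"
          using m by (intro l2norm_cong_AE) (auto simp: \<phi>_def)
        then show "semi_inner_space.nrm (ip \<Omega>) (\<phi> j) = 0"
          unfolding nrm by (simp add: l2norm_def ip_def)
      next
        fix n assume n: "n \<le> N"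
        show "\<eta> n \<in> \<V>" unfolding \<eta>_def using tn[OF n] by (intro XV) auto
        show "ip \<Omega> (\<eta> n) w = 0" if "w \<in> Vh" for w
          unfolding \<eta>_eq using uV[OF n] that by (intro Ph(2)) auto
        show "\<rho> n \<in> L2 \<Omega>" unfolding \<rho>_eq using WF[OF n] uM[OF n] by simp
      qed (use assms \<tau> \<delta>_range Vh' \<phi>Vh in auto)
    qed (rule nrm)

    \<comment> \<open>The scheme, the projected solution and the exact solution combine to \<open>A \<phi> = A \<eta> - \<rho>\<close>, tested.\<close>
    have galerkin: "ip \<Omega> (Aop G l b \<tau> \<phi> n) (Top G \<delta> w) = ip \<Omega> (forcing n) (Top G \<delta> w)"
      if n: "n \<in> {n0..N}" and w: "w \<in> Vh" for n w
    proof -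
      have nN: "n \<le> N" using n by simp
      have wV: "w \<in> \<V>" using w Vh' by auto
      have z: "Top G \<delta> w \<in> L2 \<Omega>" unfolding Top_eq using wV by simp
      have V: "Uh j \<in> \<V>" "u j \<in> \<V>" "Ph (u j) \<in> \<V>" if "j \<le> n" for j
        using that nN Uh(1) Vh' uV PhV by auto
      have A: "Aop G l b \<tau> \<psi> n = material l b \<tau> \<psi> n" for \<psi> by (simp add: Aop_eq material_def)
      have seqs: "\<phi> = (\<lambda>n. Uh n - Ph (u n))" "\<eta> = (\<lambda>n. u n - Ph (u n))"
        by (simp_all add: fun_eq_iff \<phi>_def \<eta>_eq)
      let ?z = "Top G \<delta> w"
      have "ip \<Omega> (material l b \<tau> \<phi> n) ?z
          = ip \<Omega> (material l b \<tau> Uh n) ?z - ip \<Omega> (material l b \<tau> (\<lambda>n. Ph (u n)) n) ?z"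
        unfolding seqs by (intro ip_material_diff V z)
      moreover have "ip \<Omega> (material l b \<tau> \<eta> n) ?z
          = ip \<Omega> (material l b \<tau> u n) ?z - ip \<Omega> (material l b \<tau> (\<lambda>n. Ph (u n)) n) ?z"
        unfolding seqs by (intro ip_material_diff V z)
      moreover have "ip \<Omega> (material l b \<tau> Uh n) ?z = ip \<Omega> (wavg l b (sampled \<tau> F) n) ?z"
        using scheme n w by (simp add: A[symmetric] Mavg_eq)
      moreover have "ip \<Omega> (forcing n) ?z = ip \<Omega> (material l b \<tau> \<eta> n) ?z
          - (ip \<Omega> (material l b \<tau> u n) ?z - ip \<Omega> (wavg l b (sampled \<tau> F) n) ?z)"
        unfolding forcing_def \<rho>_eq using nN z uM[OF nN] WF[OF nN] by (simp add: ip_simps)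
      ultimately show ?thesis by (simp add: A)
    qed
    have I0: "Iinit \<Omega> G \<delta> n0 \<phi> = 0"
      using nrm_\<phi>_init_stabilized(1) by (simp add: Iinit_def Top_eq)
    have lower: "cE * (l2norm \<Omega> (\<phi> n + \<delta> *\<^sub>R G (\<phi> n)))\<^sup>2 \<le> e n \<phi>"
      "cE * \<delta> * (l2norm \<Omega> (material l b \<tau> \<phi> n))\<^sup>2 \<le> d n \<phi>" if "n0 \<le> n" "n \<le> N" for n
      using EH \<phi>Vh that unfolding energy_hypothesis_def Top_eq Aop_eq material_def by auto
    have energy: "e m \<phi> + \<tau> * (\<Sum>n=n0..m. d n \<phi>)
        \<le> CE * \<tau> * (\<Sum>n=n0..m. ip \<Omega> (forcing n) (multiplier n))
          + CE * \<tau> * (l2seq \<tau> {n0..m} (\<lambda>n. l2norm \<Omega> (forcing n)))\<^sup>2" if m: "n0 \<le> m" "m \<le> N" for m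
    proof -
      have "\<forall>n\<in>{n0..N}. forcing n \<in> L2 \<Omega>" by auto
      then have "e m \<phi> + \<tau> * (\<Sum>n=n0..m. d n \<phi>) \<le> CE * Iinit \<Omega> G \<delta> n0 \<phi>
          + CE * \<tau> * (\<Sum>n=n0..m. ip \<Omega> (forcing n) (Pop G l b \<tau> \<delta> \<phi> n))
          + CE * \<tau> * (lt2norm \<Omega> \<tau> n0 m forcing)\<^sup>2"
        using EH \<phi>Vh galerkin m unfolding energy_hypothesis_def by auto
      then show ?thesis by (simp add: I0 Pop_eq multiplier_def lt2norm_eq)
    qed
    have X_deriv: "path_derivative T (X 0) (X 1)" "path_derivative T (X 1) (X 2)"
    proof -
      have "path_derivative T (dU j) (dU (Suc j))" if "j < 2" for j
        using exact that dU(1)[of j] dU(1)[of "Suc j"]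
        by (auto simp: path_derivative_def exact_solution_def has_time_derivative_def
            fun_diff_def scaleR_fun_def)
      then have "path_derivative T (X j) (X (Suc j))" if "j < 2" for j
        unfolding X_def using Vh' Ph that V_L2
        by (intro path_derivative_projection_error[of T "dU j" "dU (Suc j)" Vh]) auto
      from this[of 0] this[of 1] show "path_derivative T (X 0) (X 1)" "path_derivative T (X 1) (X 2)"
        by (auto simp: numeral_2_eq_2)
    qed
    have bounds: "l2norm \<Omega> (X j t) \<le> cA * h powr r * g j t" "l2norm \<Omega> (G (X j t)) \<le> \<beta> * g j t"
      if "j \<le> 2" "t \<in> {0..T}" for j t
    proof -
      have *: "l2norm \<Omega> (X j t) + h * l2norm \<Omega> (G (X j t)) \<le> cA * h powr r * g j t"
        using approx that by (simp add: X_def g_def fun_diff_def)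
      have nn: "0 \<le> l2norm \<Omega> (X j t)" "0 \<le> h * l2norm \<Omega> (G (X j t))"
        using XV[OF that] h by auto
      show "l2norm \<Omega> (X j t) \<le> cA * h powr r * g j t" using * nn by simp
      have "h * l2norm \<Omega> (G (X j t)) \<le> h * (\<beta> * g j t)"
        using * nn h by (simp add: \<beta>_def powr_diff)
      then show "l2norm \<Omega> (G (X j t)) \<le> \<beta> * g j t" using h by simp
    qed
    have P_ge: "cR * \<tau> ^ \<nu> * CT T (\<nu> + 1) (dU 0) F \<le> P" "cR1 * \<tau> ^ \<nu> * Cs \<le> P" "cR2 * \<tau> ^ \<nu> * Cs \<le> P"
    proof -
      have "cR * \<tau> ^ \<nu> * CT T (\<nu> + 1) (dU 0) F \<le> cR * \<tau> ^ \<nu> * Cs"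
        using CT assms \<tau> unfolding Cs_def by (intro mult_left_mono) auto
      also have "\<dots> \<le> P" unfolding P_def using assms \<tau> Cs0 by (intro mult_right_mono) auto
      finally show "cR * \<tau> ^ \<nu> * CT T (\<nu> + 1) (dU 0) F \<le> P" .
      show "cR1 * \<tau> ^ \<nu> * Cs \<le> P" "cR2 * \<tau> ^ \<nu> * Cs \<le> P"
        unfolding P_def using assms \<tau> Cs0 by (auto intro!: mult_right_mono)
    qed
    have residual_bounds: "l2seq \<tau> {n0..N} (\<lambda>n. l2norm \<Omega> (\<rho> n)) \<le> P"
      "l2seq \<tau> {n0..N - 1} (\<lambda>n. l2norm \<Omega> (fdiff \<tau> \<rho> n)) \<le> P"
      using res(1,3) P_ge by (auto simp: lt2norm_eq Dplus_eq \<rho>_def Cs_def)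
    have residual_max: "l2norm \<Omega> (\<rho> n) \<le> P" if "n0 \<le> n" "n \<le> N" for n
    proof -
      have "l2norm \<Omega> (\<rho> n) \<le> Max ((\<lambda>n. l2norm \<Omega> (residual G l b \<tau> (dU 0) F n)) ` {n0..N})"
        unfolding \<rho>_def using that by (intro Max_ge) auto
      then show ?thesis using res(2) P_ge(2) by (simp add: Cs_def)
    qed
    have g: "sq_integrable T (g j)" "l2time T (g j) = L2H_norm \<Omega> r T (dU j)" if "j \<le> 2" for j
      using sq_integrable_L2H[OF dU(2)[OF that tn[of 0]]] by (simp_all add: g_def[abs_def])

    define E where "E = (sqrt \<delta> * \<beta> + cA * h powr r / sqrt \<delta>) * (\<Sum>j\<le>2. l2time T (g j)) + P
      + sqrt \<tau> * (cA * h powr r + \<tau> * \<beta>) * l2time T (g 1) + sqrt \<tau> * \<beta> * l2time T (g 0) + sqrt \<tau> * P"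
    have "E = (sqrt \<delta> * (cA * h powr (r - 1)) + cA * h powr r / sqrt \<delta>) * (\<Sum>j\<le>2. L2H_norm \<Omega> r T (dU j))
      + (cR + cR1 + cR2) * \<tau> ^ \<nu> * Cs
      + sqrt \<tau> * (cA * h powr r + \<tau> * (cA * h powr (r - 1))) * L2H_norm \<Omega> r T (dU 1)
      + sqrt \<tau> * (cA * h powr (r - 1)) * L2H_norm \<Omega> r T (dU 0)
      + sqrt \<tau> * ((cR + cR1 + cR2) * \<tau> ^ \<nu> * Cs)"
      unfolding E_def \<beta>_def P_def by (simp add: g)
    moreover have "0 \<le> cA" "0 \<le> cR + cR1 + cR2" using assms by auto
    ultimately have E: "0 \<le> E" "E \<le> (cA + (cR + cR1 + cR2)) * error_bound \<Omega> r T \<nu> \<delta> h \<tau> dU Cs"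
      using abstract_bound_le_error_bound[OF \<open>0 < T\<close> \<delta>_range(1) \<tau>(1) h _ _ Cs0] by blast+
    have KE: "K * E \<le> C * error_bound \<Omega> r T \<nu> \<delta> h \<tau> dU Cs"
      using mult_left_mono[OF E(2), of K] K0 by (simp add: C_def mult.assoc)

    have \<beta>0: "0 \<le> \<beta>" and \<alpha>0: "0 \<le> cA * h powr r" using assms by (auto simp: \<beta>_def)
    have \<eta>_fun: "\<eta> = (\<lambda>n. X 0 (real n * \<tau>))" by (simp add: \<eta>_def fun_eq_iff)
    note estimate = error_estimate[OF \<open>0 < cE\<close> \<open>0 < CE\<close> \<delta>_range(2) \<open>0 < T\<close> _ _ _ \<eta>_fun X_deriv
      _ _ \<alpha>0 _ \<beta>0 _ residual_bounds(1) _ residual_bounds(2) E_def,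
      where e = "\<lambda>n. e n \<phi>" and d = "\<lambda>n. d n \<phi>", folded W_def]
    have \<phi>_le: "l2norm \<Omega> (\<phi> n + \<delta> *\<^sub>R G (\<phi> n)) \<le> stability_constant W T (4 * CE / cE) * E"
      if "n0 \<le> n" "n \<le> N" for n
      by (rule estimate(1)) ((erule (1) lower energy XV bounds residual_max | erule g)+, fact+)
    have A\<phi>_le: "sqrt \<delta> * l2seq \<tau> {n0..N} (\<lambda>n. l2norm \<Omega> (material l b \<tau> \<phi> n))
        \<le> stability_constant W T (4 * CE / cE) * E"
      by (rule estimate(2)) (erule (1) lower energy XV bounds residual_max | erule g)+
    have \<eta>_le: "l2norm \<Omega> (\<eta> n + \<delta> *\<^sub>R G (\<eta> n)) \<le> embedding_constant T * E" if "n \<le> N" for n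
      by (rule estimate(3)) ((erule (1) lower energy XV bounds residual_max | erule g)+, fact)
    show "Max ((\<lambda>n. l2norm \<Omega> (Top G \<delta> (\<lambda>x. Uh n x - sampled \<tau> (dU 0) n x))) ` {n0..N})
         \<le> C * error_bound \<Omega> r T \<nu> \<delta> h \<tau> dU (CTs T (\<nu> + 2) (dU 0) F)"
    proof (rule Max.boundedI)
      fix y assume "y \<in> (\<lambda>n. l2norm \<Omega> (Top G \<delta> (\<lambda>x. Uh n x - sampled \<tau> (dU 0) n x))) ` {n0..N}"
      then obtain n where n: "n0 \<le> n" "n \<le> N"
        and y: "y = l2norm \<Omega> (Top G \<delta> (\<lambda>x. Uh n x - sampled \<tau> (dU 0) n x))" by auto
      have split: "(\<lambda>x. Uh n x - sampled \<tau> (dU 0) n x) = \<phi> n - \<eta> n"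
        by (simp add: \<phi>_def \<eta>_eq u_def fun_eq_iff)
      have "y = l2norm \<Omega> ((\<phi> n + \<delta> *\<^sub>R G (\<phi> n)) - (\<eta> n + \<delta> *\<^sub>R G (\<eta> n)))"
        unfolding y split Top_eq using n
        by (intro nrm_tested_eq) (auto simp: ip_simps ip_G_diff algebra_simps)
      also have "\<dots> \<le> l2norm \<Omega> (\<phi> n + \<delta> *\<^sub>R G (\<phi> n)) + l2norm \<Omega> (\<eta> n + \<delta> *\<^sub>R G (\<eta> n))"
        using n by (intro nrm_diff_triangle) auto
      also have "\<dots> \<le> stability_constant W T (4 * CE / cE) * E + embedding_constant T * E"
        using n by (intro add_mono \<phi>_le \<eta>_le)
      also have "\<dots> = K * E" by (simp add: K_def distrib_right)
      finally show "y \<le> C * error_bound \<Omega> r T \<nu> \<delta> h \<tau> dU (CTs T (\<nu> + 2) (dU 0) F)"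
        using KE by (simp add: Cs_def)
    qed (use \<tau> in auto)
    show "sqrt (\<tau> * \<delta> * (\<Sum>n=n0..N.
           (l2norm \<Omega> (Aop G l b \<tau> (\<lambda>j x. Uh j x - Ph (sampled \<tau> (dU 0) j) x) n))\<^sup>2))
         \<le> C * error_bound \<Omega> r T \<nu> \<delta> h \<tau> dU (CTs T (\<nu> + 2) (dU 0) F)"
    proof -
      have "sqrt (\<tau> * \<delta> * (\<Sum>n=n0..N. (l2norm \<Omega> (Aop G l b \<tau> \<phi> n))\<^sup>2))
          = sqrt \<delta> * l2seq \<tau> {n0..N} (\<lambda>n. l2norm \<Omega> (material l b \<tau> \<phi> n))"
        by (simp add: Aop_eq material_def l2seq_def L2_set_def real_sqrt_mult mult_ac)
      also have "\<dots> \<le> stability_constant W T (4 * CE / cE) * E" by (rule A\<phi>_le)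
      also have "\<dots> \<le> K * E" using E(1) K0 by (intro mult_right_mono) (auto simp: K_def)
      finally show ?thesis using KE by (simp add: \<phi>_fun Cs_def)
    qed
  qed
qed

end
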